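(* For every integer $n \geq 2$, the generalized $4$-connectivity of the $n$-dimensional burnt pancake graph satisfies $\kappa_4(BP_n) = n-1$.
   Context: Notation: $[n]=\{1,\dots,n\}$, $\bar{i}=-i$, and $[[n]] = [n]\cup\{\bar i : i\in[n]\}$. A signed permutation of $[n]$ is a sequence $x = x_1x_2\cdots x_n$ of elements of $[[n]]$ such that $|x_1||x_2|\cdots|x_n|$ is a permutation of $[n]$. For $1\le i\le n$, the $i$-th signed prefix reversal of $x$ is $x(i) = \bar{x}_i\bar{x}_{i-1}\cdots\bar{x}_1x_{i+1}\cdots x_n$. The $n$-dimensional burnt pancake graph $BP_n$ ($n\ge 2$) is the simple graph whose vertices are all signed permutations of $[n]$, with $x$ and $y$ adjacent if and only if $y = x(i)$ for some $i\in[n]$. Generalized connectivity: for a simple graph $G$ and $S\subseteq V(G)$, an $S$-tree is a tree $T$ in $G$ with $S\subseteq V(T)$. $S$-trees $T_1,\dots,T_r$ are internally edge disjoint if $V(T_i)\cap V(T_j)=S$ and $E(T_i)\cap E(T_j)=\emptyset$ for all $i\neq j$. $\kappa_G(S)$ denotes the maximum number of internally edge disjoint $S$-trees in $G$, and for $2\le k\le |V(G)|$, $\kappa_k(G)=\min\{\kappa_G(S) : S\subseteq V(G),\ |S|=k\}$. *)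

theory Defs
  imports "HOL-Combinatorics.Multiset_Permutations"
begin

text \<open>
  An undirected simple graph is given by its vertex set and its set of edges, each edge being a
  two-element set of vertices. The digraphs of the AFP entry Graph_Theory are not used, as
  acyclicity there refers to directed cycles.
\<close>

record 'a sgraph =
  sg_verts :: "'a set"
  sg_edges :: "'a set set"

definition simple_graph :: "'a sgraph \<Rightarrow> bool" where
  "simple_graph G \<longleftrightarrow> (\<forall>e\<in>sg_edges G. e \<subseteq> sg_verts G \<and> card e = 2)"

definition sg_subgraph :: "'a sgraph \<Rightarrow> 'a sgraph \<Rightarrow> bool" where
  "sg_subgraph H G \<longleftrightarrow>
     simple_graph H \<and> sg_verts H \<subseteq> sg_verts G \<and> sg_edges H \<subseteq> sg_edges G"

definition sg_walk :: "'a sgraph \<Rightarrow> 'a list \<Rightarrow> bool" where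
  "sg_walk G p \<longleftrightarrow> p \<noteq> [] \<and> set p \<subseteq> sg_verts G \<and>
     (\<forall>i. Suc i < length p \<longrightarrow> {p ! i, p ! Suc i} \<in> sg_edges G)"

definition sg_connected :: "'a sgraph \<Rightarrow> bool" where
  "sg_connected G \<longleftrightarrow> sg_verts G \<noteq> {} \<and>
     (\<forall>u\<in>sg_verts G. \<forall>v\<in>sg_verts G. \<exists>p. sg_walk G p \<and> hd p = u \<and> last p = v)"

text \<open>A cycle is listed without repeating its first vertex at the end.\<close>

definition sg_cycle :: "'a sgraph \<Rightarrow> 'a list \<Rightarrow> bool" where
  "sg_cycle G p \<longleftrightarrow>
     sg_walk G p \<and> distinct p \<and> 3 \<le> length p \<and> {last p, hd p} \<in> sg_edges G"

definition sg_tree :: "'a sgraph \<Rightarrow> bool" where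
  "sg_tree T \<longleftrightarrow> simple_graph T \<and> sg_connected T \<and> (\<nexists>p. sg_cycle T p)"

definition S_tree :: "'a sgraph \<Rightarrow> 'a set \<Rightarrow> 'a sgraph \<Rightarrow> bool" where
  "S_tree G S T \<longleftrightarrow> sg_tree T \<and> sg_subgraph T G \<and> S \<subseteq> sg_verts T"

definition internally_edge_disjoint :: "'a set \<Rightarrow> 'a sgraph \<Rightarrow> 'a sgraph \<Rightarrow> bool" where
  "internally_edge_disjoint S T T' \<longleftrightarrow>
     sg_verts T \<inter> sg_verts T' = S \<and> sg_edges T \<inter> sg_edges T' = {}"

text \<open>
  The maximum is over a set containing 0. For a finite simple graph and \<open>card S \<ge> 2\<close> this
  set is also finite, since every \<open>S\<close>-tree then has an edge.
\<close>

definition kappa_set :: "'a sgraph \<Rightarrow> 'a set \<Rightarrow> nat" where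
  "kappa_set G S = Max {r. \<exists>T :: nat \<Rightarrow> 'a sgraph.
     (\<forall>i<r. S_tree G S (T i)) \<and>
     (\<forall>i<r. \<forall>j<r. i \<noteq> j \<longrightarrow> internally_edge_disjoint S (T i) (T j))}"

text \<open>Meaningful for finite \<open>G\<close> and \<open>2 \<le> k \<le> card (sg_verts G)\<close>.\<close>

definition gen_connectivity :: "nat \<Rightarrow> 'a sgraph \<Rightarrow> nat" where
  "gen_connectivity k G = Min {kappa_set G S |S. S \<subseteq> sg_verts G \<and> card S = k}"

text \<open>
  A signed permutation \<open>x\<^sub>1 \<dots> x\<^sub>n\<close> is the list of the integers \<open>x\<^sub>i\<close>, a bar being the
  negative sign. List positions start at 0.
\<close>

definition signed_perms :: "nat \<Rightarrow> int list set" where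
  "signed_perms n = {x. map abs x \<in> permutations_of_set {1..int n}}"

definition prefix_reversal :: "nat \<Rightarrow> int list \<Rightarrow> int list" where
  "prefix_reversal i x = rev (map uminus (take i x)) @ drop i x"

definition burnt_pancake :: "nat \<Rightarrow> int list sgraph" where
  "burnt_pancake n =
     \<lparr>sg_verts = signed_perms n,
      sg_edges = {{x, y} |x y. x \<in> signed_perms n \<and> y \<in> signed_perms n \<and>
                               (\<exists>i\<in>{1..n}. y = prefix_reversal i x)}\<rparr>"

lemma length_signed_perms: "x \<in> signed_perms n \<Longrightarrow> length x = n"
  by (auto simp: signed_perms_def dest: length_finite_permutations_of_set)

lemma map_abs_prefix_reversal:
  "map abs (prefix_reversal i x) = rev (take i (map abs x)) @ drop i (map abs x)"
  by (simp add: prefix_reversal_def rev_map[symmetric] take_map drop_map comp_def)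

lemma prefix_reversal_in_signed_perms:
  assumes "x \<in> signed_perms n"
  shows "prefix_reversal i x \<in> signed_perms n"
proof -
  have "mset (map abs (prefix_reversal i x)) = mset (map abs x)"
    unfolding map_abs_prefix_reversal by (metis append_take_drop_id mset_append mset_rev)
  then show ?thesis
    using assms unfolding signed_perms_def permutations_of_set_def
    by (metis (no_types, lifting) mem_Collect_eq mset_eq_imp_distinct_iff mset_eq_setD)
qed

lemma prefix_reversal_involution:
  "i \<le> length x \<Longrightarrow> prefix_reversal i (prefix_reversal i x) = x"
  by (simp add: prefix_reversal_def rev_map comp_def)

lemma prefix_reversal_neq:
  assumes x: "x \<in> signed_perms n" and i: "i \<in> {1..n}"
  shows "prefix_reversal i x \<noteq> x"
proof
  assume eq: "prefix_reversal i x = x"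
  have len: "length x = n" and dist: "distinct (map abs x)" and set: "set (map abs x) = {1..int n}"
    using x length_signed_perms by (auto simp: signed_perms_def permutations_of_set_def)
  have "prefix_reversal i x ! 0 = - (x ! (i - 1))"
    using i len by (simp add: prefix_reversal_def nth_append rev_nth)
  then have h: "x ! 0 = - (x ! (i - 1))" using eq by simp
  then have "map abs x ! 0 = map abs x ! (i - 1)"
    using i len by (subst (1 2) nth_map) auto
  then have "i - 1 = 0" using dist i len by (subst (asm) nth_eq_iff_index_eq) auto
  then have "x ! 0 = 0" using h by simp
  moreover have "map abs x ! 0 \<in> {1..int n}"
    using i len unfolding set[symmetric] by (intro nth_mem) auto
  ultimately show False using i len by simp
qed

lemma simple_graph_burnt_pancake: "simple_graph (burnt_pancake n)"
  unfolding simple_graph_def burnt_pancake_def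
  using prefix_reversal_neq by (fastforce simp: card_2_iff)

lemma burnt_pancake_adjacent_iff:
  assumes "x \<in> signed_perms n" and "y \<in> signed_perms n"
  shows "{x, y} \<in> sg_edges (burnt_pancake n) \<longleftrightarrow> (\<exists>i\<in>{1..n}. y = prefix_reversal i x)"
proof
  assume "{x, y} \<in> sg_edges (burnt_pancake n)"
  then obtain i where i: "i \<in> {1..n}" and "y = prefix_reversal i x \<or> x = prefix_reversal i y"
    by (auto simp: burnt_pancake_def doubleton_eq_iff)
  then have "y = prefix_reversal i x"
    using assms prefix_reversal_involution[of i] length_signed_perms by auto
  then show "\<exists>i\<in>{1..n}. y = prefix_reversal i x" using i by blast
qed (use assms in \<open>auto simp: burnt_pancake_def\<close>)

end

theory Submission
  imports Defs
begin

text \<open>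
  Call the vertices with last entry \<open>g\<close> the slice \<open>g\<close>, and \<open>\<bar>f\<bar>\<close> the colour of a vertex with first
  entry \<open>f\<close>; reversing such a vertex of the slice \<open>g\<close> completely leads to the slice \<open>- f\<close>.

  If \<open>S\<close> contains two adjacent vertices \<open>u\<close> and \<open>v\<close>, then each of \<open>n\<close> internally edge disjoint
  \<open>S\<close>-trees has exactly one edge at \<open>u\<close> and one at \<open>v\<close>, so the tree that uses the edge \<open>uv\<close> reaches
  no third vertex. Hence \<open>\<kappa>\<^sub>4 \<le> n - 1\<close>.

  For the converse let \<open>n \<ge> 3\<close>. The neighbours of a terminal \<open>x\<close> within its slice have every colour
  but that of the slice, and each of them together with its reversal of length 1 gives access to
  both slices of that colour. A slice stays connected when \<open>x\<close> and all these vertices are removed.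
  So it suffices to assign the slices, as hubs, and the colours at each slice with terminals to
  \<open>n - 1\<close> trees such that every terminal can leave its slice towards a hub of every tree and the
  hubs of one tree are joined to each other. Edges between two terminals of a slice obstruct this;
  each is given to the tree of one of its ends. How the trees are chosen depends on the
  distribution of the four terminals over the slices.
\<close>

section \<open>Spanning trees and packings\<close>

text \<open>A terminal has n - 1 neighbours in its slice, one of each colour but that of the slice,
  and n - 1 trees have to enter through them. Hence all colours but one name the trees. As long as
  the slices with terminals have only one colour, that colour is dropped, and every other colour has
  one of its slices as hub of its tree and the opposite one in reserve. The difficulty begins with a
  second occupied colour: at a slice of that colour the tree so named lacks its entry, another
  colour has to be relabelled for it, and its hubs must be within reach from every occupied slice,
  although opposite slices g and -g are never adjacent.

  Connectivity is available only after removing the neighbourhood of a single vertex. So a slice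
  with terminals can be a hub only if it holds exactly one, and all such hubs are given to one tree,
  which also receives the complete reversals between terminals.

  For n = 3 a slice has so few vertices facing another one that two occupied hubs need not be
  linked. For n = 2 only one tree is asked for.\<close>

definition reach :: "'a set set \<Rightarrow> 'a \<Rightarrow> 'a \<Rightarrow> bool" where
  "reach F u v \<longleftrightarrow> (u, v) \<in> {(a, b). {a, b} \<in> F}\<^sup>*"

lemma reach_refl [simp]: "reach F u u"
  by (simp add: reach_def)

lemma reach_edge: "{u, v} \<in> F \<Longrightarrow> reach F u v"
  by (auto simp: reach_def)

lemma reach_trans [trans]: "reach F u v \<Longrightarrow> reach F v w \<Longrightarrow> reach F u w"
  by (auto simp: reach_def)

lemma reach_sym: "reach F u v \<Longrightarrow> reach F v u"
proof -
  have "sym {(a, b). {a, b} \<in> F}"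
    by (auto simp: sym_def insert_commute)
  then have "sym ({(a, b). {a, b} \<in> F}\<^sup>*)"
    by (rule sym_rtrancl)
  then show "reach F u v \<Longrightarrow> reach F v u"
    by (auto simp: reach_def sym_def)
qed

lemma reach_substitute:
  assumes "reach F u v" and "\<And>a b. {a, b} \<in> F \<Longrightarrow> reach F' a b"
  shows "reach F' u v"
  using assms(1) unfolding reach_def
proof (induction rule: rtrancl_induct)
  case (step y z)
  then have "reach F' y z" using assms(2) by auto
  then show ?case using step by (auto simp: reach_def)
qed simp

lemma reach_mono: "reach F u v \<Longrightarrow> F \<subseteq> F' \<Longrightarrow> reach F' u v"
  by (rule reach_substitute) (auto intro: reach_edge)

lemma reach_invariant:
  assumes "reach F u v" "u \<in> K" "\<And>a b. {a, b} \<in> F \<Longrightarrow> a \<in> K \<Longrightarrow> b \<in> K"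
  shows "v \<in> K"
  using assms(1) unfolding reach_def
  by (induction rule: rtrancl_induct) (use assms in auto)

lemma reach_imp_walk:
  assumes "simple_graph G" "u \<in> sg_verts G" "reach (sg_edges G) u v"
  shows "\<exists>p. sg_walk G p \<and> hd p = u \<and> last p = v"
  using assms(3) unfolding reach_def
proof (induction rule: rtrancl_induct)
  case base
  then show ?case using assms by (intro exI[of _ "[u]"]) (auto simp: sg_walk_def)
next
  case (step y z)
  then obtain p where p: "sg_walk G p" "hd p = u" "last p = y" by blast
  have e: "{y, z} \<in> sg_edges G" using step by auto
  then have "z \<in> sg_verts G" using assms(1) by (auto simp: simple_graph_def)
  moreover have "{(p @ [z]) ! i, (p @ [z]) ! Suc i} \<in> sg_edges G" if "Suc i < length (p @ [z])" for i
  proof (cases "Suc i = length p")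
    case True
    then have "p \<noteq> []" "i = length p - 1" by auto
    then show ?thesis using p e True by (auto simp: nth_append last_conv_nth)
  next
    case False
    then show ?thesis using p(1) that by (auto simp: nth_append sg_walk_def)
  qed
  ultimately have "sg_walk G (p @ [z])" using p(1) by (auto simp: sg_walk_def)
  then show ?case using p by (intro exI[of _ "p @ [z]"]) (auto simp: sg_walk_def)
qed

lemma reach_along:
  assumes "\<And>i. Suc i < length p \<Longrightarrow> {p ! i, p ! Suc i} \<in> F" "j < length p"
  shows "reach F (p ! 0) (p ! j)"
  using assms(2)
proof (induction j)
  case (Suc j)
  then show ?case using assms(1)[of j] reach_trans reach_edge by (metis Suc_lessD)
qed simp

lemma walk_imp_reach: "sg_walk G p \<Longrightarrow> reach (sg_edges G) (hd p) (last p)"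
  using reach_along[of p "sg_edges G" "length p - 1"]
  by (auto simp: sg_walk_def hd_conv_nth last_conv_nth)

lemma sg_connected_iff_reach:
  assumes "simple_graph G"
  shows "sg_connected G \<longleftrightarrow>
    sg_verts G \<noteq> {} \<and> (\<forall>u\<in>sg_verts G. \<forall>v\<in>sg_verts G. reach (sg_edges G) u v)"
proof
  assume c: "sg_connected G"
  have "reach (sg_edges G) u v" if uv: "u \<in> sg_verts G" "v \<in> sg_verts G" for u v
  proof -
    obtain p where p: "sg_walk G p" "hd p = u" "last p = v"
      using c uv unfolding sg_connected_def by blast
    show ?thesis using walk_imp_reach[OF p(1)] p(2,3) by simp
  qed
  with c show "sg_verts G \<noteq> {} \<and> (\<forall>u\<in>sg_verts G. \<forall>v\<in>sg_verts G. reach (sg_edges G) u v)"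
    by (simp add: sg_connected_def)
next
  assume "sg_verts G \<noteq> {} \<and> (\<forall>u\<in>sg_verts G. \<forall>v\<in>sg_verts G. reach (sg_edges G) u v)"
  then show "sg_connected G"
    using reach_imp_walk[OF assms] by (simp add: sg_connected_def)
qed

text \<open>Among the edge sets that still connect V, one of least size is acyclic: the closing edge
  of a cycle could be dropped, since the rest of the cycle joins its ends.\<close>

lemma spanning_tree:
  assumes fin: "finite V" and ne: "V \<noteq> {}" and F: "\<And>e. e \<in> F \<Longrightarrow> e \<subseteq> V \<and> card e = 2"
    and conn: "\<And>u v. u \<in> V \<Longrightarrow> v \<in> V \<Longrightarrow> reach F u v"
  obtains F' where "F' \<subseteq> F" "sg_tree \<lparr>sg_verts = V, sg_edges = F'\<rparr>"
proof -
  define P where "P F' \<longleftrightarrow> F' \<subseteq> F \<and> (\<forall>u\<in>V. \<forall>v\<in>V. reach F' u v)" for F'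
  have finF: "finite F"
    using F fin by (intro finite_subset[of F "Pow V"]) auto
  have "P F" using conn by (auto simp: P_def)
  then obtain F' where F': "P F'" and min: "\<And>F''. P F'' \<Longrightarrow> card F' \<le> card F''"
    using ex_has_least_nat[of P F card] by blast
  let ?T = "\<lparr>sg_verts = V, sg_edges = F'\<rparr>"
  have simple: "simple_graph ?T"
    using F' F by (auto simp: simple_graph_def P_def)
  have "\<not> sg_cycle ?T p" for p
  proof
    assume c: "sg_cycle ?T p"
    let ?e = "{last p, hd p}" and ?F = "F' - {{last p, hd p}}"
    have len: "3 \<le> length p" and d: "distinct p" and e: "?e \<in> F'"
      and w: "\<And>i. Suc i < length p \<Longrightarrow> {p ! i, p ! Suc i} \<in> F'"
      using c by (auto simp: sg_cycle_def sg_walk_def)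
    have "{p ! i, p ! Suc i} \<in> ?F" if i: "Suc i < length p" for i
    proof -
      \<comment> \<open>The closing edge coincides with an edge of the path only if the path has two
        vertices, and a cycle has at least three.\<close>
      have "{p ! i, p ! Suc i} \<noteq> {p ! (length p - 1), p ! 0}"
      proof
        assume "{p ! i, p ! Suc i} = {p ! (length p - 1), p ! 0}"
        then have "p ! i = p ! (length p - 1) \<or> (p ! i = p ! 0 \<and> p ! Suc i = p ! (length p - 1))"
          by (auto simp: doubleton_eq_iff)
        moreover have "0 < length p" "length p - 1 < length p" "i < length p" using i by auto
        ultimately have "i = length p - 1 \<or> (i = 0 \<and> Suc i = length p - 1)"
          using d i by (simp add: nth_eq_iff_index_eq)
        then show False using i len by linarith
      qed
      moreover have "?e = {p ! (length p - 1), p ! 0}"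
        using len last_conv_nth[of p] hd_conv_nth[of p] by (cases "p = []") auto
      ultimately show ?thesis using w[OF i] by auto
    qed
    then have "reach ?F (p ! 0) (p ! (length p - 1))"
      using len by (intro reach_along) auto
    then have hl: "reach ?F (hd p) (last p)"
      using len last_conv_nth[of p] hd_conv_nth[of p] by (cases "p = []") auto
    have "reach ?F a b" if "{a, b} \<in> F'" for a b
    proof (cases "{a, b} = ?e")
      case True
      then show ?thesis using hl reach_sym[OF hl] by (auto simp: doubleton_eq_iff)
    next
      case False
      then show ?thesis using that by (intro reach_edge) auto
    qed
    then have "P ?F"
      using F' unfolding P_def by (blast intro: reach_substitute)
    then have "card F' \<le> card ?F" by (rule min)
    moreover have "finite F'" using F' finF by (auto simp: P_def intro: finite_subset)
    ultimately show False using e card_Diff1_less[of F' ?e] by linarith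
  qed
  then have "sg_tree ?T"
    using simple sg_connected_iff_reach[OF simple] F' ne by (auto simp: sg_tree_def P_def)
  then show thesis using that F' by (auto simp: P_def)
qed

section \<open>Packings of trees and the degree bound\<close>

definition packing :: "'a sgraph \<Rightarrow> 'a set \<Rightarrow> 'i set \<Rightarrow> ('i \<Rightarrow> 'a sgraph) \<Rightarrow> bool" where
  "packing G S I T \<longleftrightarrow> (\<forall>i\<in>I. S_tree G S (T i)) \<and>
     (\<forall>i\<in>I. \<forall>j\<in>I. i \<noteq> j \<longrightarrow> internally_edge_disjoint S (T i) (T j))"

lemma kappa_set_packing: "kappa_set G S = Max {r. \<exists>T :: nat \<Rightarrow> 'a sgraph. packing G S {..<r} T}"
  for G :: "'a sgraph"
  by (simp add: kappa_set_def packing_def Ball_def)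

text \<open>The constructions index trees by colours, whereas \<open>kappa_set\<close> counts with
  indices below r.\<close>

lemma packing_reindex:
  assumes "packing G S I T" "inj_on f J" "f ` J \<subseteq> I"
  shows "packing G S J (T \<circ> f)"
  unfolding packing_def
proof (intro conjI ballI impI)
  fix i assume "i \<in> J"
  then show "S_tree G S ((T \<circ> f) i)"
    using assms by (auto simp: packing_def)
next
  fix i j assume ij: "i \<in> J" "j \<in> J" "i \<noteq> j"
  then have "f i \<in> I" "f j \<in> I" "f i \<noteq> f j"
    using assms(2,3) by (auto dest: inj_onD)
  then show "internally_edge_disjoint S ((T \<circ> f) i) ((T \<circ> f) j)"
    using assms(1) by (simp add: packing_def)
qed

text \<open>A terminal without an edge would be a component of its own, cut off from a second
  terminal.\<close>

lemma tree_edge_at: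
  assumes T: "S_tree G S T" and u: "u \<in> S" and S: "2 \<le> card S"
  shows "\<exists>e\<in>sg_edges T. u \<in> e"
proof (rule ccontr)
  assume no: "\<not> (\<exists>e\<in>sg_edges T. u \<in> e)"
  have "S \<noteq> {u}" using S by auto
  then obtain v where v: "v \<in> S" "v \<noteq> u" using u by blast
  have simple: "simple_graph T" using T by (auto simp: S_tree_def sg_tree_def)
  then have "reach (sg_edges T) u v"
    using T u v sg_connected_iff_reach[OF simple] by (auto simp: S_tree_def sg_tree_def)
  then have "v \<in> {u}" by (rule reach_invariant) (use no in auto)
  then show False using v by simp
qed

text \<open>The trees share no edge, so the edges picked at u in different trees differ.\<close>

lemma packing_edge_choice:
  assumes P: "packing G S {..<r} T" and u: "u \<in> S" and S: "2 \<le> card S"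
  obtains f where "inj_on f {..<r}" "\<forall>i<r. f i \<in> sg_edges (T i) \<and> u \<in> f i"
    "f ` {..<r} \<subseteq> {e \<in> sg_edges G. u \<in> e}"
proof -
  have "\<forall>i\<in>{..<r}. \<exists>e. e \<in> sg_edges (T i) \<and> u \<in> e"
    using P tree_edge_at[OF _ u S] unfolding packing_def by blast
  then obtain f where f: "\<forall>i<r. f i \<in> sg_edges (T i) \<and> u \<in> f i"
    by (metis lessThan_iff)
  have "inj_on f {..<r}"
  proof (rule inj_onI)
    fix i j assume ij: "i \<in> {..<r}" "j \<in> {..<r}" "f i = f j"
    show "i = j"
    proof (rule ccontr)
      assume "i \<noteq> j"
      then have "sg_edges (T i) \<inter> sg_edges (T j) = {}"
        using P ij by (auto simp: packing_def internally_edge_disjoint_def)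
      then show False using f ij by auto
    qed
  qed
  moreover have "sg_edges (T i) \<subseteq> sg_edges G" if "i < r" for i
    using P that by (auto simp: packing_def S_tree_def sg_subgraph_def)
  ultimately show thesis using that[of f] f by blast
qed

lemma packing_le_degree:
  assumes P: "packing G S {..<r} T" and u: "u \<in> S" and S: "2 \<le> card S"
    and fin: "finite {e \<in> sg_edges G. u \<in> e}"
  shows "r \<le> card {e \<in> sg_edges G. u \<in> e}"
proof -
  obtain f where f: "inj_on f {..<r}" "\<forall>i<r. f i \<in> sg_edges (T i) \<and> u \<in> f i"
    "f ` {..<r} \<subseteq> {e \<in> sg_edges G. u \<in> e}"
    by (rule packing_edge_choice[OF P u S])
  then have "card {..<r} \<le> card {e \<in> sg_edges G. u \<in> e}"
    using card_inj_on_le[OF f(1,3) fin] by simp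
  then show ?thesis by simp
qed

text \<open>With as many trees as edges at u, the injective choice of
  \<open>packing_edge_choice\<close> is onto. A second edge of the tree i at u would be the one
  chosen for another tree.\<close>

lemma packing_tight_unique_edge:
  assumes P: "packing G S {..<r} T" and u: "u \<in> S" and S: "2 \<le> card S"
    and fin: "finite {e \<in> sg_edges G. u \<in> e}" and deg: "card {e \<in> sg_edges G. u \<in> e} \<le> r"
    and i: "i < r" "e \<in> sg_edges (T i)" "e' \<in> sg_edges (T i)" "u \<in> e" "u \<in> e'"
  shows "e = e'"
proof -
  obtain f where f: "inj_on f {..<r}" "\<forall>i<r. f i \<in> sg_edges (T i) \<and> u \<in> f i"
    "f ` {..<r} \<subseteq> {e \<in> sg_edges G. u \<in> e}"
    by (rule packing_edge_choice[OF P u S])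
  have img: "f ` {..<r} = {e \<in> sg_edges G. u \<in> e}"
    using f fin deg by (intro card_seteq) (auto simp: card_image)
  have "d = f i" if d: "d \<in> sg_edges (T i)" "u \<in> d" for d
  proof -
    have "d \<in> sg_edges G"
      using P i d by (auto simp: packing_def S_tree_def sg_subgraph_def)
    then obtain j where j: "j < r" "d = f j" using img d by blast
    then have "i = j"
      using P i d f(2) unfolding packing_def internally_edge_disjoint_def by blast
    then show ?thesis using j by simp
  qed
  then show ?thesis using i by metis
qed

lemma packing_adjacent_less_degree:
  assumes P: "packing G S {..<r} T" and uv: "u \<in> S" "v \<in> S" "{u, v} \<in> sg_edges G"
    and S: "3 \<le> card S" and G: "simple_graph G" "finite (sg_verts G)"
    and du: "card {e \<in> sg_edges G. u \<in> e} \<le> d" and dv: "card {e \<in> sg_edges G. v \<in> e} \<le> d"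
  shows "r < d"
proof (rule ccontr)
  assume "\<not> r < d"
  then have r: "d \<le> r" by simp
  have "finite (sg_edges G)"
    using G by (intro finite_subset[of "sg_edges G" "Pow (sg_verts G)"]) (auto simp: simple_graph_def)
  then have fin: "finite {e \<in> sg_edges G. w \<in> e}" for w by simp
  have S2: "2 \<le> card S" using S by simp
  obtain f where f: "inj_on f {..<r}" "\<forall>i<r. f i \<in> sg_edges (T i) \<and> u \<in> f i"
    "f ` {..<r} \<subseteq> {e \<in> sg_edges G. u \<in> e}"
    by (rule packing_edge_choice[OF P uv(1) S2])
  have "f ` {..<r} = {e \<in> sg_edges G. u \<in> e}"
    using f fin du r by (intro card_seteq) (auto simp: card_image)
  then have "{u, v} \<in> f ` {..<r}" using uv by auto
  then obtain i where i: "i < r" "{u, v} = f i" by auto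
  then have e: "{u, v} \<in> sg_edges (T i)" using f(2) by simp
  have "\<not> S \<subseteq> {u, v}"
  proof
    assume "S \<subseteq> {u, v}"
    then have "card S \<le> card {u, v}" by (intro card_mono) auto
    also have "\<dots> \<le> 2" by (simp add: card_insert_if)
    finally show False using S by simp
  qed
  then obtain w where w: "w \<in> S" "w \<notin> {u, v}" by blast
  have T: "S_tree G S (T i)" using P i by (auto simp: packing_def)
  then have simple: "simple_graph (T i)" by (auto simp: S_tree_def sg_tree_def)
  then have "reach (sg_edges (T i)) u w"
    using T uv w sg_connected_iff_reach[OF simple] by (auto simp: S_tree_def sg_tree_def)
  then have "w \<in> {u, v}"
  proof (rule reach_invariant)
    fix a b assume ab: "{a, b} \<in> sg_edges (T i)" "a \<in> {u, v}"
    then have "{a, b} = {u, v}"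
      using packing_tight_unique_edge[OF P uv(1) S2 fin _ i(1) ab(1) e]
        packing_tight_unique_edge[OF P uv(2) S2 fin _ i(1) ab(1) e] du dv r by auto
    then show "b \<in> {u, v}" by auto
  qed simp
  then show False using w by simp
qed

section \<open>Signed permutations and slices\<close>

abbreviation pr :: "nat \<Rightarrow> int list \<Rightarrow> int list" where
  "pr \<equiv> prefix_reversal"

definition sperms :: "int set \<Rightarrow> int list set" where
  "sperms A = {x. distinct (map abs x) \<and> set (map abs x) = A}"

definition slice :: "int set \<Rightarrow> int \<Rightarrow> int list set" where
  "slice A g = {x \<in> sperms A. last x = g}"

text \<open>The dimension is read off the word, so adjacency survives appending a last entry
  (\<open>adj_append\<close>).\<close>

definition adj :: "int list \<Rightarrow> int list \<Rightarrow> bool" where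
  "adj x y \<longleftrightarrow> (\<exists>i\<in>{1..length x}. y = pr i x)"

lemma signed_perms_eq: "signed_perms n = sperms {1..int n}"
  by (auto simp: signed_perms_def sperms_def permutations_of_set_def)

lemma length_pr [simp]: "length (pr i x) = length x"
  by (simp add: prefix_reversal_def)

lemma pr_eq_Nil [simp]: "pr i x = [] \<longleftrightarrow> x = []"
  using length_pr[of i x] by (metis length_0_conv)

lemma pr_sperms: "x \<in> sperms A \<Longrightarrow> pr i x \<in> sperms A"
proof -
  assume x: "x \<in> sperms A"
  have "mset (map abs (pr i x)) = mset (map abs x)"
    unfolding map_abs_prefix_reversal by (metis append_take_drop_id mset_append mset_rev)
  then show ?thesis
    using x unfolding sperms_def
    by (metis (no_types, lifting) mem_Collect_eq mset_eq_imp_distinct_iff mset_eq_setD)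
qed

lemma hd_pr: "1 \<le> i \<Longrightarrow> i \<le> length x \<Longrightarrow> hd (pr i x) = - (x ! (i - 1))"
  by (subst hd_conv_nth) (auto simp: prefix_reversal_def nth_append rev_nth)

lemma last_pr: "i < length x \<Longrightarrow> last (pr i x) = last x"
  by (simp add: prefix_reversal_def)

lemma last_pr_full: "x \<noteq> [] \<Longrightarrow> last (pr (length x) x) = - hd x"
  by (cases x) (auto simp: prefix_reversal_def)

lemma hd_pr_full: "x \<noteq> [] \<Longrightarrow> hd (pr (length x) x) = - last x"
  by (simp add: prefix_reversal_def hd_rev last_map)

lemma pr_1: "x \<noteq> [] \<Longrightarrow> pr (Suc 0) x = - hd x # tl x"
  by (cases x) (auto simp: prefix_reversal_def)

lemma hd_pr_1: "x \<noteq> [] \<Longrightarrow> hd (pr (Suc 0) x) = - hd x"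
  by (simp add: pr_1)

lemma pr_pr: "i \<le> length x \<Longrightarrow> pr i (pr i x) = x"
  by (rule prefix_reversal_involution)

lemma pr_append: "i \<le> length u \<Longrightarrow> pr i (u @ w) = pr i u @ w"
  by (simp add: prefix_reversal_def)

lemma adj_pr: "1 \<le> i \<Longrightarrow> i \<le> length x \<Longrightarrow> adj x (pr i x)"
  by (auto simp: adj_def)

lemma adj_sym: "adj x y \<Longrightarrow> adj y x"
  by (auto simp: adj_def pr_pr intro!: bexI)

lemma adj_commute: "adj x y \<longleftrightarrow> adj y x"
  by (blast intro: adj_sym)

lemma adj_append: "adj u v \<Longrightarrow> adj (u @ w) (v @ w)"
  unfolding adj_def
proof (elim bexE)
  fix i assume "i \<in> {1..length u}" "v = pr i u"
  then show "\<exists>i\<in>{1..length (u @ w)}. v @ w = pr i (u @ w)"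
    by (intro bexI[of _ i]) (auto simp: pr_append)
qed

lemma length_sperms: "x \<in> sperms A \<Longrightarrow> length x = card A"
  by (auto simp: sperms_def dest: distinct_card)

lemma sperms_abs_nth: "x \<in> sperms A \<Longrightarrow> i < length x \<Longrightarrow> \<bar>x ! i\<bar> \<in> A"
  by (auto simp: sperms_def)

lemma sperms_nth_inj:
  assumes "x \<in> sperms A" "i < length x" "j < length x" "\<bar>x ! i\<bar> = \<bar>x ! j\<bar>"
  shows "i = j"
  using assms nth_eq_iff_index_eq[of "map abs x" i j] by (auto simp: sperms_def)

lemma sperms_obtain_index:
  assumes "x \<in> sperms A" "c \<in> A"
  obtains i where "i < length x" "\<bar>x ! i\<bar> = c"
  using assms by (auto simp: sperms_def in_set_conv_nth)

lemma sperms_ends: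
  assumes "x \<in> sperms A" "2 \<le> card A"
  shows "x \<noteq> []" "\<bar>hd x\<bar> \<in> A" "\<bar>last x\<bar> \<in> A" "\<bar>hd x\<bar> \<noteq> \<bar>last x\<bar>"
proof -
  have len: "2 \<le> length x" using assms length_sperms by auto
  then show ne: "x \<noteq> []" by auto
  show "\<bar>hd x\<bar> \<in> A" "\<bar>last x\<bar> \<in> A"
    using assms(1) ne by (auto simp: sperms_def)
  show "\<bar>hd x\<bar> \<noteq> \<bar>last x\<bar>"
    using sperms_nth_inj[OF assms(1), of 0 "length x - 1"] len ne
    by (auto simp: hd_conv_nth last_conv_nth)
qed

lemma finite_sperms: "finite A \<Longrightarrow> finite (sperms A)"
proof -
  assume A: "finite A"
  have "sperms A \<subseteq> {x. set x \<subseteq> A \<union> uminus ` A \<and> length x = card A}"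
  proof
    fix x assume x: "x \<in> sperms A"
    have "set x \<subseteq> A \<union> uminus ` A"
    proof
      fix a assume "a \<in> set x"
      then have "\<bar>a\<bar> \<in> A" using x by (auto simp: sperms_def)
      then show "a \<in> A \<union> uminus ` A"
        by (cases "0 \<le> a") (simp_all add: image_iff, metis minus_minus)
    qed
    then show "x \<in> {x. set x \<subseteq> A \<union> uminus ` A \<and> length x = card A}"
      using length_sperms[OF x] by simp
  qed
  then show ?thesis
    using finite_lists_length_eq[of "A \<union> uminus ` A" "card A"] A finite_subset by auto
qed

lemma sperms_snoc: "x \<in> sperms (A - {\<bar>g\<bar>}) \<Longrightarrow> \<bar>g\<bar> \<in> A \<Longrightarrow> x @ [g] \<in> sperms A"
  by (auto simp: sperms_def)

text \<open>Incomplete prefix reversals fix the last entry, so a slice is a copy of the graph on one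
  symbol less. Connectivity is carried over along this map.\<close>

lemma slice_eq_image:
  assumes "\<bar>g\<bar> \<in> A"
  shows "slice A g = (\<lambda>u. u @ [g]) ` sperms (A - {\<bar>g\<bar>})"
proof (intro equalityI subsetI)
  fix x assume x: "x \<in> slice A g"
  then have "x \<noteq> []" using assms by (auto simp: slice_def sperms_def)
  then have eq: "x = butlast x @ [g]" using x by (auto simp: slice_def)
  then have "butlast x @ [g] \<in> sperms A" using x by (auto simp: slice_def)
  then have "distinct (map abs (butlast x))" "\<bar>g\<bar> \<notin> abs ` set (butlast x)"
    "A = insert \<bar>g\<bar> (abs ` set (butlast x))"
    by (auto simp: sperms_def)
  then have "butlast x \<in> sperms (A - {\<bar>g\<bar>})"
    unfolding sperms_def by (simp add: insert_Diff_if)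
  with eq show "x \<in> (\<lambda>u. u @ [g]) ` sperms (A - {\<bar>g\<bar>})" by blast
next
  fix x assume "x \<in> (\<lambda>u. u @ [g]) ` sperms (A - {\<bar>g\<bar>})"
  then show "x \<in> slice A g"
    using assms by (auto simp: slice_def sperms_snoc)
qed

lemma sperms_nonempty: "finite A \<Longrightarrow> 0 \<notin> A \<Longrightarrow> A \<subseteq> {0..} \<Longrightarrow> sorted_list_of_set A \<in> sperms A"
  by (subst sperms_def) (auto simp: distinct_map subset_iff intro!: inj_onI image_eqI)

lemma between_in_slice:
  assumes "L \<in> sperms (A - {\<bar>f\<bar>, \<bar>g\<bar>})" "\<bar>f\<bar> \<in> A" "\<bar>g\<bar> \<in> A" "\<bar>f\<bar> \<noteq> \<bar>g\<bar>"
  shows "f # L @ [g] \<in> slice A g"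
  using assms by (auto simp: slice_def sperms_def)

text \<open>At least two entries lie between the first and the last one, and changing their signs
  yields the three words. Three are needed in \<open>linked_lone\<close>, where one may be lost at
  either end of a link.\<close>

lemma slice_three:
  assumes A: "finite A" "A \<subseteq> {1..}" and c: "4 \<le> card A" and fg: "\<bar>f\<bar> \<in> A" "\<bar>g\<bar> \<in> A" "\<bar>f\<bar> \<noteq> \<bar>g\<bar>"
  shows "\<exists>x\<in>slice A g. \<exists>y\<in>slice A g. \<exists>z\<in>slice A g. hd x = f \<and> hd y = f \<and> hd z = f \<and>
    x \<noteq> y \<and> x \<noteq> z \<and> y \<noteq> z"
proof -
  let ?B = "A - {\<bar>f\<bar>, \<bar>g\<bar>}"
  let ?L = "sorted_list_of_set ?B"
  have L: "?L \<in> sperms ?B" using A by (intro sperms_nonempty) auto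
  have "card ?B = card A - 2" using fg A by (subst card_Diff_subset) auto
  then have "2 \<le> length ?L" using length_sperms[OF L] c by simp
  then obtain a b r where abr: "?L = a # b # r"
    by (metis One_nat_def Suc_1 Suc_le_length_iff)
  then have "a # b # r \<in> sperms ?B" using L by simp
  then have "(- a) # b # r \<in> sperms ?B" "a # (- b) # r \<in> sperms ?B" by (auto simp: sperms_def)
  note mem = this L[unfolded abr]
  have "a \<in> ?B" "b \<in> ?B" using abr A by (metis list.set_intros set_sorted_list_of_set finite_Diff)+
  then have "a \<noteq> 0" "b \<noteq> 0" using A by auto
  then show ?thesis
    using between_in_slice[OF mem(1) fg] between_in_slice[OF mem(2) fg] between_in_slice[OF mem(3) fg]
    by (intro bexI[of _ "f # (a # b # r) @ [g]"] bexI[of _ "f # (- a # b # r) @ [g]"]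
      bexI[of _ "f # (a # - b # r) @ [g]"]) auto
qed

text \<open>The words differ in the sign of one inner entry. Two suffice where only one can be lost,
  which \<open>near_unique\<close> guarantees for the neighbourhood of a single vertex.\<close>

lemma slice_two:
  assumes A: "finite A" "A \<subseteq> {1..}" and c: "3 \<le> card A" and fg: "\<bar>f\<bar> \<in> A" "\<bar>g\<bar> \<in> A" "\<bar>f\<bar> \<noteq> \<bar>g\<bar>"
  shows "\<exists>x\<in>slice A g. \<exists>y\<in>slice A g. hd x = f \<and> hd y = f \<and> x \<noteq> y"
proof -
  let ?B = "A - {\<bar>f\<bar>, \<bar>g\<bar>}"
  let ?L = "sorted_list_of_set ?B"
  have L: "?L \<in> sperms ?B" using A by (intro sperms_nonempty) auto
  have "card ?B = card A - 2" using fg A by (subst card_Diff_subset) auto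
  then have "1 \<le> length ?L" using length_sperms[OF L] c by simp
  then obtain a r where abr: "?L = a # r"
    by (metis One_nat_def Suc_le_length_iff)
  then have "a # r \<in> sperms ?B" using L by simp
  then have "(- a) # r \<in> sperms ?B" by (auto simp: sperms_def)
  note mem = this L[unfolded abr]
  have "a \<in> ?B" using abr A by (metis list.set_intros(1) set_sorted_list_of_set finite_Diff)
  then have "a \<noteq> 0" using A by auto
  then show ?thesis
    using between_in_slice[OF mem(1) fg] between_in_slice[OF mem(2) fg]
    by (intro bexI[of _ "f # (a # r) @ [g]"] bexI[of _ "f # (- a # r) @ [g]"]) auto
qed

lemma pr_full_slice: "x \<in> sperms A \<Longrightarrow> x \<noteq> [] \<Longrightarrow> pr (length x) x \<in> slice A (- hd x)"
  by (simp add: slice_def pr_sperms last_pr_full)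

section \<open>Connected vertex sets\<close>

definition induced_edges :: "int list set \<Rightarrow> int list set set" where
  "induced_edges X = {{u, v} |u v. u \<in> X \<and> v \<in> X \<and> adj u v}"

definition conn_on :: "int list set \<Rightarrow> bool" where
  "conn_on X \<longleftrightarrow> (\<forall>u\<in>X. \<forall>v\<in>X. reach (induced_edges X) u v)"

lemma induced_edges_iff: "{u, v} \<in> induced_edges X \<longleftrightarrow> u \<in> X \<and> v \<in> X \<and> adj u v"
  by (auto simp: induced_edges_def doubleton_eq_iff adj_commute)

lemma induced_edges_mono: "X \<subseteq> Y \<Longrightarrow> induced_edges X \<subseteq> induced_edges Y"
  by (auto simp: induced_edges_def)

lemma conn_onI_root:
  assumes "\<And>u. u \<in> X \<Longrightarrow> reach (induced_edges X) r u"
  shows "conn_on X"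
  unfolding conn_on_def
proof (intro ballI)
  fix u v assume "u \<in> X" "v \<in> X"
  then show "reach (induced_edges X) u v"
    using reach_trans[OF reach_sym[OF assms] assms] by blast
qed

lemma conn_on_singleton [simp]: "conn_on {x}"
  by (simp add: conn_on_def)

lemma conn_on_reach: "conn_on X \<Longrightarrow> X \<subseteq> Y \<Longrightarrow> u \<in> X \<Longrightarrow> v \<in> X \<Longrightarrow> reach (induced_edges Y) u v"
  unfolding conn_on_def by (rule reach_mono[OF _ induced_edges_mono]) auto

lemma conn_on_star:
  assumes C: "conn_on C" "C \<noteq> {}"
    and Y: "\<And>g. g \<in> P \<Longrightarrow> conn_on (Y g)"
    and link: "\<And>g. g \<in> P \<Longrightarrow> \<exists>u\<in>Y g. \<exists>v\<in>C. adj u v"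
  shows "conn_on (C \<union> (\<Union>g\<in>P. Y g))" (is "conn_on ?X")
proof -
  obtain r where r: "r \<in> C" using C by blast
  have rC: "reach (induced_edges ?X) r v" if "v \<in> C" for v
    using conn_on_reach[OF C(1) Un_upper1 r that] .
  have "reach (induced_edges ?X) r v" if v: "v \<in> Y g" and g: "g \<in> P" for v g
  proof -
    obtain u w where uw: "u \<in> Y g" "w \<in> C" "adj u w" using link g by blast
    have sub: "Y g \<subseteq> ?X" using g by blast
    have "reach (induced_edges ?X) r w" by (rule rC[OF uw(2)])
    also have "reach (induced_edges ?X) w u"
      using uw sub adj_sym[OF uw(3)] by (intro reach_edge) (auto simp: induced_edges_iff)
    also have "reach (induced_edges ?X) u v"
      by (rule conn_on_reach[OF Y[OF g] sub uw(1) v])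
    finally show ?thesis .
  qed
  then show ?thesis using rC by (intro conn_onI_root[of _ r]) blast
qed

lemma conn_on_union:
  "conn_on C \<Longrightarrow> conn_on D \<Longrightarrow> u \<in> C \<Longrightarrow> v \<in> D \<Longrightarrow> adj u v \<Longrightarrow> conn_on (C \<union> D)"
  using conn_on_star[of C "{()}" "\<lambda>_. D"] adj_sym[of u v] by auto

lemma conn_on_snoc: "conn_on X \<Longrightarrow> conn_on ((\<lambda>u. u @ w) ` X)"
proof (unfold conn_on_def, intro ballI)
  fix u v assume c: "\<forall>u\<in>X. \<forall>v\<in>X. reach (induced_edges X) u v"
    and "u \<in> (\<lambda>u. u @ w) ` X" "v \<in> (\<lambda>u. u @ w) ` X"
  then obtain u' v' where uv: "u' \<in> X" "v' \<in> X" "u = u' @ w" "v = v' @ w" by blast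
  have "reach (induced_edges X) u' v'" using c uv by blast
  then have "reach (induced_edges ((\<lambda>u. u @ w) ` X)) (u' @ w) (v' @ w)"
    unfolding reach_def
  proof (induction rule: rtrancl_induct)
    case (step y z)
    then have "{y @ w, z @ w} \<in> induced_edges ((\<lambda>u. u @ w) ` X)"
      by (auto simp: induced_edges_iff intro: adj_append)
    with step.IH show ?case by (auto intro: rtrancl_into_rtrancl)
  qed simp
  then show "reach (induced_edges ((\<lambda>u. u @ w) ` X)) u v" using uv by simp
qed

lemma conn_on_path:
  assumes "successively adj p"
  shows "conn_on (set p)"
proof (rule conn_onI_root)
  fix u assume "u \<in> set p"
  then obtain j where j: "j < length p" "u = p ! j" by (auto simp: in_set_conv_nth)
  have "reach (induced_edges (set p)) (p ! 0) (p ! j)"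
    using assms j by (intro reach_along) (auto simp: induced_edges_iff successively_conv_nth)
  then show "reach (induced_edges (set p)) (p ! 0) u" using j by simp
qed

section \<open>Removing part of the neighbourhood of a vertex\<close>

text \<open>The index \<open>length w\<close> is excluded because the complete reversal leaves the
  slice. For i = 1 the pair consists of \<open>pr 1 w\<close> and \<open>w\<close>, so
  \<open>w\<close> belongs to its own neighbourhood (\<open>self_near\<close>).\<close>

definition near :: "int list \<Rightarrow> int list set" where
  "near w = (\<Union>i\<in>{1..<length w}. {pr i w, pr 1 (pr i w)})"

text \<open>In contrast to \<open>near\<close>, the complete reversal may occur: for a word stripped
  of its last entry it is an ordinary prefix reversal of the longer word.\<close>

definition puncture :: "int list \<Rightarrow> nat set \<Rightarrow> int list set" where
  "puncture w I = insert w (\<Union>i\<in>I. {pr i w, pr 1 (pr i w)})"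

lemma near_abs_hd: "x \<in> {pr i w, pr 1 (pr i w)} \<Longrightarrow> 1 \<le> i \<Longrightarrow> i \<le> length w \<Longrightarrow> \<bar>hd x\<bar> = \<bar>w ! (i - 1)\<bar>"
  using hd_pr[of i w] hd_pr_1[of "pr i w"] by (cases "w = []") auto

text \<open>The absolute value of the first entry determines i, and its sign decides between the two
  vertices of the pair. So of two vertices with equal first entry at least one is not near
  \<open>w\<close>.\<close>

lemma near_unique:
  assumes w: "w \<in> sperms A" "0 \<notin> A" and xy: "x \<in> near w" "y \<in> near w" "hd x = hd y"
  shows "x = y"
proof -
  obtain i where i: "1 \<le> i" "i < length w" "x \<in> {pr i w, pr 1 (pr i w)}"
    using xy by (auto simp: near_def)
  obtain j where j: "1 \<le> j" "j < length w" "y \<in> {pr j w, pr 1 (pr j w)}"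
    using xy by (auto simp: near_def)
  have "i - 1 = j - 1"
    using near_abs_hd[OF i(3,1)] near_abs_hd[OF j(3,1)] i j xy
    by (intro sperms_nth_inj[OF w(1)]) auto
  then have ij: "i = j" using i j by simp
  have "w ! (i - 1) \<noteq> 0" using sperms_abs_nth[OF w(1), of "i - 1"] i w(2) by fastforce
  then have "hd (pr i w) \<noteq> hd (pr 1 (pr i w))"
    using i hd_pr[of i w] hd_pr_1[of "pr i w"] by (cases "w = []") simp_all
  then show ?thesis using i(3) j(3) ij xy by auto
qed

lemma near_slice: "w \<in> slice A g \<Longrightarrow> 2 \<le> length w \<Longrightarrow> near w \<subseteq> slice A g"
  by (auto simp: near_def slice_def pr_sperms last_pr)

lemma self_near: "2 \<le> length w \<Longrightarrow> w \<in> near w"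
  by (auto simp: near_def pr_pr intro!: bexI[of _ 1])

lemma near_closed:
  assumes "v \<in> near w" shows "pr 1 v \<in> near w"
proof -
  obtain i where i: "i \<in> {1..<length w}" "v = pr i w \<or> v = pr 1 (pr i w)"
    using assms by (auto simp: near_def)
  then have "pr 1 v \<in> {pr i w, pr 1 (pr i w)}" by (auto simp: pr_pr)
  then show ?thesis using i by (auto simp: near_def)
qed

lemma eight_cycle_diffs:
  assumes "distinct [a, b, c, d, e, f, g, h]"
  shows "{a, b, c, d, e, f, g, h} - {a} = set [b, c, d, e, f, g, h]"
    "{a, b, c, d, e, f, g, h} - {a, b} = set [c, d, e, f, g, h]"
    "{a, b, c, d, e, f, g, h} - {a, h, g} = set [b, c, d, e, f]"
    "{a, b, c, d, e, f, g, h} - {a, b, h, g} = set [c, d, e, f]"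
  using assms by auto

text \<open>On two symbols the graph is a cycle of length 8. Starting from \<open>w\<close>, the
  index 1 removes the next vertex and the index 2 the two preceding ones, so a puncture is always an
  arc and leaves a path.\<close>

lemma conn_on_puncture_two:
  assumes A: "A \<subseteq> {1..}" "card A = 2" and w: "w \<in> sperms A" and I: "I \<subseteq> {1..2}"
  shows "conn_on (sperms A - puncture w I)"
proof -
  have "length w = 2" using length_sperms[OF w] A by simp
  then obtain p q where pq: "w = [p, q]"
    by (metis (no_types) One_nat_def Suc_1 length_0_conv length_Suc_conv)
  have A': "A = {\<bar>p\<bar>, \<bar>q\<bar>}" and ne: "\<bar>p\<bar> \<noteq> \<bar>q\<bar>"
    using w A(2) by (auto simp: pq sperms_def)
  have pos: "p \<noteq> 0" "q \<noteq> 0" using A(1) A' by auto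
  \<comment> \<open>Listed in cyclic order, with reversals of lengths 1 and 2 alternating.\<close>
  have all: "sperms A = {[p, q], [- p, q], [- q, p], [q, p], [- p, - q], [p, - q], [q, - p], [- q, - p]}"
  proof (intro equalityI subsetI)
    fix x assume x: "x \<in> sperms A"
    then have "length x = 2" using length_sperms A by auto
    then obtain a b where ab: "x = [a, b]"
      by (metis (no_types) One_nat_def Suc_1 length_0_conv length_Suc_conv)
    have "\<bar>a\<bar> \<noteq> \<bar>b\<bar>" "{\<bar>a\<bar>, \<bar>b\<bar>} = {\<bar>p\<bar>, \<bar>q\<bar>}" using x A' by (auto simp: ab sperms_def)
    then have "(\<bar>a\<bar> = \<bar>p\<bar> \<and> \<bar>b\<bar> = \<bar>q\<bar>) \<or> (\<bar>a\<bar> = \<bar>q\<bar> \<and> \<bar>b\<bar> = \<bar>p\<bar>)" by (auto simp: doubleton_eq_iff)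
    then show "x \<in> {[p, q], [- p, q], [- q, p], [q, p], [- p, - q], [p, - q], [q, - p], [- q, - p]}"
      by (auto simp: ab abs_eq_iff)
  next
    fix x assume "x \<in> {[p, q], [- p, q], [- q, p], [q, p], [- p, - q], [p, - q], [q, - p], [- q, - p]}"
    then show "x \<in> sperms A" using ne by (auto simp: sperms_def A')
  qed
  have step: "adj [a, b] [- a, b]" "adj [a, b] [- b, - a]" for a b
    using adj_pr[of 1 "[a, b]"] adj_pr[of 2 "[a, b]"] by (auto simp: prefix_reversal_def)
  have steps: "adj [- p, q] [- q, p]" "adj [- q, p] [q, p]" "adj [q, p] [- p, - q]"
    "adj [- p, - q] [p, - q]" "adj [p, - q] [q, - p]" "adj [q, - p] [- q, - p]"
    using step(2)[of "- p" q] step(1)[of "- q" p] step(2)[of q p] step(1)[of "- p" "- q"]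
      step(2)[of p "- q"] step(1)[of q "- p"] by simp_all
  have Icases: "I = {} \<or> I = {1} \<or> I = {2} \<or> I = {1, 2}"
  proof -
    have "{1..2::nat} = {1, 2}" by auto
    with I have "I \<in> Pow {1, 2}" by simp
    then show ?thesis by (auto simp: Pow_insert)
  qed
  have diff: "distinct [[p, q], [- p, q], [- q, p], [q, p], [- p, - q], [p, - q], [q, - p], [- q, - p]]"
    using ne pos by auto
  have pcs: "puncture w {} = {[p, q]}" "puncture w {1} = {[p, q], [- p, q]}"
    "puncture w {2} = {[p, q], [- q, - p], [q, - p]}"
    "puncture w {1, 2} = {[p, q], [- p, q], [- q, - p], [q, - p]}"
    by (auto simp: puncture_def pq prefix_reversal_def)
  show ?thesis
    using Icases
  proof (elim disjE)
    assume "I = {}"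
    then show ?thesis unfolding all
      by (simp only: pcs eight_cycle_diffs[OF diff]) (intro conn_on_path, simp add: steps)
  next
    assume "I = {1}"
    then show ?thesis unfolding all
      by (simp only: pcs eight_cycle_diffs[OF diff]) (intro conn_on_path, simp add: steps)
  next
    assume "I = {2}"
    then show ?thesis unfolding all
      by (simp only: pcs eight_cycle_diffs[OF diff]) (intro conn_on_path, simp add: steps)
  next
    assume "I = {1, 2}"
    then show ?thesis unfolding all
      by (simp only: pcs eight_cycle_diffs[OF diff]) (intro conn_on_path, simp add: steps)
  qed
qed

text \<open>Only the index \<open>card A\<close> changes the last entry, so beside the slice of
  \<open>w\<close> a puncture meets just one other slice, and there the absolute value of the first
  entry is fixed.\<close>

lemma puncture_cases:
  assumes w: "w \<in> sperms A" "2 \<le> card A" and I: "I \<subseteq> {1..card A}" and x: "x \<in> puncture w I"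
  obtains "x \<in> near w" "last x = last w"
  | "card A \<in> I" "x \<in> {pr (card A) w, pr 1 (pr (card A) w)}" "last x = - hd w" "\<bar>hd x\<bar> = \<bar>last w\<bar>"
proof -
  have len: "length w = card A" by (rule length_sperms[OF w(1)])
  have ne: "w \<noteq> []" using len w(2) by auto
  consider "x = w" | i where "i \<in> I" "x \<in> {pr i w, pr 1 (pr i w)}"
    using x by (auto simp: puncture_def)
  then show thesis
  proof cases
    case 1
    then show thesis using that(1) self_near len w(2) by simp
  next
    case 2
    then have i: "1 \<le> i" "i \<le> card A" using I by auto
    show thesis
    proof (cases "i = card A")
      case True
      have "last x = - hd w"
        using 2(2) True len last_pr_full[OF ne] w(2) by (auto simp: last_pr)
      moreover have "\<bar>hd x\<bar> = \<bar>last w\<bar>"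
        using 2(2) True len hd_pr_full[OF ne] hd_pr_1[of "pr i w"] ne by auto
      ultimately show thesis using that(2) 2 True by simp
    next
      case False
      then have "x \<in> near w" using 2(2) i len by (auto simp: near_def)
      moreover have "last x = last w"
        using 2(2) i False len w(2) by (auto simp: last_pr)
      ultimately show thesis by (rule that(1))
    qed
  qed
qed

lemma puncture_snoc:
  assumes "I \<subseteq> {1..length u}"
  shows "puncture (u @ [g]) I = (\<lambda>u. u @ [g]) ` puncture u I"
proof -
  have "pr i (u @ [g]) = pr i u @ [g]" "pr (Suc 0) (pr i (u @ [g])) = pr (Suc 0) (pr i u) @ [g]"
    if "i \<in> I" for i
    using that assms by (auto simp: pr_append)
  then show ?thesis
    by (auto simp: puncture_def image_UN)
qed

lemma conn_on_slice_diff: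
  assumes "\<bar>g\<bar> \<in> A" "conn_on (sperms (A - {\<bar>g\<bar>}) - Z)" "slice A g \<inter> W = (\<lambda>u. u @ [g]) ` Z"
  shows "conn_on (slice A g - W)"
proof -
  have "slice A g - W = slice A g - (\<lambda>u. u @ [g]) ` Z" using assms(3) by blast
  also have "\<dots> = (\<lambda>u. u @ [g]) ` (sperms (A - {\<bar>g\<bar>}) - Z)"
    unfolding slice_eq_image[OF assms(1)] by auto
  finally show ?thesis using conn_on_snoc[OF assms(2)] by simp
qed

lemma butlast_slice:
  assumes "\<bar>g\<bar> \<in> A" "x \<in> slice A g"
  shows "butlast x \<in> sperms (A - {\<bar>g\<bar>})" "x = butlast x @ [g]"
  using assms unfolding slice_eq_image[OF assms(1)] by auto

text \<open>The induction hypothesis always removes a vertex; it is put back by its edge to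
  \<open>pr 1\<close>.\<close>

lemma conn_on_sperms_if_puncture:
  assumes A: "A \<subseteq> {1..}" "2 \<le> card A"
    and IH: "\<And>w. w \<in> sperms A \<Longrightarrow> conn_on (sperms A - puncture w {})"
  shows "conn_on (sperms A)"
proof -
  let ?u = "sorted_list_of_set A"
  have fin: "finite A" using A(2) by (intro card_ge_0_finite) simp
  have u: "?u \<in> sperms A" using A(1) fin by (intro sperms_nonempty) auto
  have ne: "?u \<noteq> []" using sperms_ends(1)[OF u A(2)] .
  have "0 \<notin> A" using A(1) by auto
  then have "hd ?u \<noteq> 0" using sperms_ends(2)[OF u A(2)] by auto
  then have neq: "pr 1 ?u \<noteq> ?u" using hd_pr_1[OF ne] by (metis One_nat_def neg_equal_zero)
  have "conn_on ({?u} \<union> (sperms A - {?u}))"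
    using conn_on_union[of "{?u}" "sperms A - {?u}" ?u "pr 1 ?u"] IH[OF u] neq pr_sperms[OF u] ne
      adj_pr[of 1 ?u] A(2)
    by (auto simp: puncture_def Suc_leI)
  moreover have "{?u} \<union> (sperms A - {?u}) = sperms A" using u by blast
  ultimately show ?thesis by simp
qed

text \<open>
  Induction on \<open>card A\<close>: the puncture at \<open>w\<close> meets only the slice of \<open>w\<close>, in a puncture there,
  and one further slice, in the two vertices of a puncture. A slice \<open>c\<close> avoiding both serves as
  the centre to which the other slices are linked.
\<close>

lemma conn_on_puncture:
  assumes "A \<subseteq> {1..}" "2 \<le> card A" "w \<in> sperms A" "I \<subseteq> {1..card A}"
  shows "conn_on (sperms A - puncture w I)"
  using assms(2,1,3,4)
proof (induction "card A" arbitrary: A w I rule: nat_induct_at_least)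
  case base
  then show ?case using conn_on_puncture_two[of A w I] by simp
next
  case (Suc k)
  note A = Suc.prems(1) and w = Suc.prems(2) and I = Suc.prems(3)
  have cA: "card A = Suc k" using Suc.hyps by simp
  have fin: "finite A" using cA by (intro card_ge_0_finite) simp
  have c2: "2 \<le> card A" "3 \<le> card A" using cA Suc.hyps by auto
  have len: "length w = Suc k" using length_sperms[OF w] cA by simp
  have ne: "w \<noteq> []" using len by auto
  define h where "h = last w"
  define m where "m = - hd w"
  have hm: "\<bar>h\<bar> \<in> A" "\<bar>m\<bar> \<in> A" "\<bar>m\<bar> \<noteq> \<bar>h\<bar>"
    using sperms_ends[OF w c2(1)] by (auto simp: h_def m_def)
  have IH: "conn_on (sperms (A - {\<bar>g\<bar>}) - puncture v J)"
    if "\<bar>g\<bar> \<in> A" "v \<in> sperms (A - {\<bar>g\<bar>})" "J \<subseteq> {1..k}" for g v J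
    using Suc.hyps(2)[of "A - {\<bar>g\<bar>}" v J] that A cA by auto
  have full: "conn_on (slice A g)" if "\<bar>g\<bar> \<in> A" for g
  proof -
    have "conn_on (sperms (A - {\<bar>g\<bar>}))"
      using A cA that Suc.hyps(1) IH[OF that, of _ "{}"] by (intro conn_on_sperms_if_puncture) auto
    then show ?thesis using conn_on_snoc slice_eq_image[OF that] by simp
  qed
  define Y where "Y g = slice A g - puncture w I" for g
  have Y_full: "Y g = slice A g" if "g \<noteq> h" "g \<noteq> m" for g
  proof -
    have "x \<notin> puncture w I" if "last x = g" for x
    proof
      assume "x \<in> puncture w I"
      then show False
        using \<open>last x = g\<close> \<open>g \<noteq> h\<close> \<open>g \<noteq> m\<close>
        by (cases rule: puncture_cases[OF w c2(1) I]) (auto simp: h_def m_def)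
    qed
    then show ?thesis by (auto simp: Y_def slice_def)
  qed
  have near: "x \<in> near w" if "x \<in> puncture w I" "\<bar>hd x\<bar> \<noteq> \<bar>h\<bar>" for x
    using that(1) by (cases rule: puncture_cases[OF w c2(1) I]) (use that in \<open>auto simp: h_def\<close>)
  have conn: "conn_on (Y g)" if g: "\<bar>g\<bar> \<in> A" for g
  proof -
    consider "g = h" | "g = m" "Suc k \<in> I" | "g \<noteq> h" "Suc k \<notin> I" | "g \<noteq> h" "g \<noteq> m" by blast
    then show ?thesis
    proof cases
      case 1
      have eq: "w = butlast w @ [h]" using ne by (simp add: h_def)
      have u: "butlast w \<in> sperms (A - {\<bar>h\<bar>})"
        using butlast_slice(1)[OF hm(1), of w] w by (simp add: h_def slice_def)
      let ?J = "I \<inter> {1..k}"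
      have img: "(\<lambda>u. u @ [h]) ` puncture (butlast w) ?J = puncture w ?J"
        using puncture_snoc[of ?J "butlast w" h] len eq by simp
      have "slice A h \<inter> puncture w I = puncture w ?J"
      proof (intro equalityI subsetI)
        fix x assume x: "x \<in> slice A h \<inter> puncture w I"
        then have "last x = h" by (simp add: slice_def)
        consider "x = w" | i where "i \<in> I" "x \<in> {pr i w, pr 1 (pr i w)}"
          using x by (auto simp: puncture_def)
        then show "x \<in> puncture w ?J"
        proof cases
          case 2
          have "i \<noteq> Suc k"
          proof
            assume "i = Suc k"
            then have "last x = m"
              using 2(2) len last_pr_full[OF ne] Suc.hyps(1) by (auto simp: m_def last_pr)
            then show False using \<open>last x = h\<close> hm by simp
          qed
          then have "i \<in> ?J" using 2(1) I cA by fastforce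
          then show ?thesis using 2(2) by (auto simp: puncture_def)
        qed (simp add: puncture_def)
      next
        fix x assume x: "x \<in> puncture w ?J"
        then have "x \<in> (\<lambda>u. u @ [h]) ` puncture (butlast w) ?J" using img by simp
        then have "last x = h" by auto
        moreover have "x \<in> sperms A"
          using x w by (auto simp: puncture_def pr_sperms)
        ultimately show "x \<in> slice A h \<inter> puncture w I"
          using x by (auto simp: slice_def puncture_def)
      qed
      then show ?thesis
        unfolding Y_def 1 using img conn_on_slice_diff[OF hm(1) IH[OF hm(1) u, of ?J]] by simp
    next
      case 2
      let ?p = "pr (Suc k) w"
      have pA: "?p \<in> sperms A" "last ?p = m" "?p \<noteq> []"
        using w ne last_pr_full[OF ne] len by (auto simp: pr_sperms m_def)
      then have eq: "?p = butlast ?p @ [m]" by (metis append_butlast_last_id)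
      have u: "butlast ?p \<in> sperms (A - {\<bar>m\<bar>})"
        using butlast_slice(1)[OF hm(2), of ?p] pA by (simp add: slice_def)
      have "{1} \<subseteq> {1..length (butlast ?p)}" using len Suc.hyps(1) by simp
      then have img: "(\<lambda>u. u @ [m]) ` puncture (butlast ?p) {1} = puncture ?p {1}"
        using puncture_snoc[of "{1}" "butlast ?p" m] eq by simp
      \<comment> \<open>Since \<open>pr 1\<close> is an involution, the two vertices removed from
        the slice m form a puncture at \<open>?p\<close> with index set {1}.\<close>
      have "slice A m \<inter> puncture w I = puncture ?p {1}"
      proof (intro equalityI subsetI)
        fix x assume x: "x \<in> slice A m \<inter> puncture w I"
        then have "last x = m" by (simp add: slice_def)
        then show "x \<in> puncture ?p {1}"
          using x hm(3) cA
          by (elim IntE, cases rule: puncture_cases[OF w c2(1) I]) (auto simp: h_def puncture_def)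
      next
        fix x assume "x \<in> puncture ?p {1}"
        then have x: "x \<in> {?p, pr 1 ?p}" using len by (auto simp: puncture_def pr_pr)
        then have "last x = m" using pA len Suc.hyps(1) by (auto simp: last_pr)
        then show "x \<in> slice A m \<inter> puncture w I"
          using x pA 2(2) by (auto simp: slice_def puncture_def pr_sperms)
      qed
      moreover have "{1} \<subseteq> {1..k}" using Suc.hyps(1) by simp
      ultimately show ?thesis
        unfolding Y_def 2 using img conn_on_slice_diff[OF hm(2) IH[OF hm(2) u, of "{1}"]] by simp
    next
      case 3
      have "x \<notin> puncture w I" if "last x = g" for x
      proof
        assume "x \<in> puncture w I"
        then show False
          using that 3 cA by (cases rule: puncture_cases[OF w c2(1) I]) (auto simp: h_def)
      qed
      then have "Y g = slice A g" by (auto simp: Y_def slice_def)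
      then show ?thesis using full[OF g] by simp
    next
      case 4
      then show ?thesis using full[OF g] Y_full by simp
    qed
  qed
  have "\<not> A \<subseteq> {\<bar>h\<bar>, \<bar>m\<bar>}"
  proof
    assume "A \<subseteq> {\<bar>h\<bar>, \<bar>m\<bar>}"
    then have "card A \<le> card {\<bar>h\<bar>, \<bar>m\<bar>}" by (intro card_mono) auto
    also have "\<dots> \<le> 2" by (simp add: card_insert_if)
    finally show False using c2 by simp
  qed
  then obtain c where c: "c \<in> A" "c \<noteq> \<bar>h\<bar>" "c \<noteq> \<bar>m\<bar>" by blast
  then have c0: "0 < c" using A by auto
  have c': "c \<noteq> h" "c \<noteq> m" "- c \<noteq> h" "- c \<noteq> m" "\<bar>c\<bar> \<in> A" "\<bar>c\<bar> = c" using c c0 by auto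
  let ?P = "{g. \<bar>g\<bar> \<in> A \<and> \<bar>g\<bar> \<noteq> c}"
  let ?X = "Y c \<union> (\<Union>g\<in>?P. Y g)"
  have "conn_on ?X"
  proof (rule conn_on_star)
    show "conn_on (Y c)" using conn c' by blast
    obtain x where "x \<in> slice A c"
      using slice_two[OF fin A c2(2), of h c] hm(1) c(1,2) c'(6) by auto
    then show "Y c \<noteq> {}" using Y_full[OF c'(1,2)] by blast
    fix g assume g: "g \<in> ?P"
    then show "conn_on (Y g)" using conn by blast
    obtain x y where xy: "x \<in> slice A g" "y \<in> slice A g" "hd x = - c" "hd y = - c" "x \<noteq> y"
      using slice_two[OF fin A c2(2), of "- c" g] g c c0 by auto
    \<comment> \<open>Both have the first entry -c, whose absolute value is not that of h, so they
      could only be removed as vertices near \<open>w\<close>, where first entries are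
      unique.\<close>
    have "\<not> (x \<in> puncture w I \<and> y \<in> puncture w I)"
    proof
      assume "x \<in> puncture w I \<and> y \<in> puncture w I"
      then have "x \<in> near w" "y \<in> near w" using near xy c c0 by auto
      moreover have "0 \<notin> A" using A by auto
      ultimately show False using near_unique[OF w, of x y] xy by simp
    qed
    then obtain z where z: "z \<in> Y g" "hd z = - c" using xy by (auto simp: Y_def)
    then have zA: "z \<in> sperms A" by (simp add: Y_def slice_def)
    then have zl: "length z = Suc k" "z \<noteq> []" using length_sperms[of z A] cA by auto
    have "pr (length z) z \<in> Y c"
      using pr_full_slice[OF zA zl(2)] z Y_full[OF c'(1,2)] by simp
    then show "\<exists>u\<in>Y g. \<exists>v\<in>Y c. adj u v"
      using z(1) zl adj_pr[of "length z" z] by force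
  qed
  \<comment> \<open>No complete reversal joins the slices c and -c. The latter is attached through
    the slice -h, which the puncture does not meet.\<close>
  moreover have "conn_on (Y (- c))" using conn c' by simp
  moreover obtain x where x: "x \<in> slice A (- c)" "hd x = h"
    using slice_two[OF fin A c2(2), of h "- c"] hm c c' by auto
  moreover have "x \<in> Y (- c)" using x Y_full[OF c'(3,4)] by simp
  moreover have "pr (length x) x \<in> ?X"
  proof -
    have xA: "x \<in> sperms A" using x by (simp add: slice_def)
    then have "x \<noteq> []" using length_sperms[of x A] cA by auto
    then have "pr (length x) x \<in> slice A (- h)" using pr_full_slice[OF xA] x by simp
    moreover have "- h \<noteq> h" "- h \<noteq> m" using hm A by auto
    ultimately have "pr (length x) x \<in> Y (- h)" using Y_full by simp
    moreover have "- h \<in> ?P" using hm(1) c(2) by simp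
    ultimately show ?thesis by blast
  qed
  moreover have "adj (pr (length x) x) x"
  proof (rule adj_sym, rule adj_pr)
    show "1 \<le> length x" using x cA length_sperms[of x A] by (simp add: slice_def)
  qed simp
  ultimately have "conn_on (?X \<union> Y (- c))" using conn_on_union by blast
  moreover have "?X \<union> Y (- c) = sperms A - puncture w I"
  proof (intro equalityI subsetI)
    fix x assume "x \<in> sperms A - puncture w I"
    moreover then have "\<bar>last x\<bar> \<in> A" using sperms_ends[OF _ c2(1)] by blast
    moreover have "last x = c \<or> last x = - c \<or> \<bar>last x\<bar> \<noteq> c" by auto
    ultimately show "x \<in> ?X \<union> Y (- c)" by (auto simp: Y_def slice_def)
  qed (auto simp: Y_def slice_def)
  ultimately show ?case by simp
qed

lemma conn_on_sperms: "A \<subseteq> {1..} \<Longrightarrow> 2 \<le> card A \<Longrightarrow> conn_on (sperms A)"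
  using conn_on_puncture by (intro conn_on_sperms_if_puncture) auto

section \<open>Trees on hubs\<close>

lemma pr_inj:
  assumes x: "x \<in> sperms A" and ij: "i \<in> {1..length x}" "j \<in> {1..length x}" "pr i x = pr j x"
  shows "i = j"
proof -
  have "hd (pr i x) = hd (pr j x)" using ij(3) by simp
  then have "x ! (i - 1) = x ! (j - 1)" using ij hd_pr[of i x] hd_pr[of j x] by simp
  then have "i - 1 = j - 1" using ij by (intro sperms_nth_inj[OF x]) auto
  then show ?thesis using ij(1,2) unfolding atLeastAtMost_iff by linarith
qed

lemma pr_neq:
  assumes "x \<in> sperms {1..int n}" "i \<in> {1..n}"
  shows "pr i x \<noteq> x"
  using assms prefix_reversal_neq by (simp add: signed_perms_eq)

definition hood :: "int list set \<Rightarrow> int list set" where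
  "hood S = \<Union> (near ` S)"

text \<open>
  Below, \<open>\<rho> g\<close> is the tree that has the slice \<open>g\<close> as a hub (a value such as 0 that is not the
  index of a tree if there is none), and \<open>\<tau> h c\<close> is the tree that terminals of the slice \<open>h\<close>
  enter through their neighbours of colour \<open>c\<close>.
\<close>

definition owned :: "nat \<Rightarrow> int list set \<Rightarrow> (int \<Rightarrow> int \<Rightarrow> int) \<Rightarrow> (int \<Rightarrow> int) \<Rightarrow> int \<Rightarrow> int list set" where
  "owned n S \<tau> \<rho> g = {v \<in> slice {1..int n} g - S. v \<in> hood S \<longrightarrow> \<tau> g \<bar>hd v\<bar> = \<rho> g}"

definition linked :: "nat \<Rightarrow> int list set \<Rightarrow> (int \<Rightarrow> int \<Rightarrow> int) \<Rightarrow> (int \<Rightarrow> int) \<Rightarrow> int \<Rightarrow> int \<Rightarrow> bool" where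
  "linked n S \<tau> \<rho> g g' \<longleftrightarrow> (\<exists>v\<in>owned n S \<tau> \<rho> g. \<exists>w\<in>owned n S \<tau> \<rho> g'. adj v w)"

text \<open>
  A vertex of the tree \<open>t\<close> in the slice \<open>h\<close> whose first entry is \<open>- g\<close> is joined to the hub \<open>g\<close> of
  \<open>t\<close>; its neighbour there has colour \<open>\<bar>h\<bar>\<close> and may be near a terminal.
\<close>

definition lands :: "int list set \<Rightarrow> (int \<Rightarrow> int \<Rightarrow> int) \<Rightarrow> (int \<Rightarrow> int) \<Rightarrow> int \<Rightarrow> int \<Rightarrow> int \<Rightarrow> bool" where
  "lands S \<tau> \<rho> h g t \<longleftrightarrow> \<rho> g = t \<and> (g \<in> last ` S \<longrightarrow> \<tau> g \<bar>h\<bar> = t)"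

text \<open>
  If \<open>x\<close> and \<open>y\<close> are adjacent terminals of one slice and the edge between them belongs to the tree
  of the colour of \<open>x\<close>, then \<open>x\<close> cannot enter the tree of the colour of \<open>y\<close> through \<open>y\<close> and has to
  use its complete reversal instead.
\<close>

definition tailed :: "int list set \<Rightarrow> (int \<Rightarrow> int \<Rightarrow> int) \<Rightarrow> (int \<Rightarrow> int) \<Rightarrow> int list \<Rightarrow> int list \<Rightarrow> bool" where
  "tailed S \<tau> \<rho> x y \<longleftrightarrow> lands S \<tau> \<rho> (last x) (- hd x) (\<tau> (last x) \<bar>hd y\<bar>)"

lemma rootI:
  assumes "\<bar>g\<bar> \<in> B" "\<rho> g = t" "\<And>g'. \<rho> g' = t \<Longrightarrow> g' \<noteq> g \<Longrightarrow> linked n S \<tau> \<rho> g' g"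
  shows "\<exists>g. \<bar>g\<bar> \<in> B \<and> \<rho> g = t \<and>
    (\<forall>g'. \<bar>g'\<bar> \<in> B \<and> \<rho> g' = t \<and> g' \<noteq> g \<longrightarrow> linked n S \<tau> \<rho> g' g)"
  using assms by blast

lemma if_mem: "x \<in> X \<Longrightarrow> y \<in> X \<Longrightarrow> (if P then x else y) \<in> X"
  by simp

lemma abs_neqD:
  fixes x y :: int
  assumes "\<bar>x\<bar> \<noteq> \<bar>y\<bar>"
  shows "x \<noteq> y" "x \<noteq> - y" "- x \<noteq> y"
  using assms by auto

section \<open>The part of a slice owned by a tree, and links between slices\<close>

locale terminals =
  fixes n :: nat and S :: "int list set"
  assumes n: "3 \<le> n" and S: "S \<subseteq> sperms {1..int n}"
begin

abbreviation "A \<equiv> {1..int n}"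
abbreviation "U \<equiv> last ` S"

definition lone :: "int \<Rightarrow> bool" where
  "lone g \<longleftrightarrow> (\<exists>y. {x \<in> S. last x = g} = {y})"

lemma A1: "A \<subseteq> {1..}" and finA: "finite A" and A0: "0 \<notin> A"
  by auto

lemma cardA2: "2 \<le> card A"
  using n by simp

lemma cardA3: "3 \<le> card A"
  using n by simp

lemma SD: "x \<in> S \<Longrightarrow> x \<in> sperms A"
  using S by blast

lemma len: "x \<in> sperms A \<Longrightarrow> length x = n"
  using length_sperms[of x A] by simp

lemma ends: "x \<in> sperms A \<Longrightarrow> x \<noteq> [] \<and> \<bar>hd x\<bar> \<in> A \<and> \<bar>last x\<bar> \<in> A \<and> \<bar>hd x\<bar> \<noteq> \<bar>last x\<bar>"
  using sperms_ends[OF _ cardA2] by blast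

lemma near_props: "x \<in> S \<Longrightarrow> v \<in> near x \<Longrightarrow> v \<in> sperms A \<and> last v = last x"
  using near_slice[of x A "last x"] SD len n by (auto simp: slice_def)

lemma hood_props: "v \<in> hood S \<Longrightarrow> v \<in> sperms A \<and> last v \<in> U"
  unfolding hood_def using near_props by (metis UN_E image_eqI)

lemma S_hood: "x \<in> S \<Longrightarrow> x \<in> hood S"
  unfolding hood_def using self_near[of x] len[OF SD, of x] n by auto

lemma hood_pr_1: "v \<in> hood S \<Longrightarrow> pr 1 v \<in> hood S"
  unfolding hood_def using near_closed[of v] by blast

lemma hood_lone:
  assumes y: "{x \<in> S. last x = g} = {y}" and v: "last v = g"
  shows "v \<in> hood S \<longleftrightarrow> v \<in> near y"
proof
  assume "v \<in> hood S"
  then obtain x where x: "x \<in> S" "v \<in> near x" by (auto simp: hood_def)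
  then have "last x = g" using near_props v by auto
  then have "x = y" using y x by blast
  then show "v \<in> near y" using x by simp
next
  assume "v \<in> near y"
  moreover have "y \<in> S" using y by blast
  ultimately show "v \<in> hood S" by (auto simp: hood_def)
qed

lemma owned_avoiding:
  assumes "v \<in> slice A g" "v \<notin> hood S"
  shows "v \<in> owned n S \<tau> \<rho> g"
  using assms S_hood by (auto simp: owned_def)

lemma hood_hd_unique:
  assumes gl: "g \<in> U \<Longrightarrow> lone g"
    and xy: "x \<in> hood S" "y \<in> hood S" "last x = g" "last y = g" "hd x = hd y"
  shows "x = y"
proof -
  have "g \<in> U" using hood_props xy by blast
  then obtain z where z: "{x \<in> S. last x = g} = {z}" using gl lone_def by blast
  then have "z \<in> sperms A" using SD by blast
  moreover have "x \<in> near z" "y \<in> near z" using hood_lone[OF z] xy by auto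
  ultimately show ?thesis using near_unique A0 xy by blast
qed

text \<open>Of the two words from \<open>slice_two\<close> at most one lies in the neighbourhood of
  the only terminal of the slice.\<close>

lemma owned_hd:
  assumes g: "\<bar>g\<bar> \<in> A" "\<bar>f\<bar> \<in> A" "\<bar>f\<bar> \<noteq> \<bar>g\<bar>" and gl: "g \<in> U \<Longrightarrow> lone g"
  shows "\<exists>v\<in>owned n S \<tau> \<rho> g. hd v = f \<and> v \<notin> hood S"
proof -
  obtain x y where xy: "x \<in> slice A g" "y \<in> slice A g" "hd x = f" "hd y = f" "x \<noteq> y"
    using slice_two[OF finA A1 cardA3 g(2,1,3)] by blast
  then have "x \<notin> hood S \<or> y \<notin> hood S"
    using hood_hd_unique[OF gl, of x y] by (auto simp: slice_def)
  then show ?thesis using xy owned_avoiding by blast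
qed

lemma owned_nonempty:
  assumes g: "\<bar>g\<bar> \<in> A" and gl: "g \<in> U \<Longrightarrow> lone g"
  shows "owned n S \<tau> \<rho> g \<noteq> {}"
proof -
  have "\<exists>f\<in>A. f \<noteq> \<bar>g\<bar>"
    using n by (intro bexI[of _ "if \<bar>g\<bar> = 1 then 2 else 1"]) auto
  then obtain f where "f \<in> A" "f \<noteq> \<bar>g\<bar>" by blast
  then obtain v where "v \<in> owned n S \<tau> \<rho> g"
    using owned_hd[OF g _ _ gl, of f \<tau> \<rho>] by auto
  then show ?thesis by blast
qed

lemma owned_free: "g \<notin> U \<Longrightarrow> owned n S \<tau> \<rho> g = slice A g"
  using hood_props S_hood by (auto simp: owned_def slice_def)

text \<open>Around a lone terminal y the vertices not owned are y and the pairs whose colour is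
  labelled with another tree, which is a puncture. After the last entries are stripped,
  \<open>conn_on_puncture\<close> applies; the index n - 1 is then the complete reversal.\<close>

lemma conn_on_owned:
  assumes g: "\<bar>g\<bar> \<in> A" and gl: "g \<in> U \<Longrightarrow> lone g"
  shows "conn_on (owned n S \<tau> \<rho> g)"
proof (cases "g \<in> U")
  case False
  have "conn_on (sperms (A - {\<bar>g\<bar>}))"
    using g n by (intro conn_on_sperms) auto
  then show ?thesis
    using owned_free[OF False] conn_on_snoc slice_eq_image[OF g] by simp
next
  case True
  then obtain y where y: "{x \<in> S. last x = g} = {y}" using gl lone_def by blast
  then have yS: "y \<in> S" "last y = g" by blast+
  then have y_slice: "y \<in> slice A g" using SD by (simp add: slice_def)
  note bl = butlast_slice[OF g y_slice]
  have ly: "length y = n" using len SD yS by blast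
  define I where "I = {i \<in> {1..<n}. \<tau> g \<bar>y ! (i - 1)\<bar> \<noteq> \<rho> g}"
  have "owned n S \<tau> \<rho> g = slice A g - puncture y I"
  proof (intro equalityI subsetI)
    fix v assume v: "v \<in> owned n S \<tau> \<rho> g"
    have "v \<notin> puncture y I"
    proof
      assume "v \<in> puncture y I"
      moreover have "v \<noteq> y" using v yS by (auto simp: owned_def)
      ultimately obtain i where i: "i \<in> I" "v \<in> {pr i y, pr 1 (pr i y)}"
        by (auto simp: puncture_def)
      then have "v \<in> near y" "\<bar>hd v\<bar> = \<bar>y ! (i - 1)\<bar>"
        using ly near_abs_hd[of v i y] by (auto simp: near_def I_def)
      moreover then have "v \<in> hood S" using yS by (auto simp: hood_def)
      ultimately show False using v i by (auto simp: owned_def I_def)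
    qed
    then show "v \<in> slice A g - puncture y I" using v by (simp add: owned_def)
  next
    fix v assume v: "v \<in> slice A g - puncture y I"
    then have lv: "last v = g" by (simp add: slice_def)
    have "v \<notin> S" using v y lv by (auto simp: puncture_def)
    moreover have "\<tau> g \<bar>hd v\<bar> = \<rho> g" if "v \<in> hood S"
    proof -
      have "v \<in> near y" using that hood_lone[OF y lv] by simp
      then obtain i where i: "i \<in> {1..<n}" "v \<in> {pr i y, pr 1 (pr i y)}"
        using ly by (auto simp: near_def)
      then have "i \<notin> I" using v by (auto simp: puncture_def)
      then show ?thesis using i near_abs_hd[of v i y] ly by (auto simp: I_def)
    qed
    ultimately show "v \<in> owned n S \<tau> \<rho> g" using v by (simp add: owned_def)
  qed
  moreover have "conn_on (slice A g - puncture y I)"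
  proof (rule conn_on_slice_diff[OF g])
    have I: "I \<subseteq> {1..length (butlast y)}" using ly by (auto simp: I_def)
    show "conn_on (sperms (A - {\<bar>g\<bar>}) - puncture (butlast y) I)"
      using g n I ly bl(1) by (intro conn_on_puncture) auto
    have "(\<lambda>u. u @ [g]) ` puncture (butlast y) I = puncture y I"
      using puncture_snoc[OF I, of g] bl(2) by simp
    moreover have "puncture y I \<subseteq> slice A g"
      using near_slice[OF y_slice] y_slice n ly by (fastforce simp: puncture_def near_def I_def)
    ultimately show "slice A g \<inter> puncture y I = (\<lambda>u. u @ [g]) ` puncture (butlast y) I" by auto
  qed
  ultimately show ?thesis by simp
qed


lemma linked_sym: "linked n S \<tau> \<rho> g g' \<Longrightarrow> linked n S \<tau> \<rho> g' g"
  unfolding linked_def using adj_sym by blast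

text \<open>Nothing is removed from a slice without terminals, so any complete reversal into it
  arrives in the owned part.\<close>

lemma linked_free:
  assumes g: "\<bar>g\<bar> \<in> A" "\<bar>g'\<bar> \<in> A" "\<bar>g\<bar> \<noteq> \<bar>g'\<bar>" and gl: "g \<in> U \<Longrightarrow> lone g" and g': "g' \<notin> U"
  shows "linked n S \<tau> \<rho> g g'"
proof -
  obtain v where v: "v \<in> owned n S \<tau> \<rho> g" "hd v = - g'"
    using owned_hd[OF g(1) _ _ gl, of "- g'"] g by auto
  then have vA: "v \<in> sperms A" by (simp add: owned_def slice_def)
  have lv: "length v = n" "v \<noteq> []" using len ends vA by auto
  have "pr n v \<in> slice A g'" using pr_full_slice[OF vA lv(2)] v lv by simp
  then have "pr n v \<in> owned n S \<tau> \<rho> g'" using owned_free[OF g'] by simp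
  moreover have "adj v (pr n v)" using lv n by (intro adj_pr) auto
  ultimately show ?thesis using v(1) unfolding linked_def by blast
qed

text \<open>Complete reversal matches the vertices of the two slices that face each other. On each
  side at most one of them is near the terminal, so of three matched pairs one survives.\<close>

lemma linked_lone:
  assumes g: "\<bar>g\<bar> \<in> A" "\<bar>g'\<bar> \<in> A" "\<bar>g\<bar> \<noteq> \<bar>g'\<bar>" and l: "lone g" "lone g'" and n4: "4 \<le> n"
  shows "linked n S \<tau> \<rho> g g'"
proof -
  have c4: "4 \<le> card A" using n4 by simp
  define P where "P v \<longleftrightarrow> v \<in> slice A g \<and> hd v = - g'" for v
  obtain x y z where xyz: "P x" "P y" "P z" "x \<noteq> y" "x \<noteq> z" "y \<noteq> z"
    using slice_three[OF finA A1 c4, of "- g'" g] g by (auto simp: P_def)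
  have pr: "pr n v \<in> slice A g' \<and> hd (pr n v) = - g \<and> adj v (pr n v) \<and> pr n (pr n v) = v"
    if "P v" for v
  proof -
    have vA: "v \<in> sperms A" "last v = g" using that by (auto simp: slice_def P_def)
    then have lv: "length v = n" "v \<noteq> []" using len ends by auto
    show ?thesis
      using pr_full_slice[OF vA(1) lv(2)] hd_pr_full[OF lv(2)] pr_pr[of n v] adj_pr[of n v] that vA lv n
      by (simp add: P_def)
  qed
  have u1: "v = w" if "P v" "P w" "v \<in> hood S" "w \<in> hood S" for v w
    using hood_hd_unique[of g v w] that l by (auto simp: P_def slice_def)
  have u2: "v = w" if "P v" "P w" "pr n v \<in> hood S" "pr n w \<in> hood S" for v w
  proof -
    have "pr n v = pr n w"
    proof (rule hood_hd_unique[of g'])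
      show "lone g'" by (rule l(2))
    qed (use pr[OF that(1)] pr[OF that(2)] that in \<open>simp_all add: slice_def\<close>)
    then have "pr n (pr n v) = pr n (pr n w)" by simp
    then show ?thesis using pr[OF that(1)] pr[OF that(2)] by simp
  qed
  have "\<exists>v. P v \<and> v \<notin> hood S \<and> pr n v \<notin> hood S"
  proof (rule ccontr)
    assume "\<nexists>v. P v \<and> v \<notin> hood S \<and> pr n v \<notin> hood S"
    then have "v \<in> hood S \<or> pr n v \<in> hood S" if "P v" for v using that by blast
    from this[OF xyz(1)] this[OF xyz(2)] this[OF xyz(3)] show False
      using u1[OF xyz(1,2)] u1[OF xyz(1,3)] u1[OF xyz(2,3)] u2[OF xyz(1,2)] u2[OF xyz(1,3)]
        u2[OF xyz(2,3)] xyz(4-6) by blast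
  qed
  then obtain v where v: "P v" "v \<notin> hood S" "pr n v \<notin> hood S" by blast
  then show ?thesis
    unfolding linked_def using owned_avoiding pr[OF v(1)] unfolding P_def by blast
qed

end

text \<open>By \<open>surj\<close> every terminal finds an entry to each tree. By
  \<open>land\<close> an entry, possibly after a reversal of length 1, leaves for a hub of its tree
  unless its own slice is one. By \<open>pivot\<close> only the tree \<theta> may have hubs with
  terminals: if a complete reversal joins two terminals, the edge is at the disposal of a single
  tree, and this is \<theta>.\<close>

locale tree_scheme = terminals +
  fixes \<Theta> :: "int set" and \<tau> :: "int \<Rightarrow> int \<Rightarrow> int" and \<rho> :: "int \<Rightarrow> int" and \<theta> :: int
  assumes surj: "\<And>h t. h \<in> last ` S \<Longrightarrow> t \<in> \<Theta> \<Longrightarrow> \<exists>c\<in>{1..int n}. c \<noteq> \<bar>h\<bar> \<and> \<tau> h c = t"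
    and root: "\<And>t. t \<in> \<Theta> \<Longrightarrow> \<exists>g. \<bar>g\<bar> \<in> {1..int n} \<and> \<rho> g = t \<and>
      (\<forall>g'. \<bar>g'\<bar> \<in> {1..int n} \<and> \<rho> g' = t \<and> g' \<noteq> g \<longrightarrow> linked n S \<tau> \<rho> g' g)"
    and land: "\<And>h c. h \<in> last ` S \<Longrightarrow> c \<in> {1..int n} \<Longrightarrow> c \<noteq> \<bar>h\<bar> \<Longrightarrow> \<tau> h c \<in> \<Theta> \<Longrightarrow>
      \<rho> h = \<tau> h c \<or> (\<exists>g\<in>{c, - c}. lands S \<tau> \<rho> h g (\<tau> h c))"
    and tail: "\<And>x i. x \<in> S \<Longrightarrow> pr i x \<in> S \<Longrightarrow> 2 \<le> i \<Longrightarrow> i < n \<Longrightarrow>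
      tailed S \<tau> \<rho> x (pr i x) \<or> tailed S \<tau> \<rho> (pr i x) x"
    and pivot: "\<And>g. g \<in> last ` S \<Longrightarrow> \<rho> g \<in> \<Theta> \<Longrightarrow> \<rho> g = \<theta> \<and> lone g"
begin

abbreviation "M \<equiv> owned n S \<tau> \<rho>"

definition lab :: "int list \<Rightarrow> int" where
  "lab v = (if v \<in> hood S then \<tau> (last v) \<bar>hd v\<bar> else \<rho> (last v))"

definition D :: "int \<Rightarrow> int list set" where
  "D t = {v \<in> sperms A - S. lab v = t}"

text \<open>The tree that may use an edge between two vertices of \<open>S\<close>.\<close>

definition el :: "int list set \<Rightarrow> int" where
  "el e = (SOME t. \<exists>x y. e = {x, y} \<and> x \<in> S \<and> y \<in> S \<and> (y = pr n x \<and> t = \<theta> \<or>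
     y = pr 1 x \<and> t = \<tau> (last x) \<bar>hd x\<bar> \<or>
     (\<exists>i. 2 \<le> i \<and> i < n \<and> y = pr i x \<and> tailed S \<tau> \<rho> x y \<and> t = \<tau> (last x) \<bar>hd x\<bar>)))"

text \<open>An edge with an end in some \<open>D t\<close> can belong to no other tree, and edges
  inside S are divided by \<open>el\<close>. Therefore the sets \<open>F t\<close> are disjoint
  before any spanning tree is chosen.\<close>

definition F :: "int \<Rightarrow> int list set set" where
  "F t = {{u, v} |u v. u \<in> D t \<union> S \<and> v \<in> D t \<union> S \<and> adj u v \<and> (u \<in> D t \<or> v \<in> D t \<or> el {u, v} = t)}"

text \<open>An edge determines the length of its reversal by \<open>pr_inj\<close>. For length 1
  both ends yield the same value; for lengths strictly between 1 and n both ends may be tailed and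
  the choice may take either, hence the disjunction.\<close>

lemma el_cases:
  assumes x: "x \<in> S" "pr i x \<in> S" and i: "1 \<le> i" "i \<le> n"
    and ex: "\<exists>t. (i = n \<and> t = \<theta>) \<or> (i = 1 \<and> t = \<tau> (last x) \<bar>hd x\<bar>) \<or>
      (2 \<le> i \<and> i < n \<and> (tailed S \<tau> \<rho> x (pr i x) \<and> t = \<tau> (last x) \<bar>hd x\<bar> \<or>
         tailed S \<tau> \<rho> (pr i x) x \<and> t = \<tau> (last x) \<bar>hd (pr i x)\<bar>))"
  shows "(i = n \<and> el {x, pr i x} = \<theta>) \<or> (i = 1 \<and> el {x, pr i x} = \<tau> (last x) \<bar>hd x\<bar>) \<or>
      (2 \<le> i \<and> i < n \<and> (tailed S \<tau> \<rho> x (pr i x) \<and> el {x, pr i x} = \<tau> (last x) \<bar>hd x\<bar> \<or>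
         tailed S \<tau> \<rho> (pr i x) x \<and> el {x, pr i x} = \<tau> (last x) \<bar>hd (pr i x)\<bar>))"
proof -
  let ?e = "{x, pr i x}"
  let ?P = "\<lambda>t. \<exists>u y. ?e = {u, y} \<and> u \<in> S \<and> y \<in> S \<and> (y = pr n u \<and> t = \<theta> \<or>
     y = pr 1 u \<and> t = \<tau> (last u) \<bar>hd u\<bar> \<or>
     (\<exists>i. 2 \<le> i \<and> i < n \<and> y = pr i u \<and> tailed S \<tau> \<rho> u y \<and> t = \<tau> (last u) \<bar>hd u\<bar>))"
  have lx: "length x = n" using len SD x by blast
  have invol: "pr i (pr i x) = x" using i lx by (simp add: pr_pr)
  have lst: "i < n \<Longrightarrow> last (pr i x) = last x" using lx by (simp add: last_pr)
  have hd1: "\<bar>hd (pr 1 x)\<bar> = \<bar>hd x\<bar>" using hd_pr_1[of x] ends SD x by auto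
  have "\<exists>t. ?P t"
    using ex
  proof (elim exE disjE conjE)
    fix t assume "2 \<le> i" "i < n" "tailed S \<tau> \<rho> (pr i x) x"
    then show ?thesis
      using x invol by (intro exI[of _ "\<tau> (last (pr i x)) \<bar>hd (pr i x)\<bar>"] exI[of _ "pr i x"] exI[of _ x]) auto
  qed (use x in blast)+
  then have "?P (el ?e)" unfolding el_def by (rule someI_ex)
  then obtain u y where uy: "?e = {u, y}" "y = pr n u \<and> el ?e = \<theta> \<or>
     y = pr 1 u \<and> el ?e = \<tau> (last u) \<bar>hd u\<bar> \<or>
     (\<exists>i. 2 \<le> i \<and> i < n \<and> y = pr i u \<and> tailed S \<tau> \<rho> u y \<and> el ?e = \<tau> (last u) \<bar>hd u\<bar>)" and uS: "u \<in> S"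
    by blast
  have lu: "length u = n" using len SD uS by blast
  have y: "y = pr i u"
    using uy(1) invol by (auto simp: doubleton_eq_iff)
  have inj: "j = i" if "1 \<le> j" "j \<le> n" "y = pr j u" for j
    using pr_inj[OF SD[OF uS], of j i] that i y lu by auto
  have n1: "1 \<le> n" "1 \<noteq> n" using n by auto
  from uy(2) consider "i = n" "el ?e = \<theta>" | "i = 1" "el ?e = \<tau> (last u) \<bar>hd u\<bar>"
    | "2 \<le> i" "i < n" "tailed S \<tau> \<rho> u y" "el ?e = \<tau> (last u) \<bar>hd u\<bar>"
  proof (elim disjE conjE exE)
    assume "y = pr n u" "el ?e = \<theta>"
    then show thesis using inj[of n] n1 that(1) by simp
  next
    assume "y = pr 1 u" "el ?e = \<tau> (last u) \<bar>hd u\<bar>"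
    then show thesis using inj[of 1] n1 that(2) by simp
  next
    fix j assume j: "2 \<le> j" "j < n" "y = pr j u" "tailed S \<tau> \<rho> u y" "el ?e = \<tau> (last u) \<bar>hd u\<bar>"
    then have "j = i" by (intro inj) auto
    then show thesis using j that(3) by simp
  qed
  then show ?thesis
  proof cases
    case 2
    have "u = x \<or> u = pr 1 x" using uy(1) 2 by (auto simp: doubleton_eq_iff)
    then have "last u = last x" "\<bar>hd u\<bar> = \<bar>hd x\<bar>" using hd1 lst 2(1) n1 by auto
    then show ?thesis using 2 by simp
  next
    case 3
    have "(u = x \<and> y = pr i x) \<or> (u = pr i x \<and> y = x)" using uy(1) by (auto simp: doubleton_eq_iff)
    then show ?thesis using 3 lst by auto
  qed simp
qed

lemma F_iff: "{u, v} \<in> F t \<longleftrightarrow>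
    u \<in> D t \<union> S \<and> v \<in> D t \<union> S \<and> adj u v \<and> (u \<in> D t \<or> v \<in> D t \<or> el {u, v} = t)"
proof
  assume "{u, v} \<in> F t"
  then obtain a b where ab: "{u, v} = {a, b}" "a \<in> D t \<union> S" "b \<in> D t \<union> S" "adj a b"
    "a \<in> D t \<or> b \<in> D t \<or> el {a, b} = t"
    unfolding F_def by blast
  then have "(u = a \<and> v = b) \<or> (u = b \<and> v = a)" by (simp add: doubleton_eq_iff)
  then show "u \<in> D t \<union> S \<and> v \<in> D t \<union> S \<and> adj u v \<and> (u \<in> D t \<or> v \<in> D t \<or> el {u, v} = t)"
    using ab adj_sym[OF ab(4)] by (elim disjE) simp_all
qed (unfold F_def, blast)

lemma owned_D: "\<rho> g = t \<Longrightarrow> M g \<subseteq> D t"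
  by (auto simp: owned_def D_def lab_def slice_def)

definition core :: "int \<Rightarrow> int list set" where
  "core t = (\<Union>g\<in>{g. \<bar>g\<bar> \<in> A \<and> \<rho> g = t}. M g)"

lemma core_D: "core t \<subseteq> D t"
  using owned_D by (auto simp: core_def)

lemma conn_on_core:
  assumes t: "t \<in> \<Theta>"
  shows "conn_on (core t)" "core t \<noteq> {}"
proof -
  obtain g where g: "\<bar>g\<bar> \<in> A" "\<rho> g = t"
    and link: "\<And>g'. \<bar>g'\<bar> \<in> A \<Longrightarrow> \<rho> g' = t \<Longrightarrow> g' \<noteq> g \<Longrightarrow> linked n S \<tau> \<rho> g' g"
    using root[OF t] by blast
  let ?P = "{g'. \<bar>g'\<bar> \<in> A \<and> \<rho> g' = t \<and> g' \<noteq> g}"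
  have "conn_on (M g \<union> (\<Union>g'\<in>?P. M g'))"
  proof (rule conn_on_star)
    show "conn_on (M g)" "M g \<noteq> {}" using conn_on_owned[of g] owned_nonempty[of g] g t pivot[of g] by simp_all
    fix g' assume g': "g' \<in> ?P"
    then show "conn_on (M g')" using conn_on_owned[of g'] t pivot[of g'] by simp
    show "\<exists>u\<in>M g'. \<exists>v\<in>M g. adj u v" using link g' by (auto simp: linked_def)
  qed
  moreover have eq: "core t = M g \<union> (\<Union>g'\<in>?P. M g')" using g by (auto simp: core_def)
  ultimately show "conn_on (core t)" by simp
  show "core t \<noteq> {}" using eq owned_nonempty[OF g(1)] g t pivot[of g] by auto
qed

lemma core_reach:
  assumes "t \<in> \<Theta>" "u \<in> core t" "v \<in> core t"
  shows "reach (F t) u v"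
proof (rule reach_mono)
  show "reach (induced_edges (core t)) u v"
    using conn_on_core[OF assms(1)] assms by (simp add: conn_on_def)
  show "induced_edges (core t) \<subseteq> F t"
    using core_D[of t] unfolding induced_edges_def F_def by blast
qed

definition attached :: "int \<Rightarrow> int list \<Rightarrow> bool" where
  "attached t v \<longleftrightarrow> (\<exists>r\<in>core t. reach (F t) v r)"

lemma core_attached: "v \<in> core t \<Longrightarrow> attached t v"
  unfolding attached_def by (rule bexI[of _ v]) simp_all

lemma attached_edge:
  assumes "{u, v} \<in> F t" "attached t v"
  shows "attached t u"
proof -
  obtain r where r: "r \<in> core t" "reach (F t) v r" using assms(2) by (auto simp: attached_def)
  have "reach (F t) u r" by (rule reach_trans[OF reach_edge[OF assms(1)] r(2)])
  then show ?thesis using r(1) by (auto simp: attached_def)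
qed

lemma hood_D_or_S:
  assumes "v \<in> hood S" "\<tau> (last v) \<bar>hd v\<bar> = t"
  shows "v \<in> D t \<union> S"
  using assms hood_props by (auto simp: D_def lab_def)

text \<open>The neighbour of x whose colour is labelled t lies in the owned part of the hub; it is
  no terminal because x is alone in its slice.\<close>

lemma lone_attached:
  assumes x: "x \<in> S" and t: "\<rho> (last x) = t" "t \<in> \<Theta>"
  shows "attached t x"
proof -
  have xA: "x \<in> sperms A" and lx: "length x = n" using SD len x by auto
  obtain y where y: "{z \<in> S. last z = last x} = {y}" using pivot[of "last x"] x t lone_def by blast
  obtain c where c: "c \<in> A" "c \<noteq> \<bar>last x\<bar>" "\<tau> (last x) c = t" using surj x t by blast
  obtain i where i: "i < n" "\<bar>x ! i\<bar> = c" using sperms_obtain_index[OF xA c(1)] lx by metis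
  have "i \<noteq> n - 1" using i c(2) lx ends[OF xA] last_conv_nth[of x] by auto
  then have i': "Suc i \<in> {1..<n}" using i by auto
  let ?v = "pr (Suc i) x"
  have v: "last ?v = last x" "\<bar>hd ?v\<bar> = c" "?v \<in> sperms A"
    using i' lx i hd_pr[of "Suc i" x] xA by (auto simp: last_pr pr_sperms)
  have "?v \<in> near x" using i' lx unfolding near_def by blast
  then have vh: "?v \<in> hood S" using x by (auto simp: hood_def)
  have "?v \<notin> S"
  proof
    assume "?v \<in> S"
    then have "?v \<in> {z \<in> S. last z = last x}" "x \<in> {z \<in> S. last z = last x}" using v(1) x by auto
    then have "?v = x" unfolding y by simp
    then show False using pr_neq[OF xA, of "Suc i"] i' by auto
  qed
  then have "?v \<in> M (last x)" using v vh c t by (auto simp: owned_def slice_def)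
  then have vc: "?v \<in> core t" using ends[OF xA] t by (auto simp: core_def)
  have "?v \<in> D t" using vc core_D by blast
  moreover have "adj x ?v" using i' lx by (intro adj_pr) auto
  ultimately have "{x, ?v} \<in> F t" using x by (simp add: F_iff)
  then show ?thesis using core_attached[OF vc] attached_edge by blast
qed

text \<open>The complete reversal arrives in a hub of t. If it meets a terminal there,
  \<open>pivot\<close> forces t = \<theta>, so the edge is available to t even when v is a terminal
  as well, and that terminal is attached by \<open>lone_attached\<close>.\<close>

lemma exit_attached:
  assumes v: "v \<in> hood S" "v \<in> D t \<union> S" and t: "t \<in> \<Theta>" and l: "lands S \<tau> \<rho> (last v) (- hd v) t"
  shows "attached t v"
proof -
  let ?w = "pr n v"
  have vA: "v \<in> sperms A" using hood_props v by blast
  have lv: "length v = n" "v \<noteq> []" using len vA ends by auto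
  have w: "?w \<in> slice A (- hd v)" "hd ?w = - last v"
    using pr_full_slice[OF vA lv(2)] hd_pr_full[OF lv(2)] lv by auto
  then have lw: "last ?w = - hd v" by (simp add: slice_def)
  have a: "adj v ?w" using lv n by (intro adj_pr) auto
  show ?thesis
  proof (cases "?w \<in> S")
    case True
    then have U: "- hd v \<in> U" using lw by force
    have rho: "\<rho> (- hd v) = t" using l by (simp add: lands_def)
    then have th: "t = \<theta>" using pivot[OF U] t by auto
    have "el {v, ?w} = t" if "v \<in> S"
      using el_cases[OF that, of n] True n th by auto
    then have "{v, ?w} \<in> F t" using v(2) True a by (auto simp: F_iff)
    then show ?thesis using lone_attached[OF True] rho lw t attached_edge by metis
  next
    case False
    have "?w \<in> M (- hd v)"
      using w False l hood_props[of ?w] lw by (auto simp: owned_def lands_def)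
    then have wc: "?w \<in> core t"
      using l ends[OF vA] unfolding core_def lands_def by (intro UN_I[of "- hd v"]) auto
    have "?w \<in> D t" using wc core_D by blast
    then have "{v, ?w} \<in> F t" using v(2) a by (simp add: F_iff)
    then show ?thesis using core_attached[OF wc] attached_edge by blast
  qed
qed

text \<open>There are three routes: staying in the slice, leaving at once, or leaving after
  \<open>pr 1\<close>. The last one is open even between two terminals, since they have the same
  colour and \<open>el\<close> gives the edge to its tree.\<close>

lemma hood_attached:
  assumes v: "v \<in> hood S" and t: "\<tau> (last v) \<bar>hd v\<bar> = t" "t \<in> \<Theta>"
  shows "attached t v"
proof -
  let ?w = "pr 1 v"
  have vA: "v \<in> sperms A" and vU: "last v \<in> U" using hood_props v by auto
  have lv: "length v = n" "v \<noteq> []" using len vA ends by auto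
  have w: "?w \<in> hood S" "last ?w = last v" "hd ?w = - hd v"
    using hood_pr_1[OF v] lv n hd_pr_1[of v] by (auto simp: last_pr)
  have vD: "v \<in> D t \<union> S" and wD: "?w \<in> D t \<union> S"
    using hood_D_or_S v w t by auto
  have a: "adj v ?w" using lv n by (intro adj_pr) auto
  consider "\<rho> (last v) = t" | "lands S \<tau> \<rho> (last v) (- hd v) t" | "lands S \<tau> \<rho> (last v) (hd v) t"
    using land[OF vU, of "\<bar>hd v\<bar>"] ends[OF vA] t by (auto simp: abs_if split: if_splits)
  then show ?thesis
  proof cases
    case 1
    show ?thesis
    proof (cases "v \<in> S")
      case True
      then show ?thesis using lone_attached 1 t by blast
    next
      case False
      then have "v \<in> M (last v)" using v 1 t vA by (auto simp: owned_def slice_def)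
      then have "v \<in> core t" using 1 ends[OF vA] by (auto simp: core_def)
      then show ?thesis by (rule core_attached)
    qed
  next
    case 2
    then show ?thesis using exit_attached[OF v vD t(2)] by simp
  next
    case 3
    then have "attached t ?w" using exit_attached[OF w(1) wD t(2)] w by simp
    moreover have "el {v, ?w} = t" if "v \<in> S" "?w \<in> S"
      using el_cases[OF that] n t by auto
    then have "{v, ?w} \<in> F t" using vD wD a by (auto simp: F_iff)
    ultimately show ?thesis by (rule attached_edge[rotated])
  qed
qed

text \<open>The terminal enters the tree through the neighbour of the right colour. If that
  neighbour is a terminal too, then either the edge belongs to t, or \<open>tailed\<close> lets x
  leave by its own complete reversal. A neighbour \<open>pr 1 x\<close> is harmless, as x itself
  then has the right colour.\<close>

lemma S_attached:
  assumes x: "x \<in> S" and t: "t \<in> \<Theta>"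
  shows "attached t x"
proof -
  have xA: "x \<in> sperms A" and lx: "length x = n" using SD len x by auto
  obtain c where c: "c \<in> A" "c \<noteq> \<bar>last x\<bar>" "\<tau> (last x) c = t" using surj x t by blast
  obtain i where i: "i < n" "\<bar>x ! i\<bar> = c" using sperms_obtain_index[OF xA c(1)] lx by metis
  have "i \<noteq> n - 1" using i c(2) lx ends[OF xA] last_conv_nth[of x] by auto
  then have i': "Suc i \<in> {1..<n}" using i by auto
  let ?v = "pr (Suc i) x"
  have v: "last ?v = last x" "\<bar>hd ?v\<bar> = c"
    using i' lx i hd_pr[of "Suc i" x] by (auto simp: last_pr)
  have "?v \<in> near x" using i' lx unfolding near_def by blast
  then have vh: "?v \<in> hood S" using x by (auto simp: hood_def)
  have va: "attached t ?v" using hood_attached[OF vh] v c t by simp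
  have a: "adj x ?v" using i' lx by (intro adj_pr) auto
  show ?thesis
  proof (cases "?v \<in> S")
    case False
    then have "?v \<in> D t" using hood_D_or_S[OF vh] v c by auto
    then have "{x, ?v} \<in> F t" using x a by (simp add: F_iff)
    then show ?thesis using va attached_edge by blast
  next
    case vS: True
    show ?thesis
    proof (cases "i = 0")
      case True
      then have "\<bar>hd x\<bar> = c" using i lx n by (metis hd_conv_nth length_0_conv not_numeral_le_zero)
      then show ?thesis using hood_attached[OF S_hood[OF x]] c t by simp
    next
      case False
      then have ii: "2 \<le> Suc i" "Suc i < n" using i' by auto
      consider "tailed S \<tau> \<rho> x ?v" | "el {x, ?v} = \<tau> (last x) \<bar>hd ?v\<bar>"
        using el_cases[OF x vS] tail[OF x vS ii] ii by (auto split: if_splits)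
      then show ?thesis
      proof cases
        case 1
        then have "lands S \<tau> \<rho> (last x) (- hd x) t" using v c by (simp add: tailed_def)
        then show ?thesis using exit_attached[OF S_hood[OF x]] x t by blast
      next
        case 2
        then have "{x, ?v} \<in> F t" using x vS a v c by (simp add: F_iff)
        then show ?thesis using va attached_edge by blast
      qed
    qed
  qed
qed

lemma D_attached:
  assumes v: "v \<in> D t" and t: "t \<in> \<Theta>"
  shows "attached t v"
proof (cases "v \<in> hood S")
  case True
  then show ?thesis using hood_attached[OF True _ t] v by (simp add: D_def lab_def)
next
  case False
  then have r: "\<rho> (last v) = t" and vA: "v \<in> sperms A" "v \<notin> S" using v by (auto simp: D_def lab_def)
  then have "v \<in> M (last v)" using False by (auto simp: owned_def slice_def)
  then have "v \<in> core t" using r ends[OF vA(1)] by (auto simp: core_def)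
  then show ?thesis by (rule core_attached)
qed

lemma tree_reach:
  assumes t: "t \<in> \<Theta>" and uv: "u \<in> D t \<union> S" "v \<in> D t \<union> S"
  shows "reach (F t) u v"
proof -
  have "attached t u" "attached t v" using uv S_attached D_attached t by auto
  then obtain r r' where r: "r \<in> core t" "reach (F t) u r" "r' \<in> core t" "reach (F t) v r'"
    by (auto simp: attached_def)
  have "reach (F t) u r'" using r(2) core_reach[OF t r(1,3)] by (rule reach_trans)
  also have "reach (F t) r' v" using r(4) by (rule reach_sym)
  finally show ?thesis .
qed

lemma F_edges: "F t \<subseteq> sg_edges (burnt_pancake n)"
proof
  fix e assume "e \<in> F t"
  then obtain u v where e: "e = {u, v}" "u \<in> D t \<union> S" "v \<in> D t \<union> S" "adj u v" by (auto simp: F_def)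
  then have "u \<in> sperms A" "v \<in> sperms A" using SD by (auto simp: D_def)
  then show "e \<in> sg_edges (burnt_pancake n)"
    using e len by (auto simp: burnt_pancake_def signed_perms_eq adj_def)
qed

theorem ex_packing: "\<exists>T. packing (burnt_pancake n) S \<Theta> T"
proof -
  have tree: "\<exists>F'. F' \<subseteq> F t \<and> sg_tree \<lparr>sg_verts = D t \<union> S, sg_edges = F'\<rparr>" if t: "t \<in> \<Theta>" for t
  proof -
    have fin: "finite (D t \<union> S)"
      using SD by (intro finite_subset[OF _ finite_sperms[OF finA]]) (auto simp: D_def)
    have ne: "D t \<union> S \<noteq> {}" using conn_on_core(2)[OF t] core_D by blast
    have e: "e \<subseteq> D t \<union> S \<and> card e = 2" if "e \<in> F t" for e
      using that F_edges simple_graph_burnt_pancake[of n]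
      by (auto simp: F_def simple_graph_def)
    show ?thesis
      using spanning_tree[OF fin ne e tree_reach[OF t]] by metis
  qed
  then obtain E where E: "\<And>t. t \<in> \<Theta> \<Longrightarrow> E t \<subseteq> F t \<and> sg_tree \<lparr>sg_verts = D t \<union> S, sg_edges = E t\<rparr>"
    by metis
  have disj: "D t \<inter> D t' = {}" if "t \<noteq> t'" for t t' using that by (auto simp: D_def)
  have DS: "D t \<inter> S = {}" for t by (auto simp: D_def)
  have disjF: "F t \<inter> F t' = {}" if "t \<noteq> t'" for t t'
  proof -
    have False if "e \<in> F t" "e \<in> F t'" for e
    proof -
      obtain u v where e: "e = {u, v}" using \<open>e \<in> F t\<close> by (auto simp: F_def)
      show False
        using that[unfolded e F_iff] disj[OF \<open>t \<noteq> t'\<close>] DS[of t] DS[of t'] \<open>t \<noteq> t'\<close> by blast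
    qed
    then show ?thesis by blast
  qed
  have "packing (burnt_pancake n) S \<Theta> (\<lambda>t. \<lparr>sg_verts = D t \<union> S, sg_edges = E t\<rparr>)"
    unfolding packing_def
  proof (intro conjI ballI impI)
    fix t assume t: "t \<in> \<Theta>"
    show "S_tree (burnt_pancake n) S \<lparr>sg_verts = D t \<union> S, sg_edges = E t\<rparr>"
      using E[OF t] F_edges[of t] SD
      by (auto simp: S_tree_def sg_subgraph_def sg_tree_def burnt_pancake_def signed_perms_eq D_def)
  next
    fix t t' assume t: "t \<in> \<Theta>" "t' \<in> \<Theta>" "t \<noteq> t'"
    have "E t \<inter> E t' \<subseteq> F t \<inter> F t'" using E t by blast
    moreover have "(D t \<union> S) \<inter> (D t' \<union> S) = S" using disj[OF t(3)] by blast
    ultimately show "internally_edge_disjoint S \<lparr>sg_verts = D t \<union> S, sg_edges = E t\<rparr>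
        \<lparr>sg_verts = D t' \<union> S, sg_edges = E t'\<rparr>"
      using disjF[OF t(3)] by (simp add: internally_edge_disjoint_def)
  qed
  then show ?thesis by blast
qed

end

section \<open>Edges between terminals\<close>

lemma nth_pr: "i \<le> length x \<Longrightarrow> p < length x \<Longrightarrow> pr i x ! p = (if p < i then - (x ! (i - 1 - p)) else x ! p)"
  by (auto simp: prefix_reversal_def nth_append rev_nth)

text \<open>A pair \<open>(x, y)\<close> in \<open>Q\<close> is an edge of \<open>H\<close> with \<open>x\<close> as its chosen end.\<close>

lemma selection_four:
  fixes \<kappa> :: "'a \<Rightarrow> 'b"
  assumes S: "finite S" "card S \<le> 4"
    and H: "\<And>x y. H x y \<Longrightarrow> x \<in> S" "\<And>x y. H x y \<Longrightarrow> H y x"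
    and neq: "\<And>x y. H x y \<Longrightarrow> \<kappa> x \<noteq> \<kappa> y"
    and nbr: "\<And>x y z. H x y \<Longrightarrow> H x z \<Longrightarrow> y \<noteq> z \<Longrightarrow> \<kappa> y \<noteq> \<kappa> z"
    and tri: "\<And>x y z. H x y \<Longrightarrow> H y z \<Longrightarrow> \<not> H x z"
  shows "\<exists>Q. (\<forall>(x, y)\<in>Q. H x y) \<and> (\<forall>x y. H x y \<longrightarrow> (x, y) \<in> Q \<or> (y, x) \<in> Q) \<and>
    inj_on (\<lambda>(x, y). \<kappa> x) Q" (is "\<exists>Q. ?good Q")
proof (cases "\<exists>a b c. H b a \<and> H b c \<and> a \<noteq> c")
  case True
  then obtain a b c where abc: "H b a" "H b c" "a \<noteq> c" by blast
  have sym: "H a b" "H c b" by (rule H(2)[OF abc(1)], rule H(2)[OF abc(2)])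
  have nHac: "\<not> H a c" "\<not> H c a" by (rule tri[OF sym(1) abc(2)], rule tri[OF sym(2) abc(1)])
  have irr: "\<not> H x x" for x using neq[of x x] by auto
  have k: "\<kappa> a \<noteq> \<kappa> c" "\<kappa> b \<noteq> \<kappa> a" "\<kappa> b \<noteq> \<kappa> c"
    by (rule nbr[OF abc], rule neq[OF abc(1)], rule neq[OF abc(2)])
  then have ne: "a \<noteq> b" "b \<noteq> c" by auto
  have "card (S - {a, b, c}) \<le> 1"
  proof -
    have "{a, b, c} \<subseteq> S" using H(1)[OF sym(1)] H(1)[OF sym(2)] H(1)[OF abc(1)] by simp
    moreover have "card {a, b, c} = 3" using ne abc(3) by simp
    ultimately show ?thesis using S card_Diff_subset[of "{a, b, c}" S] by simp
  qed
  then consider "card (S - {a, b, c}) = 0" | "card (S - {a, b, c}) = 1" by linarith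
  then have "\<exists>d. S \<subseteq> {a, b, c, d}"
  proof cases
    case 1
    then have "S - {a, b, c} = {}" using S(1) by simp
    then show ?thesis by blast
  next
    case 2
    then obtain d where "S - {a, b, c} = {d}" by (rule card_1_singletonE)
    then show ?thesis by blast
  qed
  then obtain d where d: "S \<subseteq> {a, b, c, d}" by blast
  have mem: "x \<in> {a, b, c, d}" "y \<in> {a, b, c, d}" if "H x y" for x y
    using subsetD[OF d H(1)[OF that]] subsetD[OF d H(1)[OF H(2)[OF that]]] by simp_all
  show ?thesis
  proof (cases "H b d \<and> d \<noteq> a \<and> d \<noteq> c")
    case True
    then have bd: "H b d" and db: "H d b" using H(2)[of b d] by simp_all
    have nd: "\<not> H a d" "\<not> H d a" "\<not> H c d" "\<not> H d c"
      using tri[OF sym(1) bd] tri[OF db abc(1)] tri[OF sym(2) bd] tri[OF db abc(2)] by simp_all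
    have kd: "\<kappa> a \<noteq> \<kappa> d" "\<kappa> c \<noteq> \<kappa> d" using nbr[OF abc(1) bd] nbr[OF abc(2) bd] True by auto
    \<comment> \<open>A star: the leaves are neighbours of b and so have different colours.\<close>
    have "?good {(a, b), (c, b), (d, b)}"
    proof (intro conjI allI impI)
      show "\<forall>(x, y)\<in>{(a, b), (c, b), (d, b)}. H x y" using sym db by simp
      fix x y assume xy: "H x y"
      then show "(x, y) \<in> {(a, b), (c, b), (d, b)} \<or> (y, x) \<in> {(a, b), (c, b), (d, b)}"
        using mem[OF xy] nHac nd irr by auto
    qed (use k kd in \<open>auto simp: inj_on_def\<close>)
    then show ?thesis by blast
  next
    case F: False
    have nbd: "\<not> H b d \<or> d = a \<or> d = c" "\<not> H d b \<or> d = a \<or> d = c" using F H(2)[of d b] by auto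
    show ?thesis
    proof (cases "H c d \<and> d \<noteq> b")
      case True
      then have dn: "d \<noteq> a" "d \<noteq> c" using nHac irr by auto
      have kd: "\<kappa> c \<noteq> \<kappa> d" "\<kappa> b \<noteq> \<kappa> d"
        using neq[of c d] True nbr[of c b d] sym by auto
      \<comment> \<open>A path a, b, c, d, perhaps closed to a cycle: every vertex takes the edge to
        its successor. Two chosen ends are adjacent or have a common neighbour, so their colours
        differ.\<close>
      let ?Q = "{(a, b), (b, c), (c, d)} \<union> (if H d a then {(d, a)} else {})"
      have kda: "H d a \<Longrightarrow> \<kappa> d \<noteq> \<kappa> a" using neq[of d a] by simp
      have "?good ?Q"
      proof (intro conjI allI impI)
        show "\<forall>(x, y)\<in>?Q. H x y" using abc True sym by simp
        fix x y assume xy: "H x y"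
        then show "(x, y) \<in> ?Q \<or> (y, x) \<in> ?Q"
          using mem[OF xy] nHac nbd dn irr H(2)[OF xy] by auto
      qed (use k kd kda in \<open>auto simp: inj_on_def\<close>)
      then show ?thesis by blast
    next
      case G: False
      have nG: "\<not> H c d \<or> d = b" "\<not> H d c \<or> d = b" using G H(2)[of d c] by auto
      \<comment> \<open>Beyond b and c, the only further edge can join a and d. Along c, b, a, d
        every vertex takes the edge to its successor.\<close>
      let ?Q = "{(c, b), (b, a)} \<union> (if H a d \<and> d \<noteq> b then {(a, d)} else {})"
      have "?good ?Q"
      proof (intro conjI allI impI)
        show "\<forall>(x, y)\<in>?Q. H x y" using abc sym by simp
        fix x y assume xy: "H x y"
        then show "(x, y) \<in> ?Q \<or> (y, x) \<in> ?Q"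
          using mem[OF xy] nHac nbd nG irr H(2)[OF xy] by auto
      qed (use k in \<open>auto simp: inj_on_def\<close>)
      then show ?thesis by blast
    qed
  qed
next
  case False
  then have deg: "a = c" if "H b a" "H b c" for a b c using that by blast
  show ?thesis
  proof (cases "\<exists>x y. H x y")
    case False
    then show ?thesis by (intro exI[of _ "{}"]) auto
  next
    case True
    then obtain x y where xy: "H x y" by blast
    show ?thesis
    proof (cases "\<exists>z w. H z w \<and> z \<noteq> x \<and> z \<noteq> y")
      case False
        have yx: "H y x" by (rule H(2)[OF xy])
      have "?good {(x, y)}"
      proof (intro conjI allI impI)
        fix u v assume uv: "H u v"
        then have "u = x \<or> u = y" using False by blast
        then show "(u, v) \<in> {(x, y)} \<or> (v, u) \<in> {(x, y)}"
          using deg[OF xy, of v] deg[OF yx, of v] uv by auto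
      qed (use xy in auto)
      then show ?thesis by blast
    next
      case True
      then obtain z w where zw: "H z w" "z \<noteq> x" "z \<noteq> y" by blast
      have yx: "H y x" and wz: "H w z" by (rule H(2)[OF xy], rule H(2)[OF zw(1)])
      have w: "w \<noteq> x" "w \<noteq> y" using deg[OF xy, of z] deg[OF yx, of z] wz zw by auto
      have ne: "x \<noteq> y" "z \<noteq> w" using neq[OF xy] neq[OF zw(1)] by auto
      have "S = {x, y, z, w}"
      proof (rule sym, rule card_seteq)
        show "{x, y, z, w} \<subseteq> S" using H(1)[OF xy] H(1)[OF yx] H(1)[OF zw(1)] H(1)[OF wz] by simp
        have "card {x, y, z, w} = 4" using w zw ne by simp
        then show "card S \<le> card {x, y, z, w}" using S by simp
      qed (rule S(1))
      then have edge: "(u = x \<and> v = y) \<or> (u = y \<and> v = x) \<or> (u = z \<and> v = w) \<or> (u = w \<and> v = z)"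
        if "H u v" for u v
        using H(1)[OF that] that deg[OF xy, of v] deg[OF yx, of v] deg[OF zw(1), of v] deg[OF wz, of v] by auto
      \<comment> \<open>Two disjoint edges: the ends of the second one have different colours, so
        one of them avoids the colour of x.\<close>
      define p where "p = (if \<kappa> z \<noteq> \<kappa> x then (z, w) else (w, z))"
      have "?good {(x, y), p}"
      proof (intro conjI allI impI)
        show "\<forall>(x, y)\<in>{(x, y), p}. H x y" using xy zw wz by (simp add: p_def)
        fix u v assume "H u v"
        then show "(u, v) \<in> {(x, y), p} \<or> (v, u) \<in> {(x, y), p}"
          using edge by (auto simp: p_def)
      qed (use neq[OF zw(1)] in \<open>auto simp: inj_on_def p_def split: if_splits\<close>)
      then show ?thesis by blast
    qed
  qed
qed

lemma selection_three:
  fixes \<kappa> :: "'a \<Rightarrow> 'b"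
  assumes S: "finite S" "card S \<le> 3"
    and H: "\<And>x y. H x y \<Longrightarrow> x \<in> S" "\<And>x y. H x y \<Longrightarrow> H y x"
    and neq: "\<And>x y. H x y \<Longrightarrow> \<kappa> x \<noteq> \<kappa> y"
    and nbr: "\<And>x y z. H x y \<Longrightarrow> H x z \<Longrightarrow> y \<noteq> z \<Longrightarrow> \<kappa> y \<noteq> \<kappa> z"
    and tri: "\<And>x y z. H x y \<Longrightarrow> H y z \<Longrightarrow> \<not> H x z"
  shows "\<exists>Q. (\<forall>(x, y)\<in>Q. H x y \<and> \<kappa> x \<noteq> \<beta>) \<and> (\<forall>x y. H x y \<longrightarrow> (x, y) \<in> Q \<or> (y, x) \<in> Q) \<and>
    inj_on (\<lambda>(x, y). \<kappa> x) Q" (is "\<exists>Q. ?good Q")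
proof (cases "\<exists>x y. H x y")
  case False
  then show ?thesis by (intro exI[of _ "{}"]) auto
next
  case True
  have irr: "\<not> H x x" for x using neq[of x x] by auto
  show ?thesis
  proof (cases "\<exists>a b c. H b a \<and> H b c \<and> a \<noteq> c")
    case True
    then obtain a b c where abc: "H b a" "H b c" "a \<noteq> c" by blast
    have Hba: "H a b" "H c b" by (rule H(2)[OF abc(1)], rule H(2)[OF abc(2)])
    have nHac: "\<not> H a c" "\<not> H c a" by (rule tri[OF Hba(1) abc(2)], rule tri[OF Hba(2) abc(1)])
    have k: "\<kappa> a \<noteq> \<kappa> c" "\<kappa> b \<noteq> \<kappa> a" "\<kappa> b \<noteq> \<kappa> c"
      by (rule nbr[OF abc], rule neq[OF abc(1)], rule neq[OF abc(2)])
    then have ne: "a \<noteq> b" "b \<noteq> c" by auto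
    have "S = {a, b, c}"
    proof (rule sym, rule card_seteq)
      show "{a, b, c} \<subseteq> S" using H(1)[OF Hba(1)] H(1)[OF Hba(2)] H(1)[OF abc(1)] by simp
      show "card S \<le> card {a, b, c}" using S ne abc(3) by simp
    qed (rule S(1))
    then have edge: "(u = b \<and> (v = a \<or> v = c)) \<or> (v = b \<and> (u = a \<or> u = c))" if "H u v" for u v
      using that H(1)[OF that] H(1)[OF H(2)[OF that]] nHac irr by auto
    \<comment> \<open>If the middle vertex has colour \<beta>, both outer ones are chosen; otherwise
      the middle one and an outer one whose colour is not \<beta>.\<close>
    define Q where "Q = (if \<kappa> b = \<beta> then {(a, b), (c, b)} else if \<kappa> a = \<beta> then {(b, a), (c, b)} else {(a, b), (b, c)})"
    have "?good Q"
    proof (intro conjI allI impI)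
      show "\<forall>(x, y)\<in>Q. H x y \<and> \<kappa> x \<noteq> \<beta>" using abc Hba k by (auto simp: Q_def)
      fix u v assume "H u v"
      then show "(u, v) \<in> Q \<or> (v, u) \<in> Q" using edge[of u v] by (auto simp: Q_def)
    qed (use k in \<open>auto simp: Q_def inj_on_def\<close>)
    then show ?thesis by blast
  next
    case False
    then have deg: "a = c" if "H b a" "H b c" for a b c using that by blast
    obtain x y where xy: "H x y" using True by blast
    have yx: "H y x" by (rule H(2)[OF xy])
    have edge: "(u = x \<and> v = y) \<or> (u = y \<and> v = x)" if uv: "H u v" for u v
    proof (rule ccontr)
      assume n: "\<not> ((u = x \<and> v = y) \<or> (u = y \<and> v = x))"
      have vu: "H v u" by (rule H(2)[OF uv])
      have ux: "u \<noteq> x" using deg[OF xy, of v] uv n by blast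
      have uy: "u \<noteq> y" using deg[OF yx, of v] uv n by blast
      have vx: "v \<noteq> x" using deg[OF xy, of u] vu n by blast
      have vy: "v \<noteq> y" using deg[OF yx, of u] vu n by blast
      have "u \<noteq> v" "x \<noteq> y" using neq[OF uv] neq[OF xy] by auto
      then have "card {x, y, u, v} = 4" using ux uy vx vy by simp
      moreover have "card {x, y, u, v} \<le> card S" using H(1)[OF xy] H(1)[OF yx] H(1)[OF uv] H(1)[OF vu] by (intro card_mono S(1)) simp
      ultimately show False using S by simp
    qed
    define p where "p = (if \<kappa> x \<noteq> \<beta> then (x, y) else (y, x))"
    have "?good {p}"
    proof (intro conjI allI impI)
      show "\<forall>(x, y)\<in>{p}. H x y \<and> \<kappa> x \<noteq> \<beta>" using xy yx neq[OF xy] by (auto simp: p_def)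
      fix u v assume "H u v"
      then show "(u, v) \<in> {p} \<or> (v, u) \<in> {p}" using edge[of u v] by (auto simp: p_def)
    qed simp
    then show ?thesis by blast
  qed
qed

text \<open>For e in E the slice \<open>sg e\<close> is the hub of the tree e, and the opposite
  slice is lent to the tree \<open>tg e\<close>. A terminal with first entry \<open>sg e\<close>
  thus reaches that tree by its complete reversal.\<close>

definition hubs :: "int set \<Rightarrow> (int \<Rightarrow> int) \<Rightarrow> (int \<Rightarrow> int) \<Rightarrow> (int \<Rightarrow> int) \<Rightarrow> int \<Rightarrow> int" where
  "hubs E sg tg \<rho> g = (if \<bar>g\<bar> \<in> E then if g = sg \<bar>g\<bar> then \<bar>g\<bar> else tg \<bar>g\<bar> else \<rho> g)"

lemma linked_cong:
  assumes "\<rho> g = \<rho>' g" "\<rho> g' = \<rho>' g'"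
  shows "linked n S \<tau> \<rho> g g' \<longleftrightarrow> linked n S \<tau> \<rho>' g g'"
  using assms by (simp add: linked_def owned_def)

section \<open>Conflicts: adjacent terminals of different colours in one slice\<close>

context terminals
begin

text \<open>Length 1 is excluded since both ends then have the same colour and label, length n since
  it leaves the slice.\<close>

definition conf :: "int list \<Rightarrow> int list \<Rightarrow> bool" where
  "conf x y \<longleftrightarrow> x \<in> S \<and> y \<in> S \<and> (\<exists>i. 2 \<le> i \<and> i < n \<and> y = pr i x)"

lemma finite_S: "finite S"
  using S finite_sperms[OF finA] by (rule finite_subset)

lemma confD: "conf x y \<Longrightarrow> x \<in> S \<and> y \<in> S"
  by (simp add: conf_def)

lemma conf_sym: "conf x y \<Longrightarrow> conf y x"
proof -
  assume "conf x y"
  then obtain i where i: "2 \<le> i" "i < n" "y = pr i x" "x \<in> S" "y \<in> S" by (auto simp: conf_def)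
  then have "x = pr i y" using len[OF SD] by (simp add: pr_pr)
  then show ?thesis using i by (auto simp: conf_def)
qed

lemma conf_last: "conf x y \<Longrightarrow> last y = last x"
  using len[OF SD] by (auto simp: conf_def last_pr)

lemma conf_hd:
  assumes x: "x \<in> S" and i: "2 \<le> i" "i < n"
  shows "\<bar>hd (pr i x)\<bar> = \<bar>x ! (i - 1)\<bar>" "i - 1 < length x" "0 < length x"
  using hd_pr[of i x] len SD[OF x] i by auto

lemma conf_hd_neq:
  assumes "conf x y"
  shows "\<bar>hd x\<bar> \<noteq> \<bar>hd y\<bar>"
proof
  assume eq: "\<bar>hd x\<bar> = \<bar>hd y\<bar>"
  obtain i where i: "2 \<le> i" "i < n" "y = pr i x" and x: "x \<in> S" using assms by (auto simp: conf_def)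
  have "x \<noteq> []" using ends SD x by blast
  then have "0 = i - 1"
    using conf_hd[OF x i(1,2)] eq i(3) by (intro sperms_nth_inj[OF SD[OF x]]) (auto simp: hd_conv_nth)
  then show False using i by simp
qed

lemma conf_hd_inj:
  assumes "conf x y" "conf x z" "y \<noteq> z"
  shows "\<bar>hd y\<bar> \<noteq> \<bar>hd z\<bar>"
proof
  assume eq: "\<bar>hd y\<bar> = \<bar>hd z\<bar>"
  obtain i where i: "2 \<le> i" "i < n" "y = pr i x" and x: "x \<in> S" using assms by (auto simp: conf_def)
  obtain j where j: "2 \<le> j" "j < n" "z = pr j x" using assms by (auto simp: conf_def)
  have "i - 1 = j - 1"
    using conf_hd[OF x i(1,2)] conf_hd[OF x j(1,2)] eq i(3) j(3)
    by (intro sperms_nth_inj[OF SD[OF x]]) auto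
  then have "i = j" using i j by linarith
  then show False using i j assms by simp
qed

text \<open>If j and k differ, the last position moved by the longer of these two reversals holds
  entries of different origin on the two sides. If they agree, they cancel and \<open>pr i\<close>
  would fix x.\<close>

lemma no_triangle_ordered:
  assumes x: "x \<in> sperms A" and ij: "2 \<le> i" "i < j" "j < n" and k: "2 \<le> k" "k < n"
  shows "pr j x \<noteq> pr k (pr i x)"
proof
  assume eq: "pr j x = pr k (pr i x)"
  have lx: "length x = n" using len x by blast
  have inj: "\<bar>x ! p\<bar> = \<bar>x ! q\<bar> \<Longrightarrow> p < n \<Longrightarrow> q < n \<Longrightarrow> p = q" for p q
    using sperms_nth_inj[OF x] lx by blast
  consider "k < j" | "k = j" | "j < k" by linarith
  then show False
  proof cases
    case 1
    have "pr j x ! (j - 1) = - (x ! 0)" using ij lx by (simp add: nth_pr)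
    moreover have "pr k (pr i x) ! (j - 1) = x ! (j - 1)"
    proof -
      have "\<not> j - 1 < k" "\<not> j - 1 < i" "j - 1 < n" using 1 ij by auto
      then show ?thesis using ij k lx by (simp add: nth_pr)
    qed
    ultimately have "j - 1 = 0" using eq ij by (intro inj) auto
    then show False using ij by simp
  next
    case 2
    then have "pr j (pr j x) = pr j (pr j (pr i x))" using eq by simp
    then have "x = pr i x" using ij lx by (simp add: pr_pr)
    then show False using pr_neq[OF x, of i] ij by auto
  next
    case 3
    have "\<not> k - 1 < j" "k - 1 < n" using 3 ij k by auto
    then have "pr j x ! (k - 1) = x ! (k - 1)" using ij lx by (simp add: nth_pr)
    moreover have "pr k (pr i x) ! (k - 1) = x ! (i - 1)"
      using 3 ij k lx by (simp add: nth_pr)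
    ultimately have "k - 1 = i - 1" using eq ij k 3 by (intro inj) auto
    then show False using ij 3 by linarith
  qed
qed

lemma conf_triangle:
  assumes "conf x y" "conf y z"
  shows "\<not> conf x z"
proof
  assume c: "conf x z"
  obtain i where i: "2 \<le> i" "i < n" "y = pr i x" and x: "x \<in> S" using assms by (auto simp: conf_def)
  obtain k where k: "2 \<le> k" "k < n" "z = pr k y" using assms by (auto simp: conf_def)
  obtain j where j: "2 \<le> j" "j < n" "z = pr j x" using c by (auto simp: conf_def)
  obtain k' where k': "2 \<le> k'" "k' < n" "y = pr k' z" using conf_sym[OF assms(2)] by (auto simp: conf_def)
  consider "i < j" | "i = j" | "j < i" by linarith
  then show False
  proof cases
    case 1
    then show False using no_triangle_ordered[OF SD[OF x] i(1) 1 j(2) k(1,2)] i j k by simp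
  next
    case 2
    then have "y = z" using i j by simp
    then show False using conf_hd_neq[OF assms(2)] by simp
  next
    case 3
    then show False using no_triangle_ordered[OF SD[OF x] j(1) 3 i(2) k'(1,2)] i j k' by simp
  qed
qed

text \<open>The colours in E can be treated uniformly: no terminal lies in a slice of such a colour,
  it is the label of its own tree everywhere, and one of its slices is a hub of that tree. Only the
  colours outside E and the conflicts remain to be checked.\<close>

lemma packing_by_hubs:
  assumes \<Theta>: "E \<subseteq> \<Theta>" "\<Theta> \<subseteq> A" and avoid: "\<And>h. h \<in> U \<Longrightarrow> \<bar>h\<bar> \<notin> E"
    and sg: "\<And>e. e \<in> E \<Longrightarrow> sg e = e \<or> sg e = - e" and tg: "\<And>e. e \<in> E \<Longrightarrow> tg e \<noteq> e"
    and \<tau>E: "\<And>h e. h \<in> U \<Longrightarrow> e \<in> E \<Longrightarrow> \<tau> h e = e"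
    and surj: "\<And>h t. h \<in> U \<Longrightarrow> t \<in> \<Theta> - E \<Longrightarrow> \<exists>c\<in>A. c \<noteq> \<bar>h\<bar> \<and> \<tau> h c = t"
    and \<rho>: "\<And>g. \<rho> g \<notin> E"
    and root: "\<And>t. t \<in> \<Theta> - E \<Longrightarrow> \<exists>g. \<bar>g\<bar> \<in> A - E \<and> \<rho> g = t \<and>
      (\<forall>g'. \<bar>g'\<bar> \<in> A - E \<and> \<rho> g' = t \<and> g' \<noteq> g \<longrightarrow> linked n S \<tau> \<rho> g' g)"
    and land: "\<And>h c. h \<in> U \<Longrightarrow> c \<in> A - E \<Longrightarrow> c \<noteq> \<bar>h\<bar> \<Longrightarrow>
      \<rho> h = \<tau> h c \<or> (\<exists>g\<in>{c, - c}. lands S \<tau> \<rho> h g (\<tau> h c))"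
    and pivot: "\<And>g. g \<in> U \<Longrightarrow> \<rho> g \<in> \<Theta> \<Longrightarrow> \<rho> g = \<theta> \<and> lone g"
    and tail: "\<And>x y. conf x y \<Longrightarrow> tailed S \<tau> (hubs E sg tg \<rho>) x y \<or> tailed S \<tau> (hubs E sg tg \<rho>) y x"
  shows "\<exists>T. packing (burnt_pancake n) S \<Theta> T"
proof -
  let ?\<rho> = "hubs E sg tg \<rho>"
  have E_pos: "0 < e" if "e \<in> E" for e using that \<Theta> by fastforce
  have out: "?\<rho> g = \<rho> g" if "\<bar>g\<bar> \<notin> E" for g using that by (simp add: hubs_def)
  have sg_abs: "\<bar>sg e\<bar> = e" if "e \<in> E" for e using sg[OF that] E_pos[OF that] by auto
  have E_free: "g \<notin> U" if "\<bar>g\<bar> \<in> E" for g using that avoid by blast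
  interpret tree_scheme n S \<Theta> \<tau> ?\<rho> \<theta>
  proof unfold_locales
    fix h t assume h: "h \<in> U" "t \<in> \<Theta>"
    show "\<exists>c\<in>A. c \<noteq> \<bar>h\<bar> \<and> \<tau> h c = t"
    proof (cases "t \<in> E")
      case True
      then show ?thesis using \<tau>E[OF h(1)] avoid[OF h(1)] \<Theta> by (intro bexI[of _ t]) auto
    next
      case False
      then show ?thesis using surj h by blast
    qed
  next
    fix t assume t: "t \<in> \<Theta>"
    show "\<exists>g. \<bar>g\<bar> \<in> A \<and> ?\<rho> g = t \<and> (\<forall>g'. \<bar>g'\<bar> \<in> A \<and> ?\<rho> g' = t \<and> g' \<noteq> g \<longrightarrow> linked n S \<tau> ?\<rho> g' g)"
    proof (cases "t \<in> E")
      case True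
      have "linked n S \<tau> ?\<rho> g' (sg t)" if g': "\<bar>g'\<bar> \<in> A" "?\<rho> g' = t" "g' \<noteq> sg t" for g'
      proof -
        have gE: "\<bar>g'\<bar> \<in> E" using g' \<rho>[of g'] True by (auto simp: hubs_def split: if_splits)
        \<comment> \<open>The condition on \<open>tg\<close> rules out the slice opposite to
          \<open>sg t\<close>, to which no complete reversal leads. Slices lent to t by other
          colours carry no terminals and are linked to \<open>sg t\<close>.\<close>
        then have "\<bar>g'\<bar> \<noteq> t" using g' tg[OF True] by (auto simp: hubs_def split: if_splits)
        then show ?thesis
          using linked_free[of g' "sg t"] g' sg_abs[OF True] E_free[OF gE] E_free[of "sg t"] True \<Theta> by auto
      qed
      moreover have "?\<rho> (sg t) = t" using sg_abs[OF True] True by (simp add: hubs_def)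
      ultimately show ?thesis using sg_abs[OF True] True \<Theta> by (intro exI[of _ "sg t"]) auto
    next
      case False
      then obtain g where g: "\<bar>g\<bar> \<in> A - E" "\<rho> g = t"
        and l: "\<And>g'. \<bar>g'\<bar> \<in> A - E \<Longrightarrow> \<rho> g' = t \<Longrightarrow> g' \<noteq> g \<Longrightarrow> linked n S \<tau> \<rho> g' g"
        using root[of t] t by blast
      have "linked n S \<tau> ?\<rho> g' g" if g': "\<bar>g'\<bar> \<in> A" "?\<rho> g' = t" "g' \<noteq> g" for g'
      proof (cases "\<bar>g'\<bar> \<in> E")
        case True
        have "g \<in> U \<Longrightarrow> lone g" using pivot[of g] g t by blast
        moreover have "\<bar>g\<bar> \<noteq> \<bar>g'\<bar>" using g(1) True by auto
        ultimately have "linked n S \<tau> ?\<rho> g g'"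
          using linked_free[of g g'] g(1) g'(1) E_free[OF True] by blast
        then show ?thesis by (rule linked_sym)
      next
        case False
        then have "linked n S \<tau> \<rho> g' g" using l g' out by auto
        then show ?thesis using linked_cong[of ?\<rho> g' \<rho> g] out False g(1) by auto
      qed
      then show ?thesis using g out by (intro exI[of _ g]) auto
    qed
  next
    fix h c assume h: "h \<in> U" and c: "c \<in> A" "c \<noteq> \<bar>h\<bar>"
    have lnd: "lands S \<tau> ?\<rho> h g t \<longleftrightarrow> lands S \<tau> \<rho> h g t" if "\<bar>g\<bar> \<notin> E" for g t
      using out[OF that] by (simp add: lands_def)
    show "?\<rho> h = \<tau> h c \<or> (\<exists>g\<in>{c, - c}. lands S \<tau> ?\<rho> h g (\<tau> h c))"
    proof (cases "c \<in> E")
      case True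
      have "sg c \<notin> U" using E_free[of "sg c"] sg_abs[OF True] True by simp
      then have "lands S \<tau> ?\<rho> h (sg c) (\<tau> h c)"
        using sg_abs[OF True] True \<tau>E[OF h True] by (simp add: lands_def hubs_def)
      then show ?thesis using sg[OF True] by auto
    next
      case False
      moreover have "\<bar>c\<bar> = c" using c by auto
      ultimately show ?thesis using land[OF h _ c(2)] c(1) out[OF avoid[OF h]] lnd[of c] lnd[of "- c"] by auto
    qed
  next
    fix x i assume "x \<in> S" "pr i x \<in> S" "2 \<le> i" "i < n"
    then show "tailed S \<tau> ?\<rho> x (pr i x) \<or> tailed S \<tau> ?\<rho> (pr i x) x"
      using tail[of x "pr i x"] by (auto simp: conf_def)
  next
    fix g assume "g \<in> U" "?\<rho> g \<in> \<Theta>"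
    then show "?\<rho> g = \<theta> \<and> lone g" using pivot[of g] out[OF avoid] by auto
  qed
  show ?thesis by (rule ex_packing)
qed

text \<open>
  The pair \<open>(x, y)\<close> in \<open>Q\<close> stands for the decision that the edge between \<open>x\<close> and \<open>y\<close> goes to the
  tree of the colour of \<open>x\<close>, while the tree of the colour of \<open>y\<close> reaches \<open>x\<close> through the
  slice \<open>- hd x\<close>.
\<close>

lemma packing_by_selection:
  assumes \<Theta>: "E \<subseteq> \<Theta>" "\<Theta> \<subseteq> A" and avoid: "\<And>h. h \<in> U \<Longrightarrow> \<bar>h\<bar> \<notin> E"
    and \<tau>E: "\<And>h e. h \<in> U \<Longrightarrow> e \<in> E \<Longrightarrow> \<tau> h e = e"
    and \<tau>nE: "\<And>h c. h \<in> U \<Longrightarrow> c \<in> A - E \<Longrightarrow> c \<noteq> \<bar>h\<bar> \<Longrightarrow> \<tau> h c \<notin> E"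
    and surj: "\<And>h t. h \<in> U \<Longrightarrow> t \<in> \<Theta> - E \<Longrightarrow> \<exists>c\<in>A. c \<noteq> \<bar>h\<bar> \<and> \<tau> h c = t"
    and \<rho>: "\<And>g. \<rho> g \<notin> E"
    and root: "\<And>t. t \<in> \<Theta> - E \<Longrightarrow> \<exists>g. \<bar>g\<bar> \<in> A - E \<and> \<rho> g = t \<and>
      (\<forall>g'. \<bar>g'\<bar> \<in> A - E \<and> \<rho> g' = t \<and> g' \<noteq> g \<longrightarrow> linked n S \<tau> \<rho> g' g)"
    and land: "\<And>h c. h \<in> U \<Longrightarrow> c \<in> A - E \<Longrightarrow> c \<noteq> \<bar>h\<bar> \<Longrightarrow>
      \<rho> h = \<tau> h c \<or> (\<exists>g\<in>{c, - c}. lands S \<tau> \<rho> h g (\<tau> h c))"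
    and pivot: "\<And>g. g \<in> U \<Longrightarrow> \<rho> g \<in> \<Theta> \<Longrightarrow> \<rho> g = \<theta> \<and> lone g"
    and Q: "\<And>x y. (x, y) \<in> Q \<Longrightarrow> conf x y \<and> \<bar>hd x\<bar> \<in> E"
    and Q_compat: "\<And>x y x' y'. (x, y) \<in> Q \<Longrightarrow> (x', y') \<in> Q \<Longrightarrow> \<bar>hd x\<bar> = \<bar>hd x'\<bar> \<Longrightarrow>
      hd x = hd x' \<and> \<tau> (last x) \<bar>hd y\<bar> = \<tau> (last x') \<bar>hd y'\<bar>"
    and cover: "\<And>x y. conf x y \<Longrightarrow> (x, y) \<in> Q \<or> (y, x) \<in> Q \<or>
      (\<bar>hd x\<bar> \<notin> E \<and> tailed S \<tau> \<rho> x y) \<or> (\<bar>hd y\<bar> \<notin> E \<and> tailed S \<tau> \<rho> y x)"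
  shows "\<exists>T. packing (burnt_pancake n) S \<Theta> T"
proof -
  define P where "P e p \<longleftrightarrow> p \<in> Q \<and> \<bar>hd (fst p)\<bar> = e" for e and p :: "int list \<times> int list"
  \<comment> \<open>\<open>Q_compat\<close> makes the choice of the pair immaterial. If there is
    none, the slice e is the hub and the opposite one gets the value 0, which is no tree because
    \<Theta> is contained in A.\<close>
  define sg where "sg e = (if \<exists>p. P e p then hd (fst (SOME p. P e p)) else e)" for e
  define tg where "tg e = (if \<exists>p. P e p then
    \<tau> (last (fst (SOME p. P e p))) \<bar>hd (snd (SOME p. P e p))\<bar> else 0)" for e
  have some: "sg \<bar>hd x\<bar> = hd x \<and> tg \<bar>hd x\<bar> = \<tau> (last x) \<bar>hd y\<bar>" if xy: "(x, y) \<in> Q" for x y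
  proof -
    have ex: "\<exists>p. P \<bar>hd x\<bar> p" using xy by (auto simp: P_def)
    then have "P \<bar>hd x\<bar> (SOME p. P \<bar>hd x\<bar> p)" by (rule someI_ex)
    then have "(fst (SOME p. P \<bar>hd x\<bar> p), snd (SOME p. P \<bar>hd x\<bar> p)) \<in> Q"
      "\<bar>hd (fst (SOME p. P \<bar>hd x\<bar> p))\<bar> = \<bar>hd x\<bar>"
      by (simp_all add: P_def)
    from Q_compat[OF this(1) xy this(2)] show ?thesis using ex by (simp add: sg_def tg_def)
  qed
  show ?thesis
  proof (rule packing_by_hubs[where E = E and sg = sg and tg = tg and \<rho> = \<rho> and \<tau> = \<tau> and \<theta> = \<theta>])
    fix e assume e: "e \<in> E"
    have E0: "e \<noteq> 0" using e \<Theta> by auto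
    show "sg e = e \<or> sg e = - e"
    proof (cases "\<exists>p. P e p")
      case True
      then obtain x y where "(x, y) \<in> Q" "\<bar>hd x\<bar> = e" by (auto simp: P_def)
      then show ?thesis using some[of x y] by auto
    qed (simp add: sg_def)
    show "tg e \<noteq> e"
    proof (cases "\<exists>p. P e p")
      case True
      then obtain x y where xy: "(x, y) \<in> Q" "\<bar>hd x\<bar> = e" by (auto simp: P_def)
      then have c: "conf x y" using Q by blast
      then have xU: "last x \<in> U" and yA: "\<bar>hd y\<bar> \<in> A" and "\<bar>hd y\<bar> \<noteq> \<bar>last x\<bar>"
        using confD[OF c] ends[OF SD, of y] conf_last[OF c] by auto
      then have "\<tau> (last x) \<bar>hd y\<bar> \<noteq> e"
        using conf_hd_neq[OF c] \<tau>E[OF xU, of "\<bar>hd y\<bar>"] \<tau>nE[OF xU, of "\<bar>hd y\<bar>"] xy e by (cases "\<bar>hd y\<bar> \<in> E") auto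
      then show ?thesis using some[OF xy(1)] xy(2) by simp
    next
      case False
      then have "tg e = 0" unfolding tg_def by (rule if_not_P)
      then show ?thesis using E0 by simp
    qed
  next
    fix x y assume c: "conf x y"
    have direct: "tailed S \<tau> (hubs E sg tg \<rho>) u v" if uv: "(u, v) \<in> Q" for u v
    proof -
      have uE: "\<bar>hd u\<bar> \<in> E" using Q uv by blast
      moreover then have "hd u \<noteq> 0" using \<Theta> by auto
      moreover have "- hd u \<notin> U" using avoid[of "- hd u"] uE by auto
      ultimately show ?thesis
        using some[OF uv] by (simp add: tailed_def lands_def hubs_def)
    qed
    have other: "tailed S \<tau> (hubs E sg tg \<rho>) u v" if "\<bar>hd u\<bar> \<notin> E" "tailed S \<tau> \<rho> u v" for u v
      using that by (simp add: tailed_def lands_def hubs_def)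
    show "tailed S \<tau> (hubs E sg tg \<rho>) x y \<or> tailed S \<tau> (hubs E sg tg \<rho>) y x"
      using cover[OF c] direct other by blast
  qed (rule assms; assumption)+
qed

section \<open>Distribution of the terminals over the slices\<close>

definition packable :: bool where
  "packable \<longleftrightarrow> (\<exists>a\<in>A. \<exists>T. packing (burnt_pancake n) S (A - {a}) T)"

lemma U_abs: "h \<in> U \<Longrightarrow> \<bar>h\<bar> \<in> A"
  using ends SD by auto

lemma conf_colour:
  assumes "conf x y"
  shows "\<bar>hd x\<bar> \<in> A" "\<bar>hd y\<bar> \<in> A" "\<bar>hd x\<bar> \<noteq> \<bar>last x\<bar>" "\<bar>hd y\<bar> \<noteq> \<bar>last x\<bar>" "last x \<in> U"
  using ends[OF SD, of x] ends[OF SD, of y] confD[OF assms] conf_last[OF assms] by auto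

lemma conf_not_lone:
  assumes c: "conf x y"
  shows "\<not> lone (last x)"
proof
  assume "lone (last x)"
  then obtain w where w: "{z \<in> S. last z = last x} = {w}" by (auto simp: lone_def)
  have "x \<in> {z \<in> S. last z = last x}" "y \<in> {z \<in> S. last z = last x}"
    using confD[OF c] conf_last[OF c] by auto
  then have "x = y" unfolding w by simp
  then show False using conf_hd_neq[OF c] by simp
qed

lemma inj_on_selection:
  assumes "inj_on (\<lambda>(x, y). \<bar>hd x\<bar>) Q" "(x, y) \<in> Q" "(x', y') \<in> Q" "\<bar>hd x\<bar> = \<bar>hd x'\<bar>"
  shows "x = x' \<and> y = y'"
  using inj_onD[OF assms(1) _ assms(2,3)] assms(4) by auto

text \<open>With a single occupied colour all others are uniform and only the conflicts matter.
  \<open>selection_four\<close> charges each of them to a colour of its own, so the reserve slice of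
  a colour is lent at most once.\<close>

lemma packable_antipodal:
  assumes a: "\<bar>a\<bar> \<in> A" and U: "U \<subseteq> {a, - a}" and S4: "card S \<le> 4"
  shows packable
proof -
  have Ua: "h \<in> U \<Longrightarrow> \<bar>h\<bar> = \<bar>a\<bar>" for h using U by auto
  obtain Q where Q: "\<forall>(x, y)\<in>Q. conf x y" "\<forall>x y. conf x y \<longrightarrow> (x, y) \<in> Q \<or> (y, x) \<in> Q"
    "inj_on (\<lambda>(x, y). \<bar>hd x\<bar>) Q"
    using selection_four[of S conf "\<lambda>x. \<bar>hd x\<bar>", OF finite_S S4] confD conf_sym conf_hd_neq conf_hd_inj conf_triangle
    by blast
  have "\<exists>T. packing (burnt_pancake n) S (A - {\<bar>a\<bar>}) T"
  proof (rule packing_by_selection[where E = "A - {\<bar>a\<bar>}" and \<tau> = "\<lambda>h c. c" and \<rho> = "\<lambda>g. 0" and Q = Q])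
    fix x y assume "(x, y) \<in> Q"
    then have "conf x y" using Q(1) by auto
    then show "conf x y \<and> \<bar>hd x\<bar> \<in> A - {\<bar>a\<bar>}"
      using conf_colour[of x y] Ua[of "last x"] by auto
  next
    fix x y x' y' assume "(x, y) \<in> Q" "(x', y') \<in> Q" "\<bar>hd x\<bar> = \<bar>hd x'\<bar>"
    then show "hd x = hd x' \<and> \<bar>hd y\<bar> = \<bar>hd y'\<bar>" using inj_on_selection[OF Q(3)] by blast
  qed (use Q Ua in auto)
  then show ?thesis using a unfolding packable_def by blast
qed

section \<open>Terminals in slices of two colours\<close>

definition swap_to :: "int \<Rightarrow> int \<Rightarrow> int \<Rightarrow> int \<Rightarrow> int" where
  "swap_to a b h c = (if c = \<bar>a\<bar> then \<bar>b\<bar> else c)"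

text \<open>The colour of a is dropped as a tree. At slices of the colour of b it stands in for that
  colour, which is missing there. So the tree of b is the only one outside the uniform treatment,
  and \<rho> supplies its hubs.\<close>

lemma packable_two_colours:
  assumes ab: "\<bar>a\<bar> \<in> A" "\<bar>b\<bar> \<in> A" "\<bar>a\<bar> \<noteq> \<bar>b\<bar>" and U: "U \<subseteq> {a, - a, b, - b}"
    and \<rho>: "\<And>g. \<rho> g = 0 \<or> \<rho> g = \<bar>b\<bar>"
    and root: "\<exists>g. \<bar>g\<bar> \<in> {\<bar>a\<bar>, \<bar>b\<bar>} \<and> \<rho> g = \<bar>b\<bar> \<and>
      (\<forall>g'. \<bar>g'\<bar> \<in> {\<bar>a\<bar>, \<bar>b\<bar>} \<and> \<rho> g' = \<bar>b\<bar> \<and> g' \<noteq> g \<longrightarrow> linked n S (swap_to a b) \<rho> g' g)"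
    and land_a: "\<And>h. h \<in> U \<Longrightarrow> \<bar>h\<bar> = \<bar>a\<bar> \<Longrightarrow> \<exists>g\<in>{b, - b}. lands S (swap_to a b) \<rho> h g \<bar>b\<bar>"
    and land_b: "\<And>h. h \<in> U \<Longrightarrow> \<bar>h\<bar> = \<bar>b\<bar> \<Longrightarrow> \<rho> h = \<bar>b\<bar> \<or> (\<exists>g\<in>{a, - a}. lands S (swap_to a b) \<rho> h g \<bar>b\<bar>)"
    and pivot: "\<And>g. g \<in> U \<Longrightarrow> \<rho> g = \<bar>b\<bar> \<Longrightarrow> lone g"
    and Q: "\<And>x y. (x, y) \<in> Q \<Longrightarrow> conf x y \<and> \<bar>hd x\<bar> \<notin> {\<bar>a\<bar>, \<bar>b\<bar>}"
    and Q_compat: "\<And>x y x' y'. (x, y) \<in> Q \<Longrightarrow> (x', y') \<in> Q \<Longrightarrow> \<bar>hd x\<bar> = \<bar>hd x'\<bar> \<Longrightarrow>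
      hd x = hd x' \<and> (\<bar>hd y\<bar> = \<bar>hd y'\<bar> \<or> {\<bar>hd y\<bar>, \<bar>hd y'\<bar>} \<subseteq> {\<bar>a\<bar>, \<bar>b\<bar>})"
    and cover: "\<And>x y. conf x y \<Longrightarrow> (x, y) \<in> Q \<or> (y, x) \<in> Q"
  shows packable
proof -
  let ?E = "A - {\<bar>a\<bar>, \<bar>b\<bar>}" and ?\<tau> = "swap_to a b"
  have Uab: "h \<in> U \<Longrightarrow> \<bar>h\<bar> = \<bar>a\<bar> \<or> \<bar>h\<bar> = \<bar>b\<bar>" for h using U by auto
  have AE: "c \<in> A - ?E \<longleftrightarrow> c = \<bar>a\<bar> \<or> c = \<bar>b\<bar>" for c using ab by auto
  have pm: "{\<bar>c\<bar>, - \<bar>c\<bar>} = {c, - c}" for c :: int by (auto simp: abs_if)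
  have "\<exists>T. packing (burnt_pancake n) S (A - {\<bar>a\<bar>}) T"
  proof (rule packing_by_selection[where E = ?E and \<tau> = ?\<tau> and \<rho> = \<rho> and Q = Q and \<theta> = "\<bar>b\<bar>"])
    fix h t assume h: "h \<in> U" and "t \<in> A - {\<bar>a\<bar>} - ?E"
    then have t: "t = \<bar>b\<bar>" by auto
    show "\<exists>c\<in>A. c \<noteq> \<bar>h\<bar> \<and> ?\<tau> h c = t"
    proof (cases "\<bar>h\<bar> = \<bar>b\<bar>")
      case True
      then show ?thesis using ab t by (intro bexI[of _ "\<bar>a\<bar>"]) (auto simp: swap_to_def)
    next
      case False
      then show ?thesis using ab t by (intro bexI[of _ "\<bar>b\<bar>"]) (auto simp: swap_to_def)
    qed
  next
    fix t assume "t \<in> A - {\<bar>a\<bar>} - ?E"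
    then have t: "t = \<bar>b\<bar>" by auto
    show "\<exists>g. \<bar>g\<bar> \<in> A - ?E \<and> \<rho> g = t \<and>
        (\<forall>g'. \<bar>g'\<bar> \<in> A - ?E \<and> \<rho> g' = t \<and> g' \<noteq> g \<longrightarrow> linked n S ?\<tau> \<rho> g' g)"
      using root unfolding AE t by simp
  next
    fix h c assume h: "h \<in> U" and c: "c \<in> A - ?E" "c \<noteq> \<bar>h\<bar>"
    then have t: "?\<tau> h c = \<bar>b\<bar>" unfolding AE by (auto simp: swap_to_def)
    consider "\<bar>h\<bar> = \<bar>a\<bar>" "c = \<bar>b\<bar>" | "\<bar>h\<bar> = \<bar>b\<bar>" "c = \<bar>a\<bar>"
      using c Uab[OF h] unfolding AE by auto
    then show "\<rho> h = ?\<tau> h c \<or> (\<exists>g\<in>{c, - c}. lands S ?\<tau> \<rho> h g (?\<tau> h c))"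
    proof cases
      case 1
      show ?thesis using land_a[OF h 1(1)] unfolding t unfolding 1(2) pm by blast
    next
      case 2
      show ?thesis using land_b[OF h 2(1)] unfolding t unfolding 2(2) pm by blast
    qed
  next
    fix x y assume "(x, y) \<in> Q"
    then show "conf x y \<and> \<bar>hd x\<bar> \<in> ?E" using Q conf_colour(1)[of x y] by blast
  next
    fix x y x' y' assume "(x, y) \<in> Q" "(x', y') \<in> Q" "\<bar>hd x\<bar> = \<bar>hd x'\<bar>"
    from Q_compat[OF this] show "hd x = hd x' \<and> ?\<tau> (last x) \<bar>hd y\<bar> = ?\<tau> (last x') \<bar>hd y'\<bar>"
      by (auto simp: swap_to_def)
  next
    fix g assume "g \<in> U" "\<rho> g \<in> A - {\<bar>a\<bar>}"
    then show "\<rho> g = \<bar>b\<bar> \<and> lone g" using pivot \<rho>[of g] by auto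
  next
    fix g show "\<rho> g \<notin> ?E" using \<rho>[of g] by auto
  next
    fix h c assume "h \<in> U" "c \<in> A - ?E" "c \<noteq> \<bar>h\<bar>"
    then show "?\<tau> h c \<notin> ?E" unfolding AE by (auto simp: swap_to_def)
  next
    fix h e assume "e \<in> ?E"
    then show "?\<tau> h e = e" by (auto simp: swap_to_def)
  next
    fix x y assume "conf x y"
    then show "(x, y) \<in> Q \<or> (y, x) \<in> Q \<or> (\<bar>hd x\<bar> \<notin> ?E \<and> tailed S ?\<tau> \<rho> x y) \<or>
      (\<bar>hd y\<bar> \<notin> ?E \<and> tailed S ?\<tau> \<rho> y x)" using cover by blast
  qed (use Uab in auto)
  then show ?thesis using ab unfolding packable_def by blast
qed

text \<open>The slices -a and -b have no terminals: the tree of b is reached from a through -b and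
  from b through -a. Two selected ends may share a colour if they want the same slice for the same
  tree; the colours of a and b have the same label.\<close>

lemma packable_pairs_aligned:
  assumes ab: "\<bar>a\<bar> \<noteq> \<bar>b\<bar>" and U: "U = {a, b}"
    and Q: "\<And>x y. (x, y) \<in> Q \<Longrightarrow> conf x y \<and> \<bar>hd x\<bar> \<notin> {\<bar>a\<bar>, \<bar>b\<bar>}"
    and Q_compat: "\<And>x y x' y'. (x, y) \<in> Q \<Longrightarrow> (x', y') \<in> Q \<Longrightarrow> \<bar>hd x\<bar> = \<bar>hd x'\<bar> \<Longrightarrow>
      hd x = hd x' \<and> (\<bar>hd y\<bar> = \<bar>hd y'\<bar> \<or> {\<bar>hd y\<bar>, \<bar>hd y'\<bar>} \<subseteq> {\<bar>a\<bar>, \<bar>b\<bar>})"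
    and cover: "\<And>x y. conf x y \<Longrightarrow> (x, y) \<in> Q \<or> (y, x) \<in> Q"
  shows packable
proof -
  have A: "\<bar>a\<bar> \<in> A" "\<bar>b\<bar> \<in> A" using U_abs U by auto
  then have nU: "- a \<notin> U" "- b \<notin> U" using U ab by auto
  let ?\<rho> = "\<lambda>g. if g = - a \<or> g = - b then \<bar>b\<bar> else 0"
  have l: "linked n S (swap_to a b) ?\<rho> (- b) (- a)"
    using linked_free[of "- b" "- a"] A ab nU by simp
  show ?thesis
  proof (rule packable_two_colours[where a = a and b = b and \<rho> = ?\<rho> and Q = Q])
    show "\<exists>g. \<bar>g\<bar> \<in> {\<bar>a\<bar>, \<bar>b\<bar>} \<and> ?\<rho> g = \<bar>b\<bar> \<and>
      (\<forall>g'. \<bar>g'\<bar> \<in> {\<bar>a\<bar>, \<bar>b\<bar>} \<and> ?\<rho> g' = \<bar>b\<bar> \<and> g' \<noteq> g \<longrightarrow> linked n S (swap_to a b) ?\<rho> g' g)"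
      using l A by (intro exI[of _ "- a"]) auto
    show "\<exists>g\<in>{b, - b}. lands S (swap_to a b) ?\<rho> h g \<bar>b\<bar>" for h
      using nU by (intro bexI[of _ "- b"]) (auto simp: lands_def)
    show "?\<rho> h = \<bar>b\<bar> \<or> (\<exists>g\<in>{a, - a}. lands S (swap_to a b) ?\<rho> h g \<bar>b\<bar>)" for h
      using nU by (intro disjI2 bexI[of _ "- a"]) (auto simp: lands_def)
    show "lone g" if "g \<in> U" "?\<rho> g = \<bar>b\<bar>" for g
    proof -
      have "g \<noteq> - a" "g \<noteq> - b" using that(1) nU by blast+
      then show ?thesis using that(2) A by simp
    qed
    show "hd x = hd x' \<and> (\<bar>hd y\<bar> = \<bar>hd y'\<bar> \<or> {\<bar>hd y\<bar>, \<bar>hd y'\<bar>} \<subseteq> {\<bar>a\<bar>, \<bar>b\<bar>})"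
      if "(x, y) \<in> Q" "(x', y') \<in> Q" "\<bar>hd x\<bar> = \<bar>hd x'\<bar>" for x y x' y'
      by (rule Q_compat[OF that])
  qed (use ab A U Q cover in auto)
qed

text \<open>
  Both slices contain a pair that must detach an end of colour \<open>\<bar>v\<bar>\<close>, and these ends leave for
  opposite slices; the trees of \<open>\<bar>v\<bar>\<close> and \<open>\<bar>b\<bar>\<close> are then built on both slices \<open>v\<close> and \<open>- v\<close>.
\<close>

lemma packable_pairs_opposed:
  assumes ab: "\<bar>a\<bar> \<noteq> \<bar>b\<bar>" and U: "U = {a, b}" and v: "\<bar>v\<bar> \<in> A" "\<bar>v\<bar> \<noteq> \<bar>a\<bar>" "\<bar>v\<bar> \<noteq> \<bar>b\<bar>"
    and conf: "\<And>x y. conf x y \<Longrightarrow> last x = a \<Longrightarrow> (hd x = v \<and> \<bar>hd y\<bar> = \<bar>b\<bar>) \<or> (hd y = v \<and> \<bar>hd x\<bar> = \<bar>b\<bar>)"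
      "\<And>x y. conf x y \<Longrightarrow> last x = b \<Longrightarrow> (hd x = - v \<and> \<bar>hd y\<bar> = \<bar>a\<bar>) \<or> (hd y = - v \<and> \<bar>hd x\<bar> = \<bar>a\<bar>)"
  shows packable
proof -
  have A: "\<bar>a\<bar> \<in> A" "\<bar>b\<bar> \<in> A" using U_abs U by auto
  define e where "e = \<bar>v\<bar>"
  have e: "e \<in> A" "e \<noteq> \<bar>a\<bar>" "e \<noteq> \<bar>b\<bar>" "0 < e" using v by (auto simp: e_def)
  have nU: "- a \<notin> U" "- b \<notin> U" "v \<notin> U" "- v \<notin> U" using U ab v A by auto
  have v0: "v \<noteq> - v" using v by auto
  let ?E = "A - {\<bar>a\<bar>, \<bar>b\<bar>, e}"
  \<comment> \<open>At b the end with first entry -v leaves for the slice v, a hub of the tree e. So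
    the colour of a, which is the colour of the other end, gets the label e there, and the colour e
    gets the label freed by this.\<close>
  define \<tau> where "\<tau> h c = (if h = b then (if c = e then \<bar>b\<bar> else if c = \<bar>a\<bar> then e else c) else c)" for h c
  \<comment> \<open>Either tree has two hubs of different colours, all without terminals: from a
    they are left for -b and v, from b for -v and -a.\<close>
  define \<rho> where "\<rho> g = (if g = v \<or> g = - a then e else if g = - v \<or> g = - b then \<bar>b\<bar> else 0)" for g
  have \<tau>: "\<tau> a c = c" "\<tau> b e = \<bar>b\<bar>" "\<tau> b \<bar>a\<bar> = e" for c
    using ab e by (auto simp: \<tau>_def)
  have \<rho>_e: "\<rho> g = e \<longleftrightarrow> g = v \<or> g = - a" for g using e A by (auto simp: \<rho>_def)
  have \<rho>_b: "\<rho> g = \<bar>b\<bar> \<longleftrightarrow> g = - v \<or> g = - b" for g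
    using e A ab v v0 by (auto simp: \<rho>_def)
  have AE: "c \<in> A - ?E \<longleftrightarrow> c = \<bar>a\<bar> \<or> c = \<bar>b\<bar> \<or> c = e" for c using A e by auto
  have pm: "{\<bar>c\<bar>, - \<bar>c\<bar>} = {c, - c}" for c :: int by (auto simp: abs_if)
  have l: "linked n S \<tau> \<rho> (- a) v" "linked n S \<tau> \<rho> (- b) (- v)"
    using linked_free[of "- a" v] linked_free[of "- b" "- v"] A v nU by auto
  have lnd: "lands S \<tau> \<rho> h g t" if "g \<notin> U" "\<rho> g = t" for h g t using that by (simp add: lands_def)
  have "\<exists>T. packing (burnt_pancake n) S (A - {\<bar>a\<bar>}) T"
  proof (rule packing_by_selection[where E = ?E and \<tau> = \<tau> and \<rho> = \<rho> and Q = "{}" and \<theta> = 0])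
    fix h t assume h: "h \<in> U" and "t \<in> A - {\<bar>a\<bar>} - ?E"
    then have t: "t = \<bar>b\<bar> \<or> t = e" by auto
    have "h = a \<or> h = b" using h U by auto
    then show "\<exists>c\<in>A. c \<noteq> \<bar>h\<bar> \<and> \<tau> h c = t"
    proof
      assume "h = a"
      then show ?thesis using t A e ab by (intro bexI[of _ t]) (auto simp: \<tau>_def)
    next
      assume hb: "h = b"
      show ?thesis
      proof (cases "t = e")
        case True
        then show ?thesis using A e ab hb by (intro bexI[of _ "\<bar>a\<bar>"]) (auto simp: \<tau>_def)
      next
        case False
        then show ?thesis using A e ab hb t by (intro bexI[of _ e]) (auto simp: \<tau>_def)
      qed
    qed
  next
    fix t assume "t \<in> A - {\<bar>a\<bar>} - ?E"
    then consider "t = \<bar>b\<bar>" | "t = e" by auto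
    then show "\<exists>g. \<bar>g\<bar> \<in> A - ?E \<and> \<rho> g = t \<and>
        (\<forall>g'. \<bar>g'\<bar> \<in> A - ?E \<and> \<rho> g' = t \<and> g' \<noteq> g \<longrightarrow> linked n S \<tau> \<rho> g' g)"
    proof cases
      case 1
      have "\<bar>- v\<bar> \<in> A - ?E" unfolding AE by (simp add: e_def)
      then show ?thesis using l \<rho>_b unfolding 1 by (intro exI[of _ "- v"]) auto
    next
      case 2
      have "\<bar>v\<bar> \<in> A - ?E" unfolding AE by (simp add: e_def)
      then show ?thesis using l \<rho>_e unfolding 2 by (intro exI[of _ v]) auto
    qed
  next
    fix h c assume h: "h \<in> U" and c: "c \<in> A - ?E" "c \<noteq> \<bar>h\<bar>"
    have ex: "\<exists>g\<in>{c, - c}. lands S \<tau> \<rho> h g (\<tau> h c)" if "\<bar>g\<bar> = c" "g \<notin> U" "\<rho> g = \<tau> h c" for g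
      using lnd[OF that(2,3)] that(1) pm[of g] by auto
    have "h = a \<or> h = b" using h U by auto
    then consider "h = a" "c = \<bar>b\<bar>" | "h = a" "c = e" | "h = b" "c = e" | "h = b" "c = \<bar>a\<bar>"
      using c unfolding AE by auto
    then have "\<exists>g\<in>{c, - c}. lands S \<tau> \<rho> h g (\<tau> h c)"
    proof cases
      case 1
      then show ?thesis using ex[of "- b"] nU \<rho>_b \<tau> by simp
    next
      case 2
      then show ?thesis using ex[of v] nU \<rho>_e \<tau> e_def by simp
    next
      case 3
      then show ?thesis using ex[of "- v"] nU \<rho>_b \<tau> e_def by simp
    next
      case 4
      then show ?thesis using ex[of "- a"] nU \<rho>_e \<tau> by simp
    qed
    then show "\<rho> h = \<tau> h c \<or> (\<exists>g\<in>{c, - c}. lands S \<tau> \<rho> h g (\<tau> h c))" by blast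
  next
    fix g assume "g \<in> U" "\<rho> g \<in> A - {\<bar>a\<bar>}"
    moreover have "g \<noteq> v" "g \<noteq> - v" "g \<noteq> - a" "g \<noteq> - b" using \<open>g \<in> U\<close> nU by blast+
    ultimately show "\<rho> g = 0 \<and> lone g" by (simp add: \<rho>_def)
  next
    fix g show "\<rho> g \<notin> ?E" by (auto simp: \<rho>_def)
  next
    fix h c assume "h \<in> U" "c \<in> A - ?E" "c \<noteq> \<bar>h\<bar>"
    then show "\<tau> h c \<notin> ?E" unfolding AE by (auto simp: \<tau>_def)
  next
    fix h e' assume "e' \<in> ?E"
    then show "\<tau> h e' = e'" by (auto simp: \<tau>_def)
  next
    fix h assume "h \<in> U"
    then show "\<bar>h\<bar> \<notin> ?E" using U by auto
  next
    fix x y assume xy: "conf x y"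
    have *: "\<bar>hd p\<bar> \<notin> ?E \<and> tailed S \<tau> \<rho> p q"
      if "(last p = a \<and> hd p = v \<and> \<bar>hd q\<bar> = \<bar>b\<bar>) \<or> (last p = b \<and> hd p = - v \<and> \<bar>hd q\<bar> = \<bar>a\<bar>)" for p q
      using that
    proof
      assume p: "last p = a \<and> hd p = v \<and> \<bar>hd q\<bar> = \<bar>b\<bar>"
      then show ?thesis using lnd[of "- v"] nU \<rho>_b \<tau> e_def by (simp add: tailed_def)
    next
      assume p: "last p = b \<and> hd p = - v \<and> \<bar>hd q\<bar> = \<bar>a\<bar>"
      then show ?thesis using lnd[of v] nU \<rho>_e \<tau> e_def by (simp add: tailed_def)
    qed
    have "last x = a \<or> last x = b" using conf_colour(5)[OF xy] U by auto
    then show "(x, y) \<in> {} \<or> (y, x) \<in> {} \<or> (\<bar>hd x\<bar> \<notin> ?E \<and> tailed S \<tau> \<rho> x y) \<or>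
      (\<bar>hd y\<bar> \<notin> ?E \<and> tailed S \<tau> \<rho> y x)"
      using conf(1)[OF xy] conf(2)[OF xy] *[of x y] *[of y x] conf_last[OF xy] by auto
  qed auto
  then show ?thesis using A unfolding packable_def by blast
qed

text \<open>The slice b itself can be the hub of its tree because it holds a single terminal.
  Selected ends avoid its colour, since only uniform colours lend a slice.\<close>

lemma packable_with_lone:
  assumes ab: "\<bar>a\<bar> \<in> A" "\<bar>a\<bar> \<noteq> \<bar>b\<bar>" and U: "U \<subseteq> {a, - a, b}" and b: "b \<in> U" "lone b"
    and Q: "\<And>x y. (x, y) \<in> Q \<Longrightarrow> conf x y \<and> \<bar>hd x\<bar> \<noteq> \<bar>b\<bar>"
    and inj: "inj_on (\<lambda>(x, y). \<bar>hd x\<bar>) Q"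
    and cover: "\<And>x y. conf x y \<Longrightarrow> (x, y) \<in> Q \<or> (y, x) \<in> Q"
  shows packable
proof -
  have A: "\<bar>b\<bar> \<in> A" using U_abs b by auto
  let ?\<rho> = "\<lambda>g. if g = b then \<bar>b\<bar> else 0"
  show ?thesis
  proof (rule packable_two_colours[where a = a and b = b and \<rho> = ?\<rho> and Q = Q])
    show "\<exists>g. \<bar>g\<bar> \<in> {\<bar>a\<bar>, \<bar>b\<bar>} \<and> ?\<rho> g = \<bar>b\<bar> \<and>
      (\<forall>g'. \<bar>g'\<bar> \<in> {\<bar>a\<bar>, \<bar>b\<bar>} \<and> ?\<rho> g' = \<bar>b\<bar> \<and> g' \<noteq> g \<longrightarrow> linked n S (swap_to a b) ?\<rho> g' g)"
      using A by (intro exI[of _ b]) auto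
    show "\<exists>g\<in>{b, - b}. lands S (swap_to a b) ?\<rho> h g \<bar>b\<bar>" if "\<bar>h\<bar> = \<bar>a\<bar>" for h
      using that by (intro bexI[of _ b]) (auto simp: lands_def swap_to_def)
    show "?\<rho> h = \<bar>b\<bar> \<or> (\<exists>g\<in>{a, - a}. lands S (swap_to a b) ?\<rho> h g \<bar>b\<bar>)"
      if "h \<in> U" "\<bar>h\<bar> = \<bar>b\<bar>" for h
      using that U ab by auto
    show "lone g" if "g \<in> U" "?\<rho> g = \<bar>b\<bar>" for g using that A b by (auto split: if_splits)
    show "conf x y \<and> \<bar>hd x\<bar> \<notin> {\<bar>a\<bar>, \<bar>b\<bar>}" if xy: "(x, y) \<in> Q" for x y
    proof -
      have c: "conf x y" using Q xy by blast
      have "last x \<noteq> b" using conf_not_lone[OF c] b by auto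
      then have "\<bar>last x\<bar> = \<bar>a\<bar>" using conf_colour(5)[OF c] U by auto
      then show ?thesis using Q[OF xy] conf_colour(3)[OF c] by auto
    qed
    show "hd x = hd x' \<and> (\<bar>hd y\<bar> = \<bar>hd y'\<bar> \<or> {\<bar>hd y\<bar>, \<bar>hd y'\<bar>} \<subseteq> {\<bar>a\<bar>, \<bar>b\<bar>})"
      if "(x, y) \<in> Q" "(x', y') \<in> Q" "\<bar>hd x\<bar> = \<bar>hd x'\<bar>" for x y x' y'
      using inj_on_selection[OF inj that] by simp
  qed (use ab A U cover in auto)
qed

text \<open>Both b and -b are hubs of one tree. Being opposite they are not adjacent; the slice -a,
  which has no terminal, joins them.\<close>

lemma packable_with_lone_pair:
  assumes ab: "\<bar>a\<bar> \<noteq> \<bar>b\<bar>" and U: "U = {a, b, - b}" and l: "lone b" "lone (- b)"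
    and Q: "\<And>x y. (x, y) \<in> Q \<Longrightarrow> conf x y \<and> \<bar>hd x\<bar> \<noteq> \<bar>b\<bar>"
    and inj: "inj_on (\<lambda>(x, y). \<bar>hd x\<bar>) Q"
    and cover: "\<And>x y. conf x y \<Longrightarrow> (x, y) \<in> Q \<or> (y, x) \<in> Q"
  shows packable
proof -
  have A: "\<bar>a\<bar> \<in> A" "\<bar>b\<bar> \<in> A" using U_abs U by auto
  then have nU: "- a \<notin> U" using U ab by auto
  let ?\<rho> = "\<lambda>g. if g = - a \<or> g = b \<or> g = - b then \<bar>b\<bar> else 0"
  have lk: "linked n S (swap_to a b) ?\<rho> b (- a)" "linked n S (swap_to a b) ?\<rho> (- b) (- a)"
    using linked_free[of b "- a"] linked_free[of "- b" "- a"] A ab nU l by simp_all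
  show ?thesis
  proof (rule packable_two_colours[where a = a and b = b and \<rho> = ?\<rho> and Q = Q])
    show "\<exists>g. \<bar>g\<bar> \<in> {\<bar>a\<bar>, \<bar>b\<bar>} \<and> ?\<rho> g = \<bar>b\<bar> \<and>
      (\<forall>g'. \<bar>g'\<bar> \<in> {\<bar>a\<bar>, \<bar>b\<bar>} \<and> ?\<rho> g' = \<bar>b\<bar> \<and> g' \<noteq> g \<longrightarrow> linked n S (swap_to a b) ?\<rho> g' g)"
      using A lk by (intro exI[of _ "- a"]) auto
    show "\<exists>g\<in>{b, - b}. lands S (swap_to a b) ?\<rho> h g \<bar>b\<bar>" if "\<bar>h\<bar> = \<bar>a\<bar>" for h
      using that by (intro bexI[of _ b]) (auto simp: lands_def swap_to_def)
    show "?\<rho> h = \<bar>b\<bar> \<or> (\<exists>g\<in>{a, - a}. lands S (swap_to a b) ?\<rho> h g \<bar>b\<bar>)"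
      if "h \<in> U" "\<bar>h\<bar> = \<bar>b\<bar>" for h
      using that U ab by auto
    show "lone g" if "g \<in> U" "?\<rho> g = \<bar>b\<bar>" for g
    proof -
      have "g \<noteq> - a" using that(1) nU by blast
      then show ?thesis using that(2) A l by (auto split: if_splits)
    qed
    show "conf x y \<and> \<bar>hd x\<bar> \<notin> {\<bar>a\<bar>, \<bar>b\<bar>}" if xy: "(x, y) \<in> Q" for x y
    proof -
      have c: "conf x y" using Q xy by blast
      have "last x \<noteq> b" "last x \<noteq> - b" using conf_not_lone[OF c] l by auto
      then have "\<bar>last x\<bar> = \<bar>a\<bar>" using conf_colour(5)[OF c] U by auto
      then show ?thesis using Q[OF xy] conf_colour(3)[OF c] by auto
    qed
    show "hd x = hd x' \<and> (\<bar>hd y\<bar> = \<bar>hd y'\<bar> \<or> {\<bar>hd y\<bar>, \<bar>hd y'\<bar>} \<subseteq> {\<bar>a\<bar>, \<bar>b\<bar>})"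
      if "(x, y) \<in> Q" "(x', y') \<in> Q" "\<bar>hd x\<bar> = \<bar>hd x'\<bar>" for x y x' y'
      using inj_on_selection[OF inj that] by simp
  qed (use ab A U cover in auto)
qed

text \<open>No slice of the two colours is left to join b and -b. As n is at least 3 there is a
  third colour e: its slice -e goes to the tree of b, and e alone stays the hub of the tree
  e.\<close>

lemma packable_lone_square:
  assumes ab: "\<bar>a\<bar> \<noteq> \<bar>b\<bar>" and U: "U = {a, - a, b, - b}" and l: "\<And>h. h \<in> U \<Longrightarrow> lone h"
  shows packable
proof -
  have A: "\<bar>a\<bar> \<in> A" "\<bar>b\<bar> \<in> A" using U_abs U by auto
  have "card {\<bar>a\<bar>, \<bar>b\<bar>} < card A" using n by (simp add: card_insert_if)
  then obtain e where e: "e \<in> A" "e \<noteq> \<bar>a\<bar>" "e \<noteq> \<bar>b\<bar>"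
    using card_mono[of "{\<bar>a\<bar>, \<bar>b\<bar>}" A] by fastforce
  then have e0: "0 < e" "\<bar>e\<bar> = e" by auto
  have nU: "e \<notin> U" "- e \<notin> U" using U e e0 by auto
  let ?E = "A - {\<bar>a\<bar>, \<bar>b\<bar>, e}" and ?\<tau> = "swap_to a b"
  define \<rho> where "\<rho> g = (if g = e then e else if g = - e \<or> g = b \<or> g = - b then \<bar>b\<bar> else 0)" for g
  have \<rho>_e: "\<rho> g = e \<longleftrightarrow> g = e" for g using e e0 by (auto simp: \<rho>_def)
  have \<rho>_b: "\<rho> g = \<bar>b\<bar> \<longleftrightarrow> g = - e \<or> g = b \<or> g = - b" for g
    using e e0 A by (auto simp: \<rho>_def)
  have AE: "c \<in> A - ?E \<longleftrightarrow> c = \<bar>a\<bar> \<or> c = \<bar>b\<bar> \<or> c = e" for c using A e by auto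
  have Uab: "\<bar>h\<bar> = \<bar>a\<bar> \<or> (\<bar>h\<bar> = \<bar>b\<bar> \<and> \<rho> h = \<bar>b\<bar>)" if "h \<in> U" for h
    using that U \<rho>_b by auto
  have lk: "linked n S ?\<tau> \<rho> b (- e)" "linked n S ?\<tau> \<rho> (- b) (- e)"
    using linked_free[of b "- e"] linked_free[of "- b" "- e"] A e e0 nU l by auto
  have \<tau>: "?\<tau> h e = e" "?\<tau> h \<bar>b\<bar> = \<bar>b\<bar>" "?\<tau> h \<bar>a\<bar> = \<bar>b\<bar>" for h
    using ab e by (auto simp: swap_to_def)
  have "\<exists>T. packing (burnt_pancake n) S (A - {\<bar>a\<bar>}) T"
  proof (rule packing_by_selection[where E = ?E and \<tau> = ?\<tau> and \<rho> = \<rho> and Q = "{}" and \<theta> = "\<bar>b\<bar>"])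
    fix h t assume h: "h \<in> U" and "t \<in> A - {\<bar>a\<bar>} - ?E"
    then consider "t = e" | "t = \<bar>b\<bar>" "\<bar>h\<bar> = \<bar>a\<bar>" | "t = \<bar>b\<bar>" "\<bar>h\<bar> = \<bar>b\<bar>" using Uab by auto
    then show "\<exists>c\<in>A. c \<noteq> \<bar>h\<bar> \<and> ?\<tau> h c = t"
    proof cases
      case 1
      then show ?thesis using \<tau> e Uab[OF h] by (intro bexI[of _ e]) auto
    next
      case 2
      then show ?thesis using \<tau> A ab by (intro bexI[of _ "\<bar>b\<bar>"]) auto
    next
      case 3
      then show ?thesis using \<tau> A ab by (intro bexI[of _ "\<bar>a\<bar>"]) auto
    qed
  next
    fix t assume "t \<in> A - {\<bar>a\<bar>} - ?E"
    then consider "t = \<bar>b\<bar>" | "t = e" by auto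
    then show "\<exists>g. \<bar>g\<bar> \<in> A - ?E \<and> \<rho> g = t \<and>
        (\<forall>g'. \<bar>g'\<bar> \<in> A - ?E \<and> \<rho> g' = t \<and> g' \<noteq> g \<longrightarrow> linked n S ?\<tau> \<rho> g' g)"
    proof cases
      case 1
      have "\<bar>- e\<bar> \<in> A - ?E" unfolding AE using e0 by simp
      then show ?thesis using lk \<rho>_b unfolding 1 by (intro exI[of _ "- e"]) auto
    next
      case 2
      have "\<bar>e\<bar> \<in> A - ?E" unfolding AE using e0 by simp
      then show ?thesis using \<rho>_e unfolding 2 by (intro exI[of _ e]) auto
    qed
  next
    fix h c assume h: "h \<in> U" and c: "c \<in> A - ?E" "c \<noteq> \<bar>h\<bar>"
    consider "c = e" | "c = \<bar>b\<bar>" "\<bar>h\<bar> = \<bar>a\<bar>" | "c = \<bar>a\<bar>" "\<rho> h = \<bar>b\<bar>"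
      using c Uab[OF h] unfolding AE by auto
    then show "\<rho> h = ?\<tau> h c \<or> (\<exists>g\<in>{c, - c}. lands S ?\<tau> \<rho> h g (?\<tau> h c))"
    proof cases
      case 1
      then show ?thesis using \<tau> \<rho>_e nU by (auto simp: lands_def)
    next
      case 2
      have "lands S ?\<tau> \<rho> h b (?\<tau> h c)" using 2 \<tau> \<rho>_b by (simp add: lands_def)
      moreover have "b \<in> {c, - c}" using 2 by auto
      ultimately show ?thesis by blast
    next
      case 3
      then show ?thesis using \<tau> by simp
    qed
  next
    fix g assume "g \<in> U" "\<rho> g \<in> A - {\<bar>a\<bar>}"
    moreover then have "g \<noteq> e" "g \<noteq> - e" using nU by blast+
    ultimately show "\<rho> g = \<bar>b\<bar> \<and> lone g" using l by (auto simp: \<rho>_def split: if_splits)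
  next
    fix g show "\<rho> g \<notin> ?E" by (auto simp: \<rho>_def)
  next
    fix h c assume "h \<in> U" "c \<in> A - ?E" "c \<noteq> \<bar>h\<bar>"
    then show "?\<tau> h c \<notin> ?E" unfolding AE by (auto simp: swap_to_def)
  next
    fix h e' assume "e' \<in> ?E"
    then show "?\<tau> h e' = e'" by (auto simp: swap_to_def)
  next
    fix h assume "h \<in> U"
    then show "\<bar>h\<bar> \<notin> ?E" using Uab by auto
  next
    fix x y assume c: "conf x y"
    then show "(x, y) \<in> {} \<or> (y, x) \<in> {} \<or> (\<bar>hd x\<bar> \<notin> ?E \<and> tailed S ?\<tau> \<rho> x y) \<or>
      (\<bar>hd y\<bar> \<notin> ?E \<and> tailed S ?\<tau> \<rho> y x)"
      using conf_not_lone[OF c] l[OF conf_colour(5)[OF c]] by blast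
  qed auto
  then show ?thesis using A unfolding packable_def by blast
qed

text \<open>A tree with one hub could not be entered from the slice opposite to it, so each of the
  trees of b, c and d gets hubs of two colours. The four slices without terminals serve two of these
  trees; the third one uses the occupied slices a and b, which are linked because four colours force
  n to be at least 4.\<close>

lemma packable_four_colours:
  assumes U: "U = {a, b, c, d}" and dist: "distinct [\<bar>a\<bar>, \<bar>b\<bar>, \<bar>c\<bar>, \<bar>d\<bar>]"
    and l: "\<And>h. h \<in> U \<Longrightarrow> lone h"
  shows packable
proof -
  have A: "\<bar>a\<bar> \<in> A" "\<bar>b\<bar> \<in> A" "\<bar>c\<bar> \<in> A" "\<bar>d\<bar> \<in> A" using U_abs U by auto
  have "card {\<bar>a\<bar>, \<bar>b\<bar>, \<bar>c\<bar>, \<bar>d\<bar>} \<le> card A" using A by (intro card_mono) auto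
  then have n4: "4 \<le> n" using dist by simp
  have ne: "\<bar>a\<bar> \<noteq> \<bar>b\<bar>" "\<bar>a\<bar> \<noteq> \<bar>c\<bar>" "\<bar>a\<bar> \<noteq> \<bar>d\<bar>" "\<bar>b\<bar> \<noteq> \<bar>c\<bar>" "\<bar>b\<bar> \<noteq> \<bar>d\<bar>" "\<bar>c\<bar> \<noteq> \<bar>d\<bar>"
    using dist by auto
  note nev = ne[THEN abs_neqD(1)] ne[THEN abs_neqD(2)] ne[THEN abs_neqD(3)]
  have n0: "a \<noteq> - a" "b \<noteq> - b" "c \<noteq> - c" "d \<noteq> - d" "a \<noteq> 0" "b \<noteq> 0" "c \<noteq> 0" "d \<noteq> 0" using A by auto
  have nU: "- a \<notin> U" "- b \<notin> U" "- c \<notin> U" "- d \<notin> U" unfolding U by (simp_all add: nev[symmetric] n0 nev)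
  have abs_pm: "\<bar>g\<bar> = k \<Longrightarrow> g \<in> {k, - k}" for g k :: int by auto
  note neqs = ne ne[symmetric] nev nev[symmetric] n0 n0(1-4)[symmetric]
  note [[linarith_split_limit = 0, linarith_neq_limit = 0]]
  let ?E = "A - {\<bar>a\<bar>, \<bar>b\<bar>, \<bar>c\<bar>, \<bar>d\<bar>}"
  \<comment> \<open>Every colour has to face a hub of the tree it is labelled with. Arriving in an
    occupied hub requires the same label there: the colour of b at c and the colour of c at b both
    stand for the tree of d, and so do the colour of a at d and the colour of d at a.\<close>
  define \<tau> where "\<tau> h k =
    (if h = b then (if k = \<bar>a\<bar> then \<bar>b\<bar> else if k = \<bar>d\<bar> then \<bar>c\<bar> else if k = \<bar>c\<bar> then \<bar>d\<bar> else k)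
     else if h = c then (if k = \<bar>a\<bar> then \<bar>b\<bar> else if k = \<bar>d\<bar> then \<bar>c\<bar> else if k = \<bar>b\<bar> then \<bar>d\<bar> else k)
     else if h = d then (if k = \<bar>a\<bar> then \<bar>d\<bar> else k) else k)" for h k
  define \<rho> where "\<rho> g = (if g = - a \<or> g = - b then \<bar>b\<bar> else if g = - c \<or> g = - d then \<bar>c\<bar>
    else if g = a \<or> g = b then \<bar>d\<bar> else 0)" for g
  have \<tau>a: "\<tau> a k = k" for k by (simp add: \<tau>_def neqs)
  have \<tau>b: "\<tau> b \<bar>a\<bar> = \<bar>b\<bar>" "\<tau> b \<bar>d\<bar> = \<bar>c\<bar>" "\<tau> b \<bar>c\<bar> = \<bar>d\<bar>"
    by (simp_all add: \<tau>_def neqs)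
  have \<tau>c: "\<tau> c \<bar>a\<bar> = \<bar>b\<bar>" "\<tau> c \<bar>d\<bar> = \<bar>c\<bar>" "\<tau> c \<bar>b\<bar> = \<bar>d\<bar>"
    by (simp_all add: \<tau>_def neqs)
  have \<tau>d: "\<tau> d \<bar>b\<bar> = \<bar>b\<bar>" "\<tau> d \<bar>c\<bar> = \<bar>c\<bar>" "\<tau> d \<bar>a\<bar> = \<bar>d\<bar>"
    by (simp_all add: \<tau>_def neqs)
  have \<rho>v: "\<rho> (- a) = \<bar>b\<bar>" "\<rho> (- b) = \<bar>b\<bar>" "\<rho> (- c) = \<bar>c\<bar>" "\<rho> (- d) = \<bar>c\<bar>" "\<rho> a = \<bar>d\<bar>" "\<rho> b = \<bar>d\<bar>"
    "\<rho> c = 0" "\<rho> d = 0"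
    by (simp_all add: \<rho>_def neqs)
  have \<rho>_eq: "\<rho> g = \<bar>b\<bar> \<longleftrightarrow> g = - a \<or> g = - b" "\<rho> g = \<bar>c\<bar> \<longleftrightarrow> g = - c \<or> g = - d"
    "\<rho> g = \<bar>d\<bar> \<longleftrightarrow> g = a \<or> g = b" for g
    by (simp_all add: \<rho>_def neqs)
  have AE: "k \<in> A - ?E \<longleftrightarrow> k = \<bar>a\<bar> \<or> k = \<bar>b\<bar> \<or> k = \<bar>c\<bar> \<or> k = \<bar>d\<bar>" for k using A by blast
  have lk: "linked n S \<tau> \<rho> (- b) (- a)" "linked n S \<tau> \<rho> (- d) (- c)"
    using linked_free[of "- b" "- a"] linked_free[of "- d" "- c"] A nU by (simp_all add: neqs)
  have lk2: "linked n S \<tau> \<rho> b a"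
    using linked_lone[of b a] A l[of a] l[of b] U n4 by (simp add: neqs)
  have "\<exists>T. packing (burnt_pancake n) S (A - {\<bar>a\<bar>}) T"
  proof (rule packing_by_selection[where E = ?E and \<tau> = \<tau> and \<rho> = \<rho> and Q = "{}" and \<theta> = "\<bar>d\<bar>"])
    fix h t assume h: "h \<in> U" and "t \<in> A - {\<bar>a\<bar>} - ?E"
    then have t: "t = \<bar>b\<bar> \<or> t = \<bar>c\<bar> \<or> t = \<bar>d\<bar>" by blast
    have ex: "\<exists>k\<in>A. k \<noteq> \<bar>h\<bar> \<and> \<tau> h k = t" if "k \<in> A" "k \<noteq> \<bar>h\<bar>" "\<tau> h k = t" for k
      using that by blast
    consider "h = a" "t = \<bar>b\<bar>" | "h = a" "t = \<bar>c\<bar>" | "h = a" "t = \<bar>d\<bar>"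
      | "h = b" "t = \<bar>b\<bar>" | "h = b" "t = \<bar>c\<bar>" | "h = b" "t = \<bar>d\<bar>"
      | "h = c" "t = \<bar>b\<bar>" | "h = c" "t = \<bar>c\<bar>" | "h = c" "t = \<bar>d\<bar>"
      | "h = d" "t = \<bar>b\<bar>" | "h = d" "t = \<bar>c\<bar>" | "h = d" "t = \<bar>d\<bar>"
      using h t unfolding U by blast
    then show "\<exists>k\<in>A. k \<noteq> \<bar>h\<bar> \<and> \<tau> h k = t"
    proof cases
      case 1 then show ?thesis using ex[OF A(2)] by (simp add: \<tau>a neqs)
    next
      case 2 then show ?thesis using ex[OF A(3)] by (simp add: \<tau>a neqs)
    next
      case 3 then show ?thesis using ex[OF A(4)] by (simp add: \<tau>a neqs)
    next
      case 4 then show ?thesis using ex[OF A(1)] by (simp add: \<tau>b neqs)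
    next
      case 5 then show ?thesis using ex[OF A(4)] by (simp add: \<tau>b neqs)
    next
      case 6 then show ?thesis using ex[OF A(3)] by (simp add: \<tau>b neqs)
    next
      case 7 then show ?thesis using ex[OF A(1)] by (simp add: \<tau>c neqs)
    next
      case 8 then show ?thesis using ex[OF A(4)] by (simp add: \<tau>c neqs)
    next
      case 9 then show ?thesis using ex[OF A(2)] by (simp add: \<tau>c neqs)
    next
      case 10 then show ?thesis using ex[OF A(2)] by (simp add: \<tau>d neqs)
    next
      case 11 then show ?thesis using ex[OF A(3)] by (simp add: \<tau>d neqs)
    next
      case 12 then show ?thesis using ex[OF A(1)] by (simp add: \<tau>d neqs)
    qed
  next
    fix t assume "t \<in> A - {\<bar>a\<bar>} - ?E"
    then consider "t = \<bar>b\<bar>" | "t = \<bar>c\<bar>" | "t = \<bar>d\<bar>" by blast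
    then show "\<exists>g. \<bar>g\<bar> \<in> A - ?E \<and> \<rho> g = t \<and>
        (\<forall>g'. \<bar>g'\<bar> \<in> A - ?E \<and> \<rho> g' = t \<and> g' \<noteq> g \<longrightarrow> linked n S \<tau> \<rho> g' g)"
    proof cases
      case 1
      show ?thesis
      proof (rule rootI[of "- a"])
        show "\<bar>- a\<bar> \<in> A - ?E" unfolding AE by simp
        show "\<rho> (- a) = t" using 1 by (simp add: \<rho>v)
        fix g' assume g': "\<rho> g' = t" "g' \<noteq> - a"
        show "linked n S \<tau> \<rho> g' (- a)"
          using g' lk unfolding 1 \<rho>_eq by blast
      qed
    next
      case 2
      show ?thesis
      proof (rule rootI[of "- c"])
        show "\<bar>- c\<bar> \<in> A - ?E" unfolding AE by simp
        show "\<rho> (- c) = t" using 2 by (simp add: \<rho>v)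
        fix g' assume g': "\<rho> g' = t" "g' \<noteq> - c"
        show "linked n S \<tau> \<rho> g' (- c)"
          using g' lk unfolding 2 \<rho>_eq by blast
      qed
    next
      case 3
      show ?thesis
      proof (rule rootI[of a])
        show "\<bar>a\<bar> \<in> A - ?E" unfolding AE by simp
        show "\<rho> a = t" using 3 by (simp add: \<rho>v)
        fix g' assume g': "\<rho> g' = t" "g' \<noteq> a"
        show "linked n S \<tau> \<rho> g' a"
          using g' lk2 unfolding 3 \<rho>_eq by blast
      qed
    qed
  next
    fix h k assume h: "h \<in> U" and k: "k \<in> A - ?E" "k \<noteq> \<bar>h\<bar>"
    have ex: "\<rho> h = \<tau> h k \<or> (\<exists>g\<in>{k, - k}. lands S \<tau> \<rho> h g (\<tau> h k))"
      if "\<bar>g\<bar> = k" "\<rho> g = \<tau> h k" "g \<in> U \<longrightarrow> \<tau> g \<bar>h\<bar> = \<tau> h k" for g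
    proof -
      have "g \<in> {k, - k}" by (rule abs_pm[OF that(1)])
      moreover have "lands S \<tau> \<rho> h g (\<tau> h k)" using that(2,3) unfolding lands_def by blast
      ultimately show ?thesis by blast
    qed
    consider "h = a" "k = \<bar>b\<bar>" | "h = a" "k = \<bar>c\<bar>" | "h = a" "k = \<bar>d\<bar>"
      | "h = b" "k = \<bar>a\<bar>" | "h = b" "k = \<bar>c\<bar>" | "h = b" "k = \<bar>d\<bar>"
      | "h = c" "k = \<bar>a\<bar>" | "h = c" "k = \<bar>b\<bar>" | "h = c" "k = \<bar>d\<bar>"
      | "h = d" "k = \<bar>a\<bar>" | "h = d" "k = \<bar>b\<bar>" | "h = d" "k = \<bar>c\<bar>"
      using h k unfolding U AE by blast
    then show "\<rho> h = \<tau> h k \<or> (\<exists>g\<in>{k, - k}. lands S \<tau> \<rho> h g (\<tau> h k))"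
    proof cases
      case 1 show ?thesis using nU by (intro ex[of "- b"]) (simp_all only: 1 abs_minus_cancel \<rho>v \<tau>a simp_thms)
    next
      case 2 show ?thesis using nU by (intro ex[of "- c"]) (simp_all only: 2 abs_minus_cancel \<rho>v \<tau>a simp_thms)
    next
      case 3 show ?thesis by (rule disjI1) (simp only: 3 \<rho>v \<tau>a)
    next
      case 4 show ?thesis using nU by (intro ex[of "- a"]) (simp_all only: 4 abs_minus_cancel \<rho>v \<tau>b simp_thms)
    next
      case 5 show ?thesis by (rule disjI1) (simp only: 5 \<rho>v \<tau>b)
    next
      case 6 show ?thesis using nU by (intro ex[of "- d"]) (simp_all only: 6 abs_minus_cancel \<rho>v \<tau>b simp_thms)
    next
      case 7 show ?thesis using nU by (intro ex[of "- a"]) (simp_all only: 7 abs_minus_cancel \<rho>v \<tau>c simp_thms)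
    next
      case 8 show ?thesis using nU by (intro ex[of b]) (simp_all only: 8 abs_minus_cancel \<rho>v \<tau>c \<tau>b simp_thms)
    next
      case 9 show ?thesis using nU by (intro ex[of "- d"]) (simp_all only: 9 abs_minus_cancel \<rho>v \<tau>c simp_thms)
    next
      case 10 show ?thesis using nU by (intro ex[of a]) (simp_all only: 10 abs_minus_cancel \<rho>v \<tau>d \<tau>a simp_thms)
    next
      case 11 show ?thesis using nU by (intro ex[of "- b"]) (simp_all only: 11 abs_minus_cancel \<rho>v \<tau>d simp_thms)
    next
      case 12 show ?thesis using nU by (intro ex[of "- c"]) (simp_all only: 12 abs_minus_cancel \<rho>v \<tau>d simp_thms)
    qed
  next
    fix g assume g: "g \<in> U" "\<rho> g \<in> A - {\<bar>a\<bar>}"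
    then have "g = a \<or> g = b" unfolding U by (elim insertE) (simp_all add: \<rho>v)
    then show "\<rho> g = \<bar>d\<bar> \<and> lone g" using l[OF g(1)] by (elim disjE) (simp_all add: \<rho>v)
  next
    fix g show "\<rho> g \<notin> ?E" by (simp add: \<rho>_def)
  next
    fix h k assume "h \<in> U" "k \<in> A - ?E" "k \<noteq> \<bar>h\<bar>"
    then have "k \<in> {\<bar>a\<bar>, \<bar>b\<bar>, \<bar>c\<bar>, \<bar>d\<bar>}" unfolding AE by blast
    then have "\<tau> h k \<in> {\<bar>a\<bar>, \<bar>b\<bar>, \<bar>c\<bar>, \<bar>d\<bar>}" unfolding \<tau>_def by (intro if_mem) blast+
    then show "\<tau> h k \<notin> ?E" by blast
  next
    fix h k assume "k \<in> ?E"
    then have "k \<noteq> \<bar>a\<bar>" "k \<noteq> \<bar>b\<bar>" "k \<noteq> \<bar>c\<bar>" "k \<noteq> \<bar>d\<bar>" by blast+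
    then show "\<tau> h k = k" unfolding \<tau>_def by (simp only: if_False simp_thms if_cancel)
  next
    fix h assume "h \<in> U"
    then show "\<bar>h\<bar> \<notin> ?E" unfolding U by blast
  next
    fix x y assume c: "conf x y"
    then show "(x, y) \<in> {} \<or> (y, x) \<in> {} \<or> (\<bar>hd x\<bar> \<notin> ?E \<and> tailed S \<tau> \<rho> x y) \<or>
      (\<bar>hd y\<bar> \<notin> ?E \<and> tailed S \<tau> \<rho> y x)"
      using conf_not_lone[OF c] l[OF conf_colour(5)[OF c]] by blast
  qed auto
  then show ?thesis using A unfolding packable_def by blast
qed

section \<open>Terminals in slices of three colours\<close>

definition cross_labels :: "int \<Rightarrow> int \<Rightarrow> int \<Rightarrow> (int \<Rightarrow> bool) \<Rightarrow> int \<Rightarrow> int \<Rightarrow> int" where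
  "cross_labels a b c sw h k = (if k \<notin> {\<bar>a\<bar>, \<bar>b\<bar>, \<bar>c\<bar>} then k
     else if \<bar>h\<bar> = \<bar>a\<bar> then (if sw h then (if k = \<bar>b\<bar> then \<bar>c\<bar> else \<bar>b\<bar>) else k)
     else if k = \<bar>a\<bar> then \<bar>c\<bar> else \<bar>b\<bar>)"

definition cross_hubs :: "int \<Rightarrow> int \<Rightarrow> int set \<Rightarrow> int \<Rightarrow> int" where
  "cross_hubs b c W g = (if g = - b \<or> g = - c then \<bar>b\<bar> else if g = b \<or> g = c \<or> g \<in> W then \<bar>c\<bar> else 0)"

text \<open>The occupied slices b and c are hubs of the tree of c, and -b and -c are hubs of the
  tree of b. From a slice of the colour of a, the colours of b and c can therefore lead to either
  tree, and \<open>sw\<close> decides which way round. \<open>W\<close> holds further hubs of the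
  tree of c that may join b and c.\<close>

lemma packable_three_colours:
  assumes dist: "\<bar>a\<bar> \<noteq> \<bar>b\<bar>" "\<bar>a\<bar> \<noteq> \<bar>c\<bar>" "\<bar>b\<bar> \<noteq> \<bar>c\<bar>" and a: "\<bar>a\<bar> \<in> A"
    and U: "{b, c} \<subseteq> U" "U \<subseteq> {a, - a, b, c}" and l: "lone b" "lone c"
    and W: "W \<subseteq> {a, - a}" "\<And>g. g \<in> W \<Longrightarrow> g \<in> U \<Longrightarrow> lone g"
    and link: "\<exists>g\<in>{b, c} \<union> W. \<forall>g'\<in>{b, c} \<union> W. g' \<noteq> g \<longrightarrow>
      linked n S (cross_labels a b c sw) (cross_hubs b c W) g' g"
    and Q: "\<And>x y. (x, y) \<in> Q \<Longrightarrow> conf x y \<and> \<bar>hd x\<bar> \<notin> {\<bar>b\<bar>, \<bar>c\<bar>}"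
    and inj: "inj_on (\<lambda>(x, y). \<bar>hd x\<bar>) Q"
    and cover: "\<And>x y. conf x y \<Longrightarrow> (x, y) \<in> Q \<or> (y, x) \<in> Q \<or>
      (\<bar>hd x\<bar> \<in> {\<bar>b\<bar>, \<bar>c\<bar>} \<and> tailed S (cross_labels a b c sw) (cross_hubs b c W) x y) \<or>
      (\<bar>hd y\<bar> \<in> {\<bar>b\<bar>, \<bar>c\<bar>} \<and> tailed S (cross_labels a b c sw) (cross_hubs b c W) y x)"
  shows packable
proof -
  have A: "\<bar>a\<bar> \<in> A" "\<bar>b\<bar> \<in> A" "\<bar>c\<bar> \<in> A" using U_abs U a by auto
  have n0: "a \<noteq> - a" "b \<noteq> - b" "c \<noteq> - c" "b \<noteq> 0" "c \<noteq> 0" using A by auto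
  note nev = dist[THEN abs_neqD(1)] dist[THEN abs_neqD(2)] dist[THEN abs_neqD(3)]
  have "- b \<notin> {a, - a, b, c}" "- c \<notin> {a, - a, b, c}" by (simp_all add: nev nev[symmetric] n0 n0[symmetric])
  then have nU: "- b \<notin> U" "- c \<notin> U" using U(2) by blast+
  have nW: "- b \<notin> W" "- c \<notin> W" "b \<notin> W" "c \<notin> W" using W(1) by (auto simp: nev nev[symmetric] n0)
  let ?E = "A - {\<bar>a\<bar>, \<bar>b\<bar>, \<bar>c\<bar>}"
  let ?\<tau> = "cross_labels a b c sw" and ?\<rho> = "cross_hubs b c W"
  have Uc: "\<bar>h\<bar> = \<bar>a\<bar> \<or> h = b \<or> h = c" if "h \<in> U" for h using that U(2) by auto
  have abs_pm: "\<bar>g\<bar> = k \<Longrightarrow> g \<in> {k, - k}" for g k :: int by auto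
  note neqs = dist dist[symmetric] nev nev[symmetric] n0 n0(1-3)[symmetric]
  note [[linarith_split_limit = 0, linarith_neq_limit = 0]]
  have \<tau>b: "?\<tau> b \<bar>a\<bar> = \<bar>c\<bar>" "?\<tau> b \<bar>c\<bar> = \<bar>b\<bar>" by (simp_all add: cross_labels_def neqs)
  have \<tau>c: "?\<tau> c \<bar>a\<bar> = \<bar>c\<bar>" "?\<tau> c \<bar>b\<bar> = \<bar>b\<bar>" by (simp_all add: cross_labels_def neqs)
  have \<tau>a: "?\<tau> h \<bar>b\<bar> = (if sw h then \<bar>c\<bar> else \<bar>b\<bar>)" "?\<tau> h \<bar>c\<bar> = (if sw h then \<bar>b\<bar> else \<bar>c\<bar>)"
    if "\<bar>h\<bar> = \<bar>a\<bar>" for h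
    by (simp_all add: cross_labels_def that neqs)
  have \<rho>v: "?\<rho> (- b) = \<bar>b\<bar>" "?\<rho> (- c) = \<bar>b\<bar>" "?\<rho> b = \<bar>c\<bar>" "?\<rho> c = \<bar>c\<bar>"
    by (simp_all add: cross_hubs_def neqs)
  have \<rho>_eq: "?\<rho> g = \<bar>b\<bar> \<longleftrightarrow> g = - b \<or> g = - c" "?\<rho> g = \<bar>c\<bar> \<longleftrightarrow> g \<in> {b, c} \<union> W" for g
    using nW by (simp_all add: cross_hubs_def neqs)
  have AE: "k \<in> A - ?E \<longleftrightarrow> k = \<bar>a\<bar> \<or> k = \<bar>b\<bar> \<or> k = \<bar>c\<bar>" for k using A by blast
  have lk: "linked n S ?\<tau> ?\<rho> (- c) (- b)"
    using linked_free[of "- c" "- b"] A nU by (simp add: neqs)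
  have "\<exists>T. packing (burnt_pancake n) S (A - {\<bar>a\<bar>}) T"
  proof (rule packing_by_selection[where E = ?E and \<tau> = ?\<tau> and \<rho> = ?\<rho> and Q = Q and \<theta> = "\<bar>c\<bar>"])
    fix h t assume h: "h \<in> U" and "t \<in> A - {\<bar>a\<bar>} - ?E"
    then have t: "t = \<bar>b\<bar> \<or> t = \<bar>c\<bar>" by blast
    have "\<exists>k\<in>{\<bar>a\<bar>, \<bar>b\<bar>, \<bar>c\<bar>}. k \<noteq> \<bar>h\<bar> \<and> ?\<tau> h k = t"
      using Uc[OF h]
    proof (elim disjE)
      assume ha: "\<bar>h\<bar> = \<bar>a\<bar>"
      show ?thesis using t by (cases "sw h"; elim disjE; simp add: \<tau>a[OF ha] ha neqs)
    next
      assume "h = b"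
      then show ?thesis using t by (elim disjE; simp add: \<tau>b neqs)
    next
      assume "h = c"
      then show ?thesis using t by (elim disjE; simp add: \<tau>c neqs)
    qed
    then show "\<exists>k\<in>A. k \<noteq> \<bar>h\<bar> \<and> ?\<tau> h k = t" using A by blast
  next
    fix t assume "t \<in> A - {\<bar>a\<bar>} - ?E"
    then consider "t = \<bar>b\<bar>" | "t = \<bar>c\<bar>" by blast
    then show "\<exists>g. \<bar>g\<bar> \<in> A - ?E \<and> ?\<rho> g = t \<and>
        (\<forall>g'. \<bar>g'\<bar> \<in> A - ?E \<and> ?\<rho> g' = t \<and> g' \<noteq> g \<longrightarrow> linked n S ?\<tau> ?\<rho> g' g)"
    proof cases
      case 1
      show ?thesis
      proof (rule rootI[of "- b"])
        show "\<bar>- b\<bar> \<in> A - ?E" unfolding AE by simp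
        show "?\<rho> (- b) = t" using 1 by (simp add: \<rho>v)
        fix g' assume g': "?\<rho> g' = t" "g' \<noteq> - b"
        show "linked n S ?\<tau> ?\<rho> g' (- b)"
          using g' lk unfolding 1 \<rho>_eq(1) by blast
      qed
    next
      case 2
      from link show ?thesis
      proof (rule bexE)
        fix g assume g: "g \<in> {b, c} \<union> W"
          "\<forall>g'\<in>{b, c} \<union> W. g' \<noteq> g \<longrightarrow> linked n S ?\<tau> ?\<rho> g' g"
        have "g = b \<or> g = c \<or> g = a \<or> g = - a" using g(1) W(1) by blast
        then have gA: "\<bar>g\<bar> \<in> A - ?E" unfolding AE by (elim disjE) simp_all
        have gt: "?\<rho> g = t" using g(1) unfolding 2 \<rho>_eq(2) .
        show ?thesis
        proof (rule rootI[of g])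
          show "\<bar>g\<bar> \<in> A - ?E" by (rule gA)
          show "?\<rho> g = t" by (rule gt)
          fix g' assume g': "?\<rho> g' = t" "g' \<noteq> g"
          have "g' \<in> {b, c} \<union> W" using g'(1) unfolding 2 \<rho>_eq(2) .
          then show "linked n S ?\<tau> ?\<rho> g' g" using bspec[OF g(2)] g'(2) by blast
        qed
      qed
    qed
  next
    fix h k assume h: "h \<in> U" and k: "k \<in> A - ?E" "k \<noteq> \<bar>h\<bar>"
    have ex: "?\<rho> h = ?\<tau> h k \<or> (\<exists>g\<in>{k, - k}. lands S ?\<tau> ?\<rho> h g (?\<tau> h k))"
      if "\<bar>g\<bar> = k" "?\<rho> g = ?\<tau> h k" "g \<in> U \<longrightarrow> ?\<tau> g \<bar>h\<bar> = ?\<tau> h k" for g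
    proof -
      have "g \<in> {k, - k}" by (rule abs_pm[OF that(1)])
      moreover have "lands S ?\<tau> ?\<rho> h g (?\<tau> h k)" using that(2,3) unfolding lands_def by blast
      ultimately show ?thesis by blast
    qed
    consider "\<bar>h\<bar> = \<bar>a\<bar>" "k = \<bar>b\<bar>" | "\<bar>h\<bar> = \<bar>a\<bar>" "k = \<bar>c\<bar>"
      | "h = b" "k = \<bar>a\<bar>" | "h = b" "k = \<bar>c\<bar>" | "h = c" "k = \<bar>a\<bar>" | "h = c" "k = \<bar>b\<bar>"
      using k Uc[OF h] unfolding AE by metis
    then show "?\<rho> h = ?\<tau> h k \<or> (\<exists>g\<in>{k, - k}. lands S ?\<tau> ?\<rho> h g (?\<tau> h k))"
    proof cases
      case 1
      then show ?thesis
        using ex[of b] ex[of "- b"] nU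
        by (cases "sw h") (simp_all only: 1(2) abs_minus_cancel \<rho>v \<tau>a[OF 1(1)] 1(1) \<tau>b simp_thms if_True if_False)
    next
      case 2
      then show ?thesis
        using ex[of c] ex[of "- c"] nU
        by (cases "sw h") (simp_all only: 2(2) abs_minus_cancel \<rho>v \<tau>a[OF 2(1)] 2(1) \<tau>c simp_thms if_True if_False)
    next
      case 3 show ?thesis by (rule disjI1) (simp only: 3 \<rho>v \<tau>b)
    next
      case 4 show ?thesis using nU by (intro ex[of "- c"]) (simp_all only: 4 abs_minus_cancel \<rho>v \<tau>b simp_thms)
    next
      case 5 show ?thesis by (rule disjI1) (simp only: 5 \<rho>v \<tau>c)
    next
      case 6 show ?thesis using nU by (intro ex[of "- b"]) (simp_all only: 6 abs_minus_cancel \<rho>v \<tau>c simp_thms)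
    qed
  next
    fix g assume g: "g \<in> U" "?\<rho> g \<in> A - {\<bar>a\<bar>}"
    then have "?\<rho> g \<noteq> 0" by (intro notI) simp
    moreover have "?\<rho> g \<noteq> \<bar>b\<bar>" using nU g(1) unfolding \<rho>_eq(1) by blast
    moreover have "?\<rho> g \<in> {\<bar>b\<bar>, \<bar>c\<bar>, 0}" unfolding cross_hubs_def by (intro if_mem) blast+
    ultimately have r: "?\<rho> g = \<bar>c\<bar>" by blast
    then have "g = b \<or> g = c \<or> g \<in> W" by (simp only: \<rho>_eq(2) Un_iff insert_iff empty_iff simp_thms disj_assoc)
    then have "lone g" using l W(2)[OF _ g(1)] by metis
    with r show "?\<rho> g = \<bar>c\<bar> \<and> lone g" by (rule conjI)
  next
    fix g show "?\<rho> g \<notin> ?E" by (simp add: cross_hubs_def)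
  next
    fix h k assume "h \<in> U" "k \<in> A - ?E" "k \<noteq> \<bar>h\<bar>"
    then have k: "k \<in> {\<bar>a\<bar>, \<bar>b\<bar>, \<bar>c\<bar>}" unfolding AE by blast
    have "?\<tau> h k \<in> {\<bar>a\<bar>, \<bar>b\<bar>, \<bar>c\<bar>}" unfolding cross_labels_def by (intro if_mem k) blast+
    then show "?\<tau> h k \<notin> ?E" by blast
  next
    fix h k assume "k \<in> ?E"
    then have "k \<notin> {\<bar>a\<bar>, \<bar>b\<bar>, \<bar>c\<bar>}" by blast
    then show "?\<tau> h k = k" unfolding cross_labels_def by (rule if_P)
  next
    fix h assume "h \<in> U"
    then show "\<bar>h\<bar> \<notin> ?E" using Uc[of h] by blast
  next
    fix x y assume xy: "(x, y) \<in> Q"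
    then have co: "conf x y" "\<bar>hd x\<bar> \<notin> {\<bar>b\<bar>, \<bar>c\<bar>}" using Q by blast+
    have "last x \<noteq> b" "last x \<noteq> c" using conf_not_lone[OF co(1)] l by metis+
    then have "\<bar>last x\<bar> = \<bar>a\<bar>" using Uc[OF conf_colour(5)[OF co(1)]] by blast
    then have "\<bar>hd x\<bar> \<noteq> \<bar>a\<bar>" using conf_colour(3)[OF co(1)] by simp
    then show "conf x y \<and> \<bar>hd x\<bar> \<in> ?E" using co conf_colour(1)[OF co(1)] by blast
  next
    fix x y x' y' assume "(x, y) \<in> Q" "(x', y') \<in> Q" "\<bar>hd x\<bar> = \<bar>hd x'\<bar>"
    from inj_on_selection[OF inj this]
    show "hd x = hd x' \<and> ?\<tau> (last x) \<bar>hd y\<bar> = ?\<tau> (last x') \<bar>hd y'\<bar>" by simp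
  next
    fix x y assume "conf x y"
    then show "(x, y) \<in> Q \<or> (y, x) \<in> Q \<or> (\<bar>hd x\<bar> \<notin> ?E \<and> tailed S ?\<tau> ?\<rho> x y) \<or>
      (\<bar>hd y\<bar> \<notin> ?E \<and> tailed S ?\<tau> ?\<rho> y x)" using cover by blast
  qed auto
  then show ?thesis using A unfolding packable_def by blast
qed

lemma lone_unique:
  assumes "lone g" "x \<in> S" "y \<in> S" "last x = g" "last y = g"
  shows "x = y"
proof -
  obtain w where w: "{z \<in> S. last z = g} = {w}" using assms(1) unfolding lone_def by blast
  have "x \<in> {z \<in> S. last z = g}" "y \<in> {z \<in> S. last z = g}" using assms(2-) by simp_all
  then show ?thesis unfolding w by simp
qed

lemma conf_pair_selection:
  assumes pair: "\<And>x y. conf x y \<Longrightarrow> {x, y} = {s, t}" and B: "conf s t \<Longrightarrow> \<bar>hd s\<bar> \<notin> B \<or> \<bar>hd t\<bar> \<notin> B"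
  shows "\<exists>Q. (\<forall>x y. (x, y) \<in> Q \<longrightarrow> conf x y \<and> \<bar>hd x\<bar> \<notin> B) \<and> inj_on (\<lambda>(x, y). \<bar>hd x\<bar>) Q \<and>
    (\<forall>x y. conf x y \<longrightarrow> (x, y) \<in> Q \<or> (y, x) \<in> Q)"
proof (cases "conf s t")
  case False
  have "\<not> conf x y" for x y
  proof
    assume c: "conf x y"
    then have "(x = s \<and> y = t) \<or> (x = t \<and> y = s)" using pair[OF c] by (simp only: doubleton_eq_iff)
    then show False using c False conf_sym[OF c] by (elim disjE conjE) simp_all
  qed
  then show ?thesis by (intro exI[of _ "{}"]) simp
next
  case True
  define p where "p = (if \<bar>hd s\<bar> \<notin> B then (s, t) else (t, s))"
  have p: "conf (fst p) (snd p) \<and> \<bar>hd (fst p)\<bar> \<notin> B"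
    using True conf_sym[OF True] B[OF True] by (simp add: p_def)
  have c: "(x, y) = p \<or> (y, x) = p" if "conf x y" for x y
  proof -
    have "(x = s \<and> y = t) \<or> (x = t \<and> y = s)" using pair[OF that] by (simp only: doubleton_eq_iff)
    then show ?thesis unfolding p_def by (elim disjE conjE) simp_all
  qed
  show ?thesis
  proof (intro exI[of _ "{p}"] conjI allI impI)
    fix x y assume "(x, y) \<in> {p}"
    then have "x = fst p" "y = snd p" by (simp_all add: prod_eq_iff)
    then show "conf x y" "\<bar>hd x\<bar> \<notin> B" using p by simp_all
  next
    fix x y assume "conf x y"
    then show "(x, y) \<in> {p} \<or> (y, x) \<in> {p}" using c by simp
  qed simp
qed

lemma packable_three_distinct:
  assumes dist: "\<bar>a\<bar> \<noteq> \<bar>b\<bar>" "\<bar>a\<bar> \<noteq> \<bar>c\<bar>" "\<bar>b\<bar> \<noteq> \<bar>c\<bar>" and U: "U = {a, b, c}" and l: "lone b" "lone c"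
    and pair: "\<And>x y. conf x y \<Longrightarrow> {x, y} = {s, t}"
  shows packable
proof -
  have A: "\<bar>a\<bar> \<in> A" "\<bar>b\<bar> \<in> A" "\<bar>c\<bar> \<in> A" using U_abs U by auto
  have aU: "- a \<notin> U" "- b \<notin> U" unfolding U using dist A by auto
  have link: "\<exists>g\<in>{b, c} \<union> {- a}. \<forall>g'\<in>{b, c} \<union> {- a}. g' \<noteq> g \<longrightarrow> linked n S \<tau> \<rho> g' g" for \<tau> \<rho>
    using linked_free[of b "- a" \<tau> \<rho>] linked_free[of c "- a" \<tau> \<rho>] A dist aU l by (intro bexI[of _ "- a"]) auto
  note three = packable_three_colours[where a = a and b = b and c = c and W = "{- a}"]
  have prem: "\<bar>a\<bar> \<in> A" "{b, c} \<subseteq> U" "U \<subseteq> {a, - a, b, c}" "{- a} \<subseteq> {a, - a}"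
    "\<And>g. g \<in> {- a} \<Longrightarrow> g \<in> U \<Longrightarrow> lone g"
    using A U aU by auto
  show ?thesis
  proof (cases "\<bar>hd s\<bar> \<notin> {\<bar>b\<bar>, \<bar>c\<bar>} \<or> \<bar>hd t\<bar> \<notin> {\<bar>b\<bar>, \<bar>c\<bar>} \<or> \<not> conf s t")
    case True
    obtain Q where Q: "\<forall>x y. (x, y) \<in> Q \<longrightarrow> conf x y \<and> \<bar>hd x\<bar> \<notin> {\<bar>b\<bar>, \<bar>c\<bar>}"
      "inj_on (\<lambda>(x, y). \<bar>hd x\<bar>) Q" "\<forall>x y. conf x y \<longrightarrow> (x, y) \<in> Q \<or> (y, x) \<in> Q"
      using conf_pair_selection[OF pair, where B = "{\<bar>b\<bar>, \<bar>c\<bar>}"] True by blast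
    show ?thesis
      by (rule three[OF dist prem(1-3) l prem(4,5) link[of "cross_labels a b c (\<lambda>_. False)"], where Q = Q])
        (use Q in blast)+
  next
    case False
    then have st: "conf s t" by blast
    obtain x y where xy: "conf x y" "\<bar>hd x\<bar> = \<bar>b\<bar>" "\<bar>hd y\<bar> = \<bar>c\<bar>"
      using False st conf_sym[OF st] conf_hd_neq[OF st] by auto
    then have ps: "{x, y} = {s, t}" using pair by blast
    have xU: "last x \<in> U" "last x \<noteq> b" "last x \<noteq> c"
      using conf_colour(5)[OF xy(1)] conf_not_lone[OF xy(1)] l by metis+
    then have lx: "last x = a" using U by blast
    \<comment> \<open>The terminal x leaves for \<open>- hd x\<close>, which is a hub of the tree of
      b if \<open>hd x\<close> is b, and of the tree of c if it is -b. The labels are swapped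
      exactly when this gives the colour of y the label of that tree.\<close>
    define sw where "sw = (\<lambda>h::int. hd x = b)"
    have tl: "tailed S (cross_labels a b c sw) (cross_hubs b c {- a}) x y"
    proof (cases "hd x = b")
      case True
      have "cross_hubs b c {- a} (- b) = \<bar>b\<bar>" by (simp add: cross_hubs_def)
      moreover have "cross_labels a b c sw a \<bar>c\<bar> = \<bar>b\<bar>"
        using True dist by (simp add: cross_labels_def sw_def)
      ultimately show ?thesis using True aU(2) by (simp add: tailed_def lands_def lx xy(3))
    next
      case F: False
      then have hx: "- hd x = b" using xy(2) by auto
      have "b \<noteq> - b" "b \<noteq> - c" using A dist by auto
      then have "cross_hubs b c {- a} b = \<bar>c\<bar>" by (simp add: cross_hubs_def)
      moreover have "cross_labels a b c sw a \<bar>c\<bar> = \<bar>c\<bar>"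
        using F dist by (simp add: cross_labels_def sw_def)
      moreover have "cross_labels a b c sw b \<bar>a\<bar> = \<bar>c\<bar>"
        using dist by (simp add: cross_labels_def)
      ultimately show ?thesis by (simp add: tailed_def lands_def lx xy(3) hx)
    qed
    show ?thesis
    proof (rule three[OF dist prem(1-3) l prem(4,5) link[of "cross_labels a b c sw"], where Q = "{}"])
      fix u v assume "conf u v"
      then have "{u, v} = {x, y}" using pair ps by blast
      then have "(u = x \<and> v = y) \<or> (u = y \<and> v = x)" by (auto simp: doubleton_eq_iff)
      then show "(u, v) \<in> {} \<or> (v, u) \<in> {} \<or>
          (\<bar>hd u\<bar> \<in> {\<bar>b\<bar>, \<bar>c\<bar>} \<and> tailed S (cross_labels a b c sw) (cross_hubs b c {- a}) u v) \<or>
          (\<bar>hd v\<bar> \<in> {\<bar>b\<bar>, \<bar>c\<bar>} \<and> tailed S (cross_labels a b c sw) (cross_hubs b c {- a}) v u)"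
        using tl xy(2) by auto
    qed auto
  qed
qed

text \<open>The slice a holds the only possible conflict. An occupied slice opposite to a counts as
  one of the colour of a, and opposite slices b and -b are hubs of a common tree.\<close>

lemma packable_three_slices:
  assumes U: "U = {a, b, c}" and ne: "a \<noteq> b" "a \<noteq> c" "b \<noteq> c" and l: "lone b" "lone c"
    and two: "card {x \<in> S. last x = a} = 2"
  shows packable
proof -
  obtain s t where st: "{x \<in> S. last x = a} = {s, t}" "s \<noteq> t" using two by (auto simp: card_2_iff)
  have A: "\<bar>a\<bar> \<in> A" using U_abs U by auto
  have pair: "{x, y} = {s, t}" if xy: "conf x y" for x y
  proof -
    have "last x \<in> U" "last x \<noteq> b" "last x \<noteq> c"
      using conf_colour(5)[OF xy] conf_not_lone[OF xy] l by metis+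
    then have "last x = a" using U by blast
    then have "x \<in> {s, t}" "y \<in> {s, t}" unfolding st(1)[symmetric] using confD[OF xy] conf_last[OF xy] by auto
    moreover have "x \<noteq> y" using conf_hd_neq[OF xy] by auto
    ultimately show ?thesis by auto
  qed
  have sel: "\<exists>Q. (\<forall>x y. (x, y) \<in> Q \<longrightarrow> conf x y \<and> \<bar>hd x\<bar> \<notin> {\<beta>}) \<and> inj_on (\<lambda>(x, y). \<bar>hd x\<bar>) Q \<and>
      (\<forall>x y. conf x y \<longrightarrow> (x, y) \<in> Q \<or> (y, x) \<in> Q)" for \<beta>
  proof (rule conf_pair_selection[OF pair])
    assume "conf s t"
    then show "\<bar>hd s\<bar> \<notin> {\<beta>} \<or> \<bar>hd t\<bar> \<notin> {\<beta>}" using conf_hd_neq by fastforce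
  qed
  have bU: "b \<in> U" and cU: "c \<in> U" unfolding U by simp_all
  consider "c = - b" | "b = - a" | "c = - a" | "\<bar>a\<bar> \<noteq> \<bar>b\<bar>" "\<bar>a\<bar> \<noteq> \<bar>c\<bar>" "\<bar>b\<bar> \<noteq> \<bar>c\<bar>"
    unfolding abs_eq_iff using ne by (metis minus_minus)
  then show ?thesis
  proof cases
    case 1
    have ab: "\<bar>a\<bar> \<noteq> \<bar>b\<bar>" using ne 1 by (auto simp: abs_eq_iff)
    obtain Q where Q: "\<forall>x y. (x, y) \<in> Q \<longrightarrow> conf x y \<and> \<bar>hd x\<bar> \<notin> {\<bar>b\<bar>}" "inj_on (\<lambda>(x, y). \<bar>hd x\<bar>) Q"
      "\<forall>x y. conf x y \<longrightarrow> (x, y) \<in> Q \<or> (y, x) \<in> Q"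
      using sel[of "\<bar>b\<bar>"] by (elim exE conjE) (rule that)
    have U': "U = {a, b, - b}" unfolding U 1 by blast
    show ?thesis
      by (rule packable_with_lone_pair[OF ab U' l(1) l(2)[unfolded 1], where Q = Q]) (use Q in blast)+
  next
    case 2
    have ab: "\<bar>a\<bar> \<noteq> \<bar>c\<bar>" using ne 2 by (auto simp: abs_eq_iff)
    obtain Q where Q: "\<forall>x y. (x, y) \<in> Q \<longrightarrow> conf x y \<and> \<bar>hd x\<bar> \<notin> {\<bar>c\<bar>}" "inj_on (\<lambda>(x, y). \<bar>hd x\<bar>) Q"
      "\<forall>x y. conf x y \<longrightarrow> (x, y) \<in> Q \<or> (y, x) \<in> Q"
      using sel[of "\<bar>c\<bar>"] by (elim exE conjE) (rule that)
    have U': "U \<subseteq> {a, - a, c}" unfolding U 2 by blast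
    show ?thesis
      by (rule packable_with_lone[OF A ab U' cU l(2), where Q = Q]) (use Q in blast)+
  next
    case 3
    have ab: "\<bar>a\<bar> \<noteq> \<bar>b\<bar>" using ne 3 by (auto simp: abs_eq_iff)
    obtain Q where Q: "\<forall>x y. (x, y) \<in> Q \<longrightarrow> conf x y \<and> \<bar>hd x\<bar> \<notin> {\<bar>b\<bar>}" "inj_on (\<lambda>(x, y). \<bar>hd x\<bar>) Q"
      "\<forall>x y. conf x y \<longrightarrow> (x, y) \<in> Q \<or> (y, x) \<in> Q"
      using sel[of "\<bar>b\<bar>"] by (elim exE conjE) (rule that)
    have U': "U \<subseteq> {a, - a, b}" unfolding U 3 by blast
    show ?thesis
      by (rule packable_with_lone[OF A ab U' bU l(1), where Q = Q]) (use Q in blast)+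
  next
    case 4
    show ?thesis by (rule packable_three_distinct[OF 4 U l pair])
  qed
qed

text \<open>
  The slices of \<open>b\<close> and \<open>c\<close> cannot always be joined directly when \<open>n = 3\<close>; one of the slices
  \<open>a\<close> and \<open>- a\<close> then serves as a link.
\<close>

lemma packable_lone_three:
  assumes dist: "\<bar>a\<bar> \<noteq> \<bar>b\<bar>" "\<bar>a\<bar> \<noteq> \<bar>c\<bar>" "\<bar>b\<bar> \<noteq> \<bar>c\<bar>" and U: "U = {a, - a, b, c}"
    and l: "\<And>h. h \<in> U \<Longrightarrow> lone h"
  shows packable
proof -
  have A: "\<bar>a\<bar> \<in> A" "\<bar>b\<bar> \<in> A" "\<bar>c\<bar> \<in> A" using U_abs U by auto
  have lbc: "lone b" "lone c" "lone a" "lone (- a)" using l U by auto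
  have n0: "b \<noteq> - b" "b \<noteq> - c" "c \<noteq> - b" "c \<noteq> - c" "a \<noteq> - a" using A dist by auto
  have noconf: "\<not> conf x y" for x y using conf_not_lone l conf_colour(5) by blast
  have main: packable
    if W: "W \<subseteq> {a, - a}" and link: "\<exists>g\<in>{b, c} \<union> W. \<forall>g'\<in>{b, c} \<union> W. g' \<noteq> g \<longrightarrow>
      linked n S (cross_labels a b c sw) (cross_hubs b c W) g' g" for W sw
    by (rule packable_three_colours[where a = a and b = b and c = c and W = W and sw = sw and Q = "{}"])
      (use dist A U l lbc W link noconf in auto)
  obtain y where y: "{x \<in> S. last x = b} = {y}" using lbc by (auto simp: lone_def)
  obtain z where z: "{x \<in> S. last x = c} = {z}" using lbc by (auto simp: lone_def)
  have yS: "y \<in> S" "last y = b" and zS: "z \<in> S" "last z = c" using y z by blast+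
  have prn: "pr n v \<in> slice A (- hd v) \<and> hd (pr n v) = - last v \<and> adj v (pr n v) \<and> pr n (pr n v) = v"
    if "v \<in> sperms A" for v
  proof -
    have lv: "length v = n" "v \<noteq> []" using len ends that by auto
    show ?thesis using pr_full_slice[OF that lv(2)] hd_pr_full[OF lv(2)] pr_pr[of n v] adj_pr[of n v] lv n by simp
  qed
  have direct: packable if "linked n S (cross_labels a b c (\<lambda>_. False)) (cross_hubs b c {}) c b"
    using main[of "{}" "\<lambda>_. False"] that by simp
  show ?thesis
  proof (cases "4 \<le> n")
    case True
    then show ?thesis using direct linked_lone[of c b] A dist lbc by auto
  next
    case False
    then have n3: "n = 3" using n by simp
    \<comment> \<open>A link from b or c into q starts at a vertex with first entry -q, which should
      not be the terminal there. Such a q exists among a and -a unless the terminals y and z begin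
      with opposite entries of this colour.\<close>
    have "(hd y \<noteq> - a \<and> hd z \<noteq> - a) \<or> (hd y \<noteq> a \<and> hd z \<noteq> a) \<or> (hd y = - a \<and> hd z = a) \<or> (hd y = a \<and> hd z = - a)"
      using n0(5) by metis
    then obtain q where qa: "q = a \<or> q = - a"
      and "(hd y \<noteq> - q \<and> hd z \<noteq> - q) \<or> (hd y = - q \<and> hd z = q)"
      using that[of a] that[of "- a"] unfolding minus_minus by blast
    then consider "hd y \<noteq> - q" "hd z \<noteq> - q" | "hd y = - q" "hd z = q" by blast
    then show ?thesis
    proof cases
      case 1
      have q1: "\<bar>q\<bar> = \<bar>a\<bar>" using qa by (elim disjE) simp_all
      have "q \<in> U \<and> lone q" using qa U lbc(3,4) by blast
      with q1 have q: "\<bar>q\<bar> = \<bar>a\<bar>" "q \<in> U" "lone q" by blast+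
      \<comment> \<open>With the labels swapped at q, the vertices of q facing b are owned by the
        tree of c even near the terminal of q; only the terminal itself has to be avoided.\<close>
      define sw where "sw = (\<lambda>h. h = q)"
      let ?\<tau> = "cross_labels a b c sw" and ?\<rho> = "cross_hubs b c {q}"
      have qn: "q \<noteq> - b" "q \<noteq> - c" using abs_neqD(2)[of q b] abs_neqD(2)[of q c] q(1) dist(1,2) by simp_all
      have vals: "?\<rho> b = \<bar>c\<bar>" "?\<rho> c = \<bar>c\<bar>" "?\<rho> q = \<bar>c\<bar>" "?\<tau> b \<bar>a\<bar> = \<bar>c\<bar>" "?\<tau> c \<bar>a\<bar> = \<bar>c\<bar>" "?\<tau> q \<bar>b\<bar> = \<bar>c\<bar>"
        using n0 qn q(1) dist by (simp_all add: cross_hubs_def cross_labels_def sw_def)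
      have own: "v \<in> owned n S ?\<tau> ?\<rho> g"
        if "g = b \<or> g = c" "v \<in> slice A g" "hd v = - q" for v g
      proof -
        have "v \<notin> S"
        proof
          assume "v \<in> S"
          then have "v \<in> {x \<in> S. last x = g}" using that by (simp add: slice_def)
          then have "v = y \<or> v = z" using that(1) y z by blast
          then show False using that(3) 1 by (elim disjE) simp_all
        qed
        moreover have "?\<rho> g = \<bar>c\<bar>" "?\<tau> g \<bar>a\<bar> = \<bar>c\<bar>" using that(1) vals by (elim disjE; simp)+
        ultimately show ?thesis using that(2,3) q(1) by (simp add: owned_def)
      qed
      have "linked n S ?\<tau> ?\<rho> b q"
      proof -
        obtain v1 v2 where v: "v1 \<in> slice A b" "v2 \<in> slice A b" "hd v1 = - q" "hd v2 = - q" "v1 \<noteq> v2"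
          using slice_two[OF finA A1 cardA3, of "- q" b] A(1,2) q(1) dist(1) by (simp only: abs_minus_cancel) blast
        have vA: "v1 \<in> sperms A" "v2 \<in> sperms A" using v(1,2) by (simp_all add: slice_def)
        have lst: "last (pr n v1) = q" "last (pr n v2) = q"
          using prn[OF vA(1)] prn[OF vA(2)] v(3,4) by (simp_all add: slice_def)
        have "pr n v1 \<noteq> pr n v2"
        proof
          assume "pr n v1 = pr n v2"
          then have "pr n (pr n v1) = pr n (pr n v2)" by (rule arg_cong)
          then show False using v(5) prn[OF vA(1)] prn[OF vA(2)] by simp
        qed
        then have "pr n v1 \<notin> S \<or> pr n v2 \<notin> S" using lone_unique[OF q(3)] lst by metis
        then obtain w where w: "w \<in> slice A b" "hd w = - q" "pr n w \<notin> S" using v by blast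
        then have "pr n w \<in> slice A q" "hd (pr n w) = - b" "adj w (pr n w)"
          using prn[of w] by (simp_all add: slice_def)
        moreover from this have "pr n w \<in> owned n S ?\<tau> ?\<rho> q" using w vals by (simp add: owned_def)
        ultimately show ?thesis using own[of b w] w unfolding linked_def by blast
      qed
      moreover have "linked n S ?\<tau> ?\<rho> c q"
      proof (rule linked_sym)
        have "\<bar>q\<bar> \<in> A" "\<bar>- c\<bar> \<in> A" "\<bar>- c\<bar> \<noteq> \<bar>q\<bar>" using A(1,3) q(1) dist(2) by simp_all
        from owned_hd[OF this, of ?\<tau> ?\<rho>] obtain w where w: "w \<in> owned n S ?\<tau> ?\<rho> q" "hd w = - c"
          using q(3) by blast
        then have wq: "w \<in> sperms A" "last w = q" by (simp_all add: owned_def slice_def)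
        then have "pr n w \<in> slice A c" "hd (pr n w) = - q" "adj w (pr n w)"
          using prn[OF wq(1)] wq(2) w(2) by simp_all
        then show "linked n S ?\<tau> ?\<rho> q c" using own[of c "pr n w"] w(1) unfolding linked_def by blast
      qed
      ultimately show ?thesis using main[of "{q}" sw] qa by blast
    next
      case 2
      have q: "\<bar>q\<bar> = \<bar>a\<bar>" using qa by (elim disjE) simp_all
      have A3: "A = {\<bar>a\<bar>, \<bar>b\<bar>, \<bar>c\<bar>}"
      proof (rule sym, rule card_seteq)
        show "card A \<le> card {\<bar>a\<bar>, \<bar>b\<bar>, \<bar>c\<bar>}" using n3 dist by simp
      qed (use A in auto)
      \<comment> \<open>The vertices near y that do not begin with q or -q have q in the middle, and
        those near z have -q there. The word v and its complete reversal carry the opposite signs,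
        so both avoid the neighbourhoods and b and c are linked directly.\<close>
      define v where "v = [- c, - q, b]"
      have vb: "v \<in> slice A b"
        unfolding slice_def A3 sperms_def v_def using q dist dist[symmetric] by auto
      have prv: "pr n v = [- b, q, c]" by (simp add: v_def prefix_reversal_def n3)
      have w: "pr n v \<in> slice A c"
        unfolding slice_def A3 sperms_def prv using q dist dist[symmetric] by auto
      have "\<bar>q\<bar> \<noteq> \<bar>b\<bar>" "\<bar>q\<bar> \<noteq> \<bar>c\<bar>" using q dist by simp_all
      then have q0: "q \<noteq> - q" "q \<noteq> c" "q \<noteq> - c" "q \<noteq> b" "q \<noteq> - b" "- q \<noteq> c" "- q \<noteq> b" "- q \<noteq> - c" "- q \<noteq> - b"
        using qa n0(5) by auto
      have third: "\<exists>p. u = [hd u, p, last u]" if "u \<in> S" for u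
      proof -
        have "length u = Suc (Suc (Suc 0))" using len SD that n3 by auto
        then show ?thesis by (auto simp: length_Suc_conv)
      qed
      have range: "{Suc 0..<Suc (Suc (Suc 0))} = {1, 2}" by auto
      obtain p where p: "y = [- q, p, b]" using third[OF yS(1)] yS(2) 2(1) by auto
      obtain r where r: "z = [q, r, c]" using third[OF zS(1)] zS(2) 2(2) by auto
      have "v \<notin> near y"
        using q0 by (auto simp: near_def v_def p range prefix_reversal_def)
      then have vh: "v \<notin> hood S" using hood_lone[OF y] vb by (simp add: slice_def)
      have "pr n v \<notin> near z"
        unfolding prv near_def r using q0 by (auto simp: range prefix_reversal_def)
      then have wh: "pr n v \<notin> hood S" using hood_lone[OF z] w by (simp add: slice_def)
      have "v \<in> sperms A" using vb by (simp add: slice_def)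
      then have "linked n S (cross_labels a b c (\<lambda>_. False)) (cross_hubs b c {}) b c"
        using owned_avoiding[OF vb vh] owned_avoiding[OF w wh] prn[of v] unfolding linked_def by blast
      then show ?thesis using direct linked_sym by blast
    qed
  qed
qed

section \<open>Two occupied slices of different colours\<close>

lemma packable_two_edges:
  assumes ab: "\<bar>a\<bar> \<noteq> \<bar>b\<bar>" and U: "U = {a, b}"
    and c: "conf p q" "conf p' q'" and free: "\<bar>hd p\<bar> \<notin> {\<bar>a\<bar>, \<bar>b\<bar>}" "\<bar>hd p'\<bar> \<notin> {\<bar>a\<bar>, \<bar>b\<bar>}"
    and compat: "\<bar>hd p\<bar> = \<bar>hd p'\<bar> \<Longrightarrow> hd p = hd p' \<and> {\<bar>hd q\<bar>, \<bar>hd q'\<bar>} \<subseteq> {\<bar>a\<bar>, \<bar>b\<bar>}"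
    and edges: "\<And>x y. conf x y \<Longrightarrow> {x, y} = {p, q} \<or> {x, y} = {p', q'}"
  shows packable
proof (rule packable_pairs_aligned[OF ab U, where Q = "{(p, q), (p', q')}"])
  fix x y assume "(x, y) \<in> {(p, q), (p', q')}"
  then show "conf x y \<and> \<bar>hd x\<bar> \<notin> {\<bar>a\<bar>, \<bar>b\<bar>}" using c free by blast
next
  fix x y x' y' assume xy: "(x, y) \<in> {(p, q), (p', q')}" "(x', y') \<in> {(p, q), (p', q')}" "\<bar>hd x\<bar> = \<bar>hd x'\<bar>"
  then consider "x = x'" "y = y'" | "x = p" "y = q" "x' = p'" "y' = q'" | "x = p'" "y = q'" "x' = p" "y' = q"
    by blast
  then show "hd x = hd x' \<and> (\<bar>hd y\<bar> = \<bar>hd y'\<bar> \<or> {\<bar>hd y\<bar>, \<bar>hd y'\<bar>} \<subseteq> {\<bar>a\<bar>, \<bar>b\<bar>})"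
  proof cases
    case 1 then show ?thesis by simp
  next
    case 2 then show ?thesis using compat xy(3) by blast
  next
    case 3
    then have "hd p = hd p' \<and> {\<bar>hd q\<bar>, \<bar>hd q'\<bar>} \<subseteq> {\<bar>a\<bar>, \<bar>b\<bar>}" using compat xy(3) by metis
    then show ?thesis unfolding 3 by simp
  qed
next
  fix x y assume "conf x y"
  from edges[OF this] show "(x, y) \<in> {(p, q), (p', q')} \<or> (y, x) \<in> {(p, q), (p', q')}"
    unfolding doubleton_eq_iff by (elim disjE conjE) simp_all
qed

text \<open>The ends have different colours and neither has that of the slice, so at most one has
  the colour of b and the other can be selected.\<close>

lemma conf_orient:
  assumes c: "conf s t" and l: "last s = a"
  shows "\<exists>p q. conf p q \<and> {p, q} = {s, t} \<and> \<bar>hd p\<bar> \<notin> {\<bar>a\<bar>, \<bar>b\<bar>} \<and> \<bar>hd q\<bar> \<noteq> \<bar>a\<bar>"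
proof -
  have h: "\<bar>hd s\<bar> \<noteq> \<bar>a\<bar>" "\<bar>hd t\<bar> \<noteq> \<bar>a\<bar>" using conf_colour(3,4)[OF c] l by simp_all
  show ?thesis
  proof (cases "\<bar>hd s\<bar> = \<bar>b\<bar>")
    case True
    then have "\<bar>hd t\<bar> \<notin> {\<bar>a\<bar>, \<bar>b\<bar>}" using h conf_hd_neq[OF c] by simp
    then show ?thesis using h conf_sym[OF c] by (intro exI[of _ t] exI[of _ s]) blast
  next
    case False
    then show ?thesis using h c by (intro exI[of _ s] exI[of _ t]) blast
  qed
qed

text \<open>The two conflicts interfere only if the selected ends p and p' have the same colour. If
  q or q' has a colour other than those of a and b, selecting it instead removes the coincidence.
  Otherwise q and q' have the same label under \<open>swap_to\<close>: equal first entries of p and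
  p' are then compatible, and opposite ones are left to
  \<open>packable_pairs_opposed\<close>.\<close>

lemma packable_two_pairs:
  assumes ab: "\<bar>a\<bar> \<noteq> \<bar>b\<bar>" and U: "U = {a, b}"
    and Sa: "{x \<in> S. last x = a} = {s, t}" and Sb: "{x \<in> S. last x = b} = {y, z}"
  shows packable
proof -
  have last_st: "last s = a" "last y = b" using Sa Sb by blast+
  have aU: "h = a \<or> h = b" if "h \<in> U" for h using that unfolding U by blast
  have pair_a: "{u, v} = {s, t}" if c: "conf u v" and "last u = a" for u v
  proof -
    have "u \<in> {s, t}" "v \<in> {s, t}"
      unfolding Sa[symmetric] using confD[OF c] conf_last[OF c] that(2) by simp_all
    moreover have "u \<noteq> v" using conf_hd_neq[OF c] by blast
    ultimately show ?thesis by blast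
  qed
  have pair_b: "{u, v} = {y, z}" if c: "conf u v" and "last u = b" for u v
  proof -
    have "u \<in> {y, z}" "v \<in> {y, z}"
      unfolding Sb[symmetric] using confD[OF c] conf_last[OF c] that(2) by simp_all
    moreover have "u \<noteq> v" using conf_hd_neq[OF c] by blast
    ultimately show ?thesis by blast
  qed
  have one: packable if pair: "\<And>u v. conf u v \<Longrightarrow> {u, v} = {s', t'}" and l: "last s' \<in> {a, b}" for s' t'
  proof -
    have B: "\<bar>hd s'\<bar> \<notin> {\<bar>a\<bar>, \<bar>b\<bar>} \<or> \<bar>hd t'\<bar> \<notin> {\<bar>a\<bar>, \<bar>b\<bar>}" if c: "conf s' t'"
      using conf_hd_neq[OF c] conf_colour(3,4)[OF c] l by (elim insertE emptyE) auto
    have "\<exists>Q. (\<forall>x y. (x, y) \<in> Q \<longrightarrow> conf x y \<and> \<bar>hd x\<bar> \<notin> {\<bar>a\<bar>, \<bar>b\<bar>}) \<and>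
      inj_on (\<lambda>(x, y). \<bar>hd x\<bar>) Q \<and> (\<forall>x y. conf x y \<longrightarrow> (x, y) \<in> Q \<or> (y, x) \<in> Q)"
      by (rule conf_pair_selection) (fact pair B)+
    then obtain Q where Q: "\<forall>x y. (x, y) \<in> Q \<longrightarrow> conf x y \<and> \<bar>hd x\<bar> \<notin> {\<bar>a\<bar>, \<bar>b\<bar>}"
      "inj_on (\<lambda>(x, y). \<bar>hd x\<bar>) Q" "\<forall>x y. conf x y \<longrightarrow> (x, y) \<in> Q \<or> (y, x) \<in> Q"
      by (elim exE conjE) (rule that)
    show ?thesis
    proof (rule packable_pairs_aligned[OF ab U, where Q = Q])
      fix x y x' y' assume "(x, y) \<in> Q" "(x', y') \<in> Q" "\<bar>hd x\<bar> = \<bar>hd x'\<bar>"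
      from inj_on_selection[OF Q(2) this]
      show "hd x = hd x' \<and> (\<bar>hd y\<bar> = \<bar>hd y'\<bar> \<or> {\<bar>hd y\<bar>, \<bar>hd y'\<bar>} \<subseteq> {\<bar>a\<bar>, \<bar>b\<bar>})" by simp
    qed (use Q in blast)+
  qed
  have conf_pair: "conf s' t'" if "conf u v" "{u, v} = {s', t'}" for u v s' t'
    using that(2) that(1) conf_sym[OF that(1)] by (simp only: doubleton_eq_iff) blast
  consider "\<not> conf s t" | "\<not> conf y z" | "conf s t" "conf y z" by blast
  then show ?thesis
  proof cases
    case 1
    then have "{u, v} = {y, z}" if "conf u v" for u v
      using pair_b[OF that] pair_a[OF that] conf_pair[OF that] aU[OF conf_colour(5)[OF that]] by blast
    moreover have "last y \<in> {a, b}" using last_st by blast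
    ultimately show ?thesis by (rule one)
  next
    case 2
    then have "{u, v} = {s, t}" if "conf u v" for u v
      using pair_b[OF that] pair_a[OF that] conf_pair[OF that] aU[OF conf_colour(5)[OF that]] by blast
    moreover have "last s \<in> {a, b}" using last_st by blast
    ultimately show ?thesis by (rule one)
  next
    case 3
    obtain p q where p: "conf p q" "{p, q} = {s, t}" "\<bar>hd p\<bar> \<notin> {\<bar>a\<bar>, \<bar>b\<bar>}" "\<bar>hd q\<bar> \<noteq> \<bar>a\<bar>"
      using conf_orient[OF 3(1) last_st(1), of b] by blast
    obtain p' q' where p': "conf p' q'" "{p', q'} = {y, z}" "\<bar>hd p'\<bar> \<notin> {\<bar>a\<bar>, \<bar>b\<bar>}" "\<bar>hd q'\<bar> \<noteq> \<bar>b\<bar>"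
      using conf_orient[OF 3(2) last_st(2), of a] by blast
    have e: "{u, v} = {p, q} \<or> {u, v} = {p', q'}" if "conf u v" for u v
      unfolding p(2) p'(2) using pair_b[OF that] pair_a[OF that] aU[OF conf_colour(5)[OF that]] by blast
    have e1: "{u, v} = {q, p} \<or> {u, v} = {p', q'}" if "conf u v" for u v
      using e[OF that] by (simp add: insert_commute)
    have e2: "{u, v} = {p, q} \<or> {u, v} = {q', p'}" if "conf u v" for u v
      using e[OF that] by (simp add: insert_commute)
    show ?thesis
    proof (cases "\<bar>hd p\<bar> = \<bar>hd p'\<bar>")
      case False
      then show ?thesis using packable_two_edges[OF ab U p(1) p'(1) p(3) p'(3) _ e] by blast
    next
      case eq: True
      show ?thesis
      proof (cases "\<bar>hd q\<bar> = \<bar>b\<bar> \<and> \<bar>hd q'\<bar> = \<bar>a\<bar>")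
        case False
        then consider "\<bar>hd q\<bar> \<notin> {\<bar>a\<bar>, \<bar>b\<bar>}" | "\<bar>hd q'\<bar> \<notin> {\<bar>a\<bar>, \<bar>b\<bar>}" using p(4) p'(4) by blast
        then show ?thesis
        proof cases
          case 1
          have "\<bar>hd q\<bar> \<noteq> \<bar>hd p'\<bar>" using eq conf_hd_neq[OF p(1)] by simp
          then show ?thesis using packable_two_edges[OF ab U conf_sym[OF p(1)] p'(1) 1 p'(3) _ e1] by blast
        next
          case 2
          have "\<bar>hd p\<bar> \<noteq> \<bar>hd q'\<bar>" using eq conf_hd_neq[OF p'(1)] by simp
          then show ?thesis using packable_two_edges[OF ab U p(1) conf_sym[OF p'(1)] p(3) 2 _ e2] by blast
        qed
      next
        case True
        then have q: "\<bar>hd q\<bar> = \<bar>b\<bar>" "\<bar>hd q'\<bar> = \<bar>a\<bar>" by blast+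
        show ?thesis
        proof (cases "hd p = hd p'")
          case same: True
          have "hd p = hd p' \<and> {\<bar>hd q\<bar>, \<bar>hd q'\<bar>} \<subseteq> {\<bar>a\<bar>, \<bar>b\<bar>}" using same q by blast
          then show ?thesis by (rule packable_two_edges[OF ab U p(1) p'(1) p(3) p'(3) _ e])
        next
          case False
          then have opp: "hd p' = - hd p" using eq abs_eq_iff[of "hd p" "hd p'"] by simp
          have v: "\<bar>hd p\<bar> \<in> A" "\<bar>hd p\<bar> \<noteq> \<bar>a\<bar>" "\<bar>hd p\<bar> \<noteq> \<bar>b\<bar>" using conf_colour(1)[OF p(1)] p(3) by blast+
          show ?thesis
          proof (rule packable_pairs_opposed[OF ab U v])
            fix u w assume "conf u w" "last u = a"
            then have "{u, w} = {p, q}" unfolding p(2) by (rule pair_a)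
            then have "(u = p \<and> w = q) \<or> (u = q \<and> w = p)" by (simp only: doubleton_eq_iff)
            then show "(hd u = hd p \<and> \<bar>hd w\<bar> = \<bar>b\<bar>) \<or> (hd w = hd p \<and> \<bar>hd u\<bar> = \<bar>b\<bar>)"
              using q(1) by blast
          next
            fix u w assume "conf u w" "last u = b"
            then have "{u, w} = {p', q'}" unfolding p'(2) by (rule pair_b)
            then have "(u = p' \<and> w = q') \<or> (u = q' \<and> w = p')" by (simp only: doubleton_eq_iff)
            then show "(hd u = - hd p \<and> \<bar>hd w\<bar> = \<bar>a\<bar>) \<or> (hd w = - hd p \<and> \<bar>hd u\<bar> = \<bar>a\<bar>)"
              using q(2) opp by blast
          qed
        qed
      qed
    qed
  qed
qed

text \<open>At most three terminals share the slice a, so \<open>selection_three\<close> can keep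
  the selected ends away from the colour of b.\<close>

lemma packable_lone_and_rest:
  assumes ab: "\<bar>a\<bar> \<noteq> \<bar>b\<bar>" and U: "U = {a, b}" and l: "lone b" and S4: "card S \<le> 4"
  shows packable
proof -
  obtain w where w: "{x \<in> S. last x = b} = {w}" using l unfolding lone_def by blast
  then have wS: "w \<in> S" "last w = b" by blast+
  have ne: "a \<noteq> b" using ab by blast
  have sub: "{x \<in> S. last x = a} \<subseteq> S - {w}" using wS(2) ne by blast
  have "card {x \<in> S. last x = a} \<le> card (S - {w})" using finite_S by (intro card_mono sub) simp
  then have c3: "card {x \<in> S. last x = a} \<le> 3" using S4 wS(1) by simp
  have fin: "finite {x \<in> S. last x = a}" using finite_S by simp
  have cS: "x \<in> {x \<in> S. last x = a}" if c: "conf x y" for x y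
  proof -
    have "last x \<noteq> b" using conf_not_lone[OF c] l by metis
    then have "last x = a" using conf_colour(5)[OF c] unfolding U by blast
    then show ?thesis using confD[OF c] by simp
  qed
  have "\<exists>Q. (\<forall>(x, y)\<in>Q. conf x y \<and> \<bar>hd x\<bar> \<noteq> \<bar>b\<bar>) \<and> (\<forall>x y. conf x y \<longrightarrow> (x, y) \<in> Q \<or> (y, x) \<in> Q) \<and>
    inj_on (\<lambda>(x, y). \<bar>hd x\<bar>) Q"
    by (rule selection_three[OF fin c3]) (fact cS conf_sym conf_hd_neq conf_hd_inj conf_triangle)+
  then obtain Q where Q: "\<forall>(x, y)\<in>Q. conf x y \<and> \<bar>hd x\<bar> \<noteq> \<bar>b\<bar>"
    "\<forall>x y. conf x y \<longrightarrow> (x, y) \<in> Q \<or> (y, x) \<in> Q" "inj_on (\<lambda>(x, y). \<bar>hd x\<bar>) Q"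
    by (elim exE conjE) (rule that)
  have a: "\<bar>a\<bar> \<in> A" and bU: "b \<in> U" and U': "U \<subseteq> {a, - a, b}" using U_abs[of a] unfolding U by blast+
  show ?thesis
    by (rule packable_with_lone[OF a ab U' bU l _ Q(3)]) (use Q in blast)+
qed

section \<open>Case distinction by the number of occupied slices\<close>

lemma card_by_slices: "card S = (\<Sum>g\<in>U. card {x \<in> S. last x = g})"
  using sum.image_gen[OF finite_S, of "\<lambda>_. 1 :: nat" last] by simp

lemma card_slice_pos: "g \<in> U \<Longrightarrow> 1 \<le> card {x \<in> S. last x = g}"
proof -
  assume "g \<in> U"
  then have "{x \<in> S. last x = g} \<noteq> {}" by blast
  then show ?thesis using finite_S by (simp add: Suc_le_eq card_gt_0_iff)
qed

lemma lone_if_card: "card {x \<in> S. last x = g} = 1 \<Longrightarrow> lone g"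
  unfolding lone_def by (rule card_1_singletonE) blast+

theorem packable_four:
  assumes S4: "card S = 4"
  shows packable
proof -
  let ?k = "\<lambda>g. card {x \<in> S. last x = g}"
  have finU: "finite U" using finite_S by simp
  have sum4: "(\<Sum>g\<in>U. ?k g) = 4" using card_by_slices S4 by simp
  have "card U \<le> (\<Sum>g\<in>U. ?k g)" using sum_mono[of U "\<lambda>_. 1" ?k] card_slice_pos by simp
  moreover have "U \<noteq> {}" using S4 by auto
  then have "0 < card U" using finU by (simp add: card_gt_0_iff)
  ultimately consider "card U = 1" | "card U = 2" | "card U = 3" | "card U = 4" using sum4 by linarith
  then show ?thesis
  proof cases
    case 1
    then obtain a where U: "U = {a}" by (rule card_1_singletonE)
    show ?thesis using packable_antipodal[of a] U_abs[of a] S4 unfolding U by simp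
  next
    case 2
    then obtain a b where U: "U = {a, b}" and ne: "a \<noteq> b" by (meson card_2_iff)
    have aA: "\<bar>a\<bar> \<in> A" using U_abs[of a] unfolding U by blast
    show ?thesis
    proof (cases "\<bar>a\<bar> = \<bar>b\<bar>")
      case True
      then have "b = - a" using ne by (auto simp: abs_eq_iff)
      then show ?thesis using packable_antipodal[OF aA] S4 unfolding U by simp
    next
      case ab: False
      have U': "U = {b, a}" unfolding U by blast
      have s: "?k a + ?k b = 4" using sum4 ne unfolding U by simp
      have "1 \<le> ?k a" "1 \<le> ?k b" using card_slice_pos[of a] card_slice_pos[of b] unfolding U by blast+
      then consider "?k b = 1" | "?k a = 1" | "?k a = 2" "?k b = 2" using s by linarith
      then show ?thesis
      proof cases
        case 1
        show ?thesis using packable_lone_and_rest[OF ab U lone_if_card[OF 1]] S4 by simp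
      next
        case 2
        show ?thesis using packable_lone_and_rest[OF ab[symmetric] U' lone_if_card[OF 2]] S4 by simp
      next
        case 3
        obtain s t where st: "{x \<in> S. last x = a} = {s, t}" using 3(1) by (meson card_2_iff)
        obtain y z where yz: "{x \<in> S. last x = b} = {y, z}" using 3(2) by (meson card_2_iff)
        show ?thesis by (rule packable_two_pairs[OF ab U st yz])
      qed
    qed
  next
    case 3
    then obtain a b c where U: "U = {a, b, c}" and ne: "a \<noteq> b" "a \<noteq> c" "b \<noteq> c" by (metis card_3_iff)
    have U': "U = {b, a, c}" "U = {c, a, b}" unfolding U by blast+
    have s: "?k a + ?k b + ?k c = 4" using sum4 ne unfolding U by simp
    have "1 \<le> ?k a" "1 \<le> ?k b" "1 \<le> ?k c"
      using card_slice_pos[of a] card_slice_pos[of b] card_slice_pos[of c] unfolding U by blast+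
    then consider "?k a = 2" "?k b = 1" "?k c = 1" | "?k b = 2" "?k a = 1" "?k c = 1"
      | "?k c = 2" "?k a = 1" "?k b = 1" using s by linarith
    then show ?thesis
    proof cases
      case 1
      show ?thesis by (rule packable_three_slices[OF U ne lone_if_card[OF 1(2)] lone_if_card[OF 1(3)] 1(1)])
    next
      case 2
      show ?thesis
        by (rule packable_three_slices[OF U'(1) ne(1)[symmetric] ne(3,2) lone_if_card[OF 2(2)] lone_if_card[OF 2(3)] 2(1)])
    next
      case 3
      show ?thesis
        by (rule packable_three_slices[OF U'(2) ne(2)[symmetric] ne(3)[symmetric] ne(1)
            lone_if_card[OF 3(2)] lone_if_card[OF 3(3)] 3(1)])
    qed
  next
    case 4
    have l: "lone h" if h: "h \<in> U" for h
    proof (rule lone_if_card)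
      have "(\<Sum>g\<in>U. ?k g) = ?k h + (\<Sum>g\<in>U - {h}. ?k g)" using finU h by (rule sum.remove)
      moreover have "card (U - {h}) \<le> (\<Sum>g\<in>U - {h}. ?k g)"
        using sum_mono[of "U - {h}" "\<lambda>_. 1" ?k] card_slice_pos by simp
      moreover have "card (U - {h}) = 3" using 4 h by simp
      ultimately have "?k h \<le> 1" using sum4 by linarith
      then show "?k h = 1" using card_slice_pos[OF h] by linarith
    qed
    have U0: "h \<noteq> - h" if "h \<in> U" for h using U_abs[OF that] by auto
    show ?thesis
    proof (cases "\<exists>a\<in>U. - a \<in> U")
      case True
      then obtain a where a: "a \<in> U" "- a \<in> U" by blast
      have "card (U - {a, - a}) = 2" using 4 a U0[OF a(1)] finU by (simp add: card_Diff_subset)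
      then obtain c d where cd: "U - {a, - a} = {c, d}" "c \<noteq> d" by (meson card_2_iff)
      have U: "U = {a, - a, c, d}" using cd(1) a by blast
      have "c \<noteq> a" "c \<noteq> - a" "d \<noteq> a" "d \<noteq> - a" using cd(1) by blast+
      then have ac: "\<bar>a\<bar> \<noteq> \<bar>c\<bar>" and ad: "\<bar>a\<bar> \<noteq> \<bar>d\<bar>" by (auto simp: abs_eq_iff)
      show ?thesis
      proof (cases "\<bar>c\<bar> = \<bar>d\<bar>")
        case True
        then have "d = - c" using cd(2) by (auto simp: abs_eq_iff)
        then have "U = {a, - a, c, - c}" using U by simp
        then show ?thesis by (rule packable_lone_square[OF ac _ l])
      next
        case False
        show ?thesis by (rule packable_lone_three[OF ac ad False U l])
      qed
    next
      case False
      then have neg: "- h \<notin> U" if "h \<in> U" for h using that by blast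
      obtain a where a: "a \<in> U" using \<open>U \<noteq> {}\<close> by blast
      have "card (U - {a}) = 3" using 4 a by simp
      then obtain b c d where bcd: "U - {a} = {b, c, d}" "b \<noteq> c" "c \<noteq> d" "b \<noteq> d" by (metis card_3_iff)
      have U: "U = {a, b, c, d}" using bcd(1) a by blast
      have mem: "a \<in> U" "b \<in> U" "c \<in> U" "d \<in> U" unfolding U by blast+
      have ne: "a \<noteq> b" "a \<noteq> c" "a \<noteq> d" using bcd(1) by blast+
      have abs_ne: "\<bar>g\<bar> \<noteq> \<bar>h\<bar>" if "g \<in> U" "h \<in> U" "g \<noteq> h" for g h
        using neg[OF that(2)] that(1,3) by (metis abs_eq_iff)
      have "distinct [\<bar>a\<bar>, \<bar>b\<bar>, \<bar>c\<bar>, \<bar>d\<bar>]"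
        using abs_ne[OF mem(1,2) ne(1)] abs_ne[OF mem(1,3) ne(2)] abs_ne[OF mem(1,4) ne(3)]
          abs_ne[OF mem(2,3) bcd(2)] abs_ne[OF mem(2,4) bcd(4)] abs_ne[OF mem(3,4) bcd(3)] by simp
      then show ?thesis by (rule packable_four_colours[OF U _ l])
    qed
  qed
qed

end

section \<open>The generalized connectivity\<close>

lemma packing_countable_index:
  assumes P: "packing G S I T" and I: "finite I"
  shows "\<exists>T' :: nat \<Rightarrow> _. packing G S {..<card I} T'"
proof -
  obtain f where f: "bij_betw f {..<card I} I" using ex_bij_betw_nat_finite[OF I] by (auto simp: lessThan_atLeast0)
  then show ?thesis using packing_reindex[OF P, of f "{..<card I}"] by (auto simp: bij_betw_def)
qed

lemma sg_verts_burnt_pancake [simp]: "sg_verts (burnt_pancake n) = sperms {1..int n}"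
  by (simp add: burnt_pancake_def signed_perms_eq)

lemma edges_burnt_pancake: "sg_edges (burnt_pancake n) = induced_edges (sperms {1..int n})"
proof -
  have "(\<exists>i\<in>{1..n}. y = pr i x) \<longleftrightarrow> adj x y" if "x \<in> sperms {1..int n}" for x y
    using length_sperms[OF that] by (simp add: adj_def)
  then have "x \<in> sperms {1..int n} \<and> y \<in> sperms {1..int n} \<and> (\<exists>i\<in>{1..n}. y = pr i x) \<longleftrightarrow>
      x \<in> sperms {1..int n} \<and> y \<in> sperms {1..int n} \<and> adj x y" for x y
    by blast
  then show ?thesis by (simp only: burnt_pancake_def sgraph.select_convs signed_perms_eq induced_edges_def)
qed

lemma degree_burnt_pancake:
  assumes "x \<in> sperms {1..int n}"
  shows "finite {e \<in> sg_edges (burnt_pancake n). x \<in> e}" "card {e \<in> sg_edges (burnt_pancake n). x \<in> e} \<le> n"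
proof -
  have sub: "{e \<in> sg_edges (burnt_pancake n). x \<in> e} \<subseteq> (\<lambda>i. {x, pr i x}) ` {1..n}"
  proof
    fix e assume "e \<in> {e \<in> sg_edges (burnt_pancake n). x \<in> e}"
    then obtain y where "e = {x, y}" "adj x y"
      unfolding edges_burnt_pancake induced_edges_def using adj_sym by blast
    moreover have "length x = n" using length_sperms[OF assms] by simp
    ultimately show "e \<in> (\<lambda>i. {x, pr i x}) ` {1..n}" unfolding adj_def by blast
  qed
  then show "finite {e \<in> sg_edges (burnt_pancake n). x \<in> e}" by (rule finite_subset) simp
  have "card {e \<in> sg_edges (burnt_pancake n). x \<in> e} \<le> card ((\<lambda>i. {x, pr i x}) ` {1..n})"
    using sub by (intro card_mono) simp
  also have "\<dots> \<le> n" using card_image_le[of "{1..n}" "\<lambda>i. {x, pr i x}"] by simp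
  finally show "card {e \<in> sg_edges (burnt_pancake n). x \<in> e} \<le> n" .
qed

text \<open>This settles n = 2, where a spanning tree of the whole graph is enough.\<close>

lemma packing_single_tree:
  assumes n: "2 \<le> n" and S: "S \<subseteq> sperms {1..int n}"
  shows "\<exists>T. packing (burnt_pancake n) S {..<Suc 0} T"
proof -
  let ?V = "sperms {1..int n}"
  have fin: "finite ?V" by (rule finite_sperms) simp
  have conn: "conn_on ?V" using n by (intro conn_on_sperms) auto
  have ne: "?V \<noteq> {}" using sperms_nonempty[of "{1..int n}"] by force
  have edges: "e \<subseteq> ?V \<and> card e = 2" if "e \<in> sg_edges (burnt_pancake n)" for e
    using simple_graph_burnt_pancake[of n] that by (simp add: simple_graph_def)
  obtain F where F: "F \<subseteq> sg_edges (burnt_pancake n)" "sg_tree \<lparr>sg_verts = ?V, sg_edges = F\<rparr>"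
    using spanning_tree[OF fin ne edges] conn unfolding conn_on_def edges_burnt_pancake by blast
  have "S_tree (burnt_pancake n) S \<lparr>sg_verts = ?V, sg_edges = F\<rparr>"
    using F S by (simp add: S_tree_def sg_subgraph_def sg_tree_def)
  then show ?thesis by (intro exI[of _ "\<lambda>_. \<lparr>sg_verts = ?V, sg_edges = F\<rparr>"]) (simp add: packing_def)
qed

lemma packing_lower_bound:
  assumes n: "2 \<le> n" and sub: "S \<subseteq> sperms {1..int n}" and S4: "card S = 4"
  shows "\<exists>T :: nat \<Rightarrow> _. packing (burnt_pancake n) S {..<n - 1} T"
proof (cases "n = 2")
  case True
  then show ?thesis using packing_single_tree[OF n sub] by simp
next
  case False
  then interpret terminals n S using n sub by unfold_locales simp_all
  obtain a T where a: "a \<in> A" "packing (burnt_pancake n) S (A - {a}) T"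
    using packable_four[OF S4] unfolding packable_def by blast
  have "card (A - {a}) = n - 1" using a(1) by simp
  then show ?thesis using packing_countable_index[OF a(2)] by simp
qed

lemma kappa_set_bounds:
  assumes n: "2 \<le> n" and S: "S \<subseteq> sperms {1..int n}" "card S = 4"
  shows "n - 1 \<le> kappa_set (burnt_pancake n) S"
    and "x \<in> S \<Longrightarrow> y \<in> S \<Longrightarrow> adj x y \<Longrightarrow> kappa_set (burnt_pancake n) S \<le> n - 1"
proof -
  let ?R = "{r. \<exists>T :: nat \<Rightarrow> _. packing (burnt_pancake n) S {..<r} T}"
  have "S \<noteq> {}" using S(2) by auto
  then obtain u where u: "u \<in> S" by blast
  then have uV: "u \<in> sperms {1..int n}" using S(1) by blast
  have "r \<le> n" if r: "r \<in> ?R" for r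
  proof -
    obtain T :: "nat \<Rightarrow> _" where "packing (burnt_pancake n) S {..<r} T" using r by blast
    from packing_le_degree[OF this u _ degree_burnt_pancake(1)[OF uV]] degree_burnt_pancake(2)[OF uV] S(2)
    show ?thesis by simp
  qed
  \<comment> \<open>The degree bound makes the set of packing sizes finite, so that
    \<open>Max\<close> is a genuine maximum.\<close>
  then have fin: "finite ?R" by (intro finite_subset[of ?R "{..n}"]) blast+
  show "n - 1 \<le> kappa_set (burnt_pancake n) S"
    unfolding kappa_set_packing using packing_lower_bound[OF n S(1,2)] by (intro Max_ge fin) blast
  assume xy: "x \<in> S" "y \<in> S" "adj x y"
  have V: "x \<in> sperms {1..int n}" "y \<in> sperms {1..int n}" using xy S(1) by blast+
  have e: "{x, y} \<in> sg_edges (burnt_pancake n)" unfolding edges_burnt_pancake induced_edges_iff using V xy(3) by blast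
  have finV: "finite (sg_verts (burnt_pancake n))" using finite_sperms[of "{1..int n}"] by simp
  have "r \<le> n - 1" if r: "r \<in> ?R" for r
  proof -
    obtain T :: "nat \<Rightarrow> _" where "packing (burnt_pancake n) S {..<r} T" using r by blast
    from packing_adjacent_less_degree[OF this xy(1,2) e _ simple_graph_burnt_pancake finV
        degree_burnt_pancake(2)[OF V(1)] degree_burnt_pancake(2)[OF V(2)]] S(2)
    show ?thesis by simp
  qed
  moreover have "?R \<noteq> {}" using packing_lower_bound[OF n S(1,2)] by blast
  ultimately show "kappa_set (burnt_pancake n) S \<le> n - 1"
    unfolding kappa_set_packing using fin by (intro Max.boundedI) blast+
qed

text \<open>Four consecutive vertices obtained by alternating reversals of lengths 1 and 2 exist
  already for n = 2; they witness that the minimum is attained.\<close>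

lemma four_set_with_edge:
  assumes n: "2 \<le> n"
  shows "\<exists>S x y. S \<subseteq> sperms {1..int n} \<and> card S = 4 \<and> x \<in> S \<and> y \<in> S \<and> adj x y"
proof -
  define x where "x = [1..int n]"
  have x: "x \<in> signed_perms n" by (simp add: x_def signed_perms_def permutations_of_set_def distinct_map inj_on_def)
  have x12: "x = 1 # 2 # [3..int n]" unfolding x_def using n by (subst upto_rec1, simp, subst upto_rec1) simp_all
  let ?S = "{x, pr 1 x, pr 2 x, pr 1 (pr 2 x)}"
  have "?S \<subseteq> sperms {1..int n}"
    unfolding signed_perms_eq[symmetric] using x prefix_reversal_in_signed_perms by blast
  moreover have "card ?S = 4" by (simp add: x12 prefix_reversal_def card_insert_if)
  moreover have "adj x (pr 1 x)" by (auto simp: adj_def x12)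
  ultimately show ?thesis by (intro exI[of _ ?S] exI[of _ x] exI[of _ "pr 1 x"] conjI insertI1 insertI2)
qed

theorem theorem1p1:
  fixes n :: nat
  assumes "n \<ge> 2"
  shows "gen_connectivity 4 (burnt_pancake n) = n - 1"
proof -
  let ?K = "{kappa_set (burnt_pancake n) S |S. S \<subseteq> sg_verts (burnt_pancake n) \<and> card S = 4}"
  have lower: "n - 1 \<le> k" if "k \<in> ?K" for k using that kappa_set_bounds(1)[OF assms] by auto
  obtain S x y where S: "S \<subseteq> sperms {1..int n}" "card S = 4" "x \<in> S" "y \<in> S" "adj x y"
    using four_set_with_edge[OF assms] by blast
  have "kappa_set (burnt_pancake n) S = n - 1"
    using kappa_set_bounds[OF assms S(1,2)] S(3-5) by (intro antisym) blast+
  then have "n - 1 \<in> ?K" using S(1,2) by (intro CollectI exI[of _ S]) simp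
  moreover have "finite ?K"
  proof (rule finite_subset)
    show "?K \<subseteq> kappa_set (burnt_pancake n) ` Pow (sperms {1..int n})"
    proof
      fix k assume "k \<in> ?K"
      then obtain S' where "k = kappa_set (burnt_pancake n) S'" "S' \<subseteq> sperms {1..int n}"
        unfolding sg_verts_burnt_pancake by blast
      then show "k \<in> kappa_set (burnt_pancake n) ` Pow (sperms {1..int n})" by (intro image_eqI) blast+
    qed
    show "finite (kappa_set (burnt_pancake n) ` Pow (sperms {1..int n}))"
      using finite_sperms[of "{1..int n}"] by simp
  qed
  ultimately show ?thesis unfolding gen_connectivity_def using lower by (intro Min_eqI) blast+
qed

end
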